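(* Let $\{(\sigma^k,s^k,y^k)\}$ be generated by the modified ADMM algorithm described in the context with penalty parameter $\beta>\max\{\beta_0,\beta_1\}$, where $$\beta_0=\max\{4C_0C_s^2,\,2\sqrt2\,C_0C_s^2\}\,h^{-1},\qquad \beta_1=2C_0C_s^2\,h^{-1}.$$ Then: (a) $\{L^h_{\alpha,\beta}(\sigma^k,s^k,y^k)\}$ is decreasing, and hence has a limit. (b) $\lim_{k\to\infty}\|s^k-\sigma^k\|_{L^2(\Omega_C)}=0$. (c) If $(\sigma^*,s^*,y^* )$ is any limit point of $\{(\sigma^k,s^k,y^k)\}$ (in $L^2(\Omega_C)\times L^2(\Omega_C)\times L^2(\Omega_C)$), then $$y^*=G_h'(\sigma^* ),\qquad s^*-\sigma^*=0,\qquad s^*\in\arg\min_{s\in K_h}\ \alpha\|\nabla s\|_{L^1(\Omega_C)}+(G_h'(\sigma^* ),s).$$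
   Context: Setting (fixed throughout). $\Omega\subset\mathbb R^3$ is a convex bounded domain consisting of a non-conducting part $\Omega_0$ and a conducting part $\Omega_C=\Omega_1\cup\overline{\Omega}_2$, both polyhedral. $\Gamma$ is the upper boundary of $\Omega$ (part of $\partial\Omega_0$), $\Gamma_D$ is the rest of $\partial\Omega$, and $n$ is the unit outer normal. $\mu>0$ is constant, $\varepsilon>0$ is the permittivity in $\Omega_0$, $\omega>0$ is the angular frequency, $\mathbf J_s\in L^2(\Omega)^3$ with $\nabla\cdot\mathbf J_s=0$ in $\Omega$. The background conductivity $\sigma_0$ vanishes in $\Omega_0$ and is a positive constant in $\Omega_C$. $\mathbf E^{obs}\times n\in L^2(\Gamma)^3$ is the given data. Conductivities are real-valued and extended by zero outside $\Omega_C$. $H_\Gamma(\mathrm{curl};\Omega)=\{\mathbf u\in L^2(\Omega)^3:\nabla\times\mathbf u\in L^2(\Omega)^3,\ n\times\mathbf u=0\text{ on }\Gamma_D\}$, $H^1_\Gamma(\Omega_0)=\{v\in H^1(\Omega_0): v=0\text{ on }\partial\Omega_0\setminus\Gamma\}$ (complex-valued). Discretization. $\mathcal M_h$ is a shape regular, quasi-uniform tetrahedral mesh of $\Omega$ of mesh size $h$, with sub-meshes $\mathcal M_0,\mathcal M_C$ fitting $\Omega_0,\Omega_C$. $R_h\subset H_\Gamma(\mathrm{curl};\Omega)$ is the lowest-order Nédélec edge element space; $U_h\subset H^1_\Gamma(\Omega_0)$ and $V_h\subset H^1_0(\Omega_C)$ (real-valued) are the linear Lagrange element spaces on $\mathcal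 M_0$ and $\mathcal M_C$. With $M>m>-\sigma_0|_{\Omega_C}$, let $K=\{\sigma\in BV(\Omega_C):\sigma\text{ compactly supported in }\Omega_C,\ m\le\sigma\le M\}$ and $K_h=V_h\cap K$. For $\sigma_h\in K_h$ put $a_h(\mathbf E_h,\mathbf F_h)=\int_\Omega\mu^{-1}\nabla\times\mathbf E_h\cdot\nabla\times\overline{\mathbf F_h}-i\omega(\sigma_h+\sigma_0)\mathbf E_h\cdot\overline{\mathbf F_h}\,dx$ and $b(\mathbf E,\mathbf F)=\int_{\Omega_0}\varepsilon\mathbf E\cdot\overline{\mathbf F}\,dx$. The discrete state $\mathbf E_h=\mathbf E_h(\sigma_h)\in R_h$, together with $\phi_h\in U_h$, solves $a_h(\mathbf E_h,\mathbf F_h)+b(\nabla\phi_h,\mathbf F_h)=i\omega\int_\Omega\mathbf J_s\cdot\overline{\mathbf F_h}\,dx$ for all $\mathbf F_h\in R_h$, and $b(\mathbf E_h,\nabla\psi_h)=0$ for all $\psi_h\in U_h$. The discrete adjoint state $\mathbf F_h=\mathbf F_h(\sigma_h)\in R_h$, together with $\psi_h\in U_h$, solves $a_h(\mathbf F_h,\tilde{\mathbf E}_h)+b(\nabla\psi_h,\tilde{\mathbf E}_h)=\int_\Gamma (n\times\overline{(\mathbf E^{obs}-\mathbf E_h)})\times n\cdot\overline{\tilde{\mathbf E}_h}\,ds$ for all $\tilde{\mathbf E}_h\in R_h$, and $b(\mathbf F_h,\nabla\tilde\phi_h)=0$ for all $\tilde\phi_h\in U_h$. Objective functional: $G_h(\sigma_h)=\frac12\|\mathbf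 E_h(\sigma_h)\times n-\mathbf E^{obs}\times n\|_{L^2(\Gamma)}^2$. Its gradient is the function $G_h'(\sigma_h)=\omega\,\mathrm{Im}(\mathbf E_h(\sigma_h)\cdot\mathbf F_h(\sigma_h))$ on $\Omega_C$ (no conjugation in the dot product), which represents directional derivatives: $(G_h'(\sigma_h),\tilde\sigma_h)=\lim_{t\downarrow0}(G_h(\sigma_h+t\tilde\sigma_h)-G_h(\sigma_h))/t$ whenever $\sigma_h+t\tilde\sigma_h\in K_h$ for some $t>0$; $(\cdot,\cdot)$ is the $L^2(\Omega_C)$ inner product. Constants. $C_s>0$ is a constant, depending only on the shape regularity of the mesh, with $\|v_h\|_{L^2(\Omega_C)}\le C_sh\|\nabla v_h\|_{L^2(\Omega_C)}$ for all $v_h\in V_h$. $C_0>0$ is a constant, depending only on the shape regularity of the mesh, $\mathbf J_s$, $K_h$ and $\mathbf E^{obs}$, such that for all $\sigma_h^1,\sigma_h^2\in K_h$ and all $\tilde\sigma_h\in V_h$ with $\sigma_h^1+t\tilde\sigma_h,\ \sigma_h^2+t\tilde\sigma_h\in K_h$ for some $t>0$: $(G_h'(\sigma_h^1)-G_h'(\sigma_h^2),\tilde\sigma_h)\le C_0h^{-3}\|\sigma_h^1-\sigma_h^2\|_{L^2(\Omega_C)}\|\tilde\sigma_h\|_{L^2(\Omega_C)}$ and $G_h(\sigma_h^1)-G_h(\sigma_h^2)-(G_h'(\sigma_h^2),\sigma_h^1-\sigma_h^2)\le C_0h^{-3}\|\sigma_h^1-\sigma_h^2\|_{L^2(\Omega_C)}^2$.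 The existence of $C_s$ and $C_0$ is taken as given. Algorithm (modified ADMM). Let $\alpha>0$ (regularization parameter), $\beta>0$ (penalty parameter), and for $\sigma,s\in K_h$, $y\in L^2(\Omega_C)$, $$L^h_{\alpha,\beta}(\sigma,s,y)=G_h(\sigma)+\alpha\|\nabla s\|_{L^1(\Omega_C)}+(y,s-\sigma)+\tfrac\beta2\|\nabla s-\nabla\sigma\|_{L^2(\Omega_C)}^2 .$$ Given initial values $\sigma^0,s^0\in K_h$ and $y^0$, for $k=0,1,2,\dots$ let $\sigma^{k+1}$ be a minimizer over $\sigma\in K_h$ of $L^h_{\alpha,\beta}(\sigma,s^k,y^k)$, let $s^{k+1}$ be a minimizer over $s\in K_h$ of $L^h_{\alpha,\beta}(\sigma^{k+1},s,y^k)$, and set $y^{k+1}=G_h'(\sigma^{k+1})$.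
   Formalization: In (a), the decrease is claimed from k=1 on for arbitrary y^0, and from k=0 only if y^0 = G_h'(σ^0); for arbitrary y^0 the step from k=0 to k=1 can increase the Lagrangian. Convergence of the Lagrangian, (b) and (c) hold for every y^0. *)

theory Defs
  imports "HOL-Analysis.Analysis"
begin

type_synonym R3 = "real^3"
type_synonym C3 = "complex^3"

section \<open>Vector calculus\<close>

text \<open>The dot product is bilinear; conjugation is always written explicitly.\<close>

definition cdot :: "C3 \<Rightarrow> C3 \<Rightarrow> complex" where
  "cdot a b = (\<Sum>i\<in>UNIV. a $ i * b $ i)"

definition ccross :: "C3 \<Rightarrow> C3 \<Rightarrow> C3" where
  "ccross a b = vector [a$2 * b$3 - a$3 * b$2, a$3 * b$1 - a$1 * b$3, a$1 * b$2 - a$2 * b$1]"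

definition cconj :: "C3 \<Rightarrow> C3" where
  "cconj a = (\<chi> i. cnj (a $ i))"

definition cvec :: "R3 \<Rightarrow> C3" where
  "cvec v = (\<chi> i. complex_of_real (v $ i))"

definition partial :: "3 \<Rightarrow> (R3 \<Rightarrow> 'b::real_normed_vector) \<Rightarrow> R3 \<Rightarrow> 'b" where
  "partial i f x = frechet_derivative f (at x) (axis i 1)"

definition grad :: "(R3 \<Rightarrow> 'b::real_normed_vector) \<Rightarrow> R3 \<Rightarrow> 'b^3" where
  "grad f x = (\<chi> i. partial i f x)"

definition divg :: "(R3 \<Rightarrow> R3) \<Rightarrow> R3 \<Rightarrow> real" where
  "divg f x = (\<Sum>i\<in>UNIV. partial i f x $ i)"

definition curl :: "(R3 \<Rightarrow> C3) \<Rightarrow> R3 \<Rightarrow> C3" where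
  "curl E x = vector [partial 2 E x $ 3 - partial 3 E x $ 2,
                      partial 3 E x $ 1 - partial 1 E x $ 3,
                      partial 1 E x $ 2 - partial 2 E x $ 1]"

section \<open>Function spaces\<close>

definition L2 :: "'a measure \<Rightarrow> ('a \<Rightarrow> 'b::{real_normed_vector, second_countable_topology}) set" where
  "L2 N = {f. f \<in> borel_measurable N \<and> integrable N (\<lambda>x. (norm (f x))\<^sup>2)}"

definition L2norm :: "'a measure \<Rightarrow> ('a \<Rightarrow> 'b::real_normed_vector) \<Rightarrow> real" where
  "L2norm N f = sqrt (LINT x|N. (norm (f x))\<^sup>2)"

definition C1c :: "R3 set \<Rightarrow> (R3 \<Rightarrow> 'b::real_normed_vector) set" where
  "C1c S = {f. (\<exists>D :: R3 \<Rightarrow> (R3 \<Rightarrow>\<^sub>L 'b). continuous_on UNIV D \<and>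
                   (\<forall>x. (f has_derivative blinfun_apply (D x)) (at x))) \<and>
               compact (closure {x. f x \<noteq> 0}) \<and> closure {x. f x \<noteq> 0} \<subseteq> S}"

definition BV :: "R3 set \<Rightarrow> (R3 \<Rightarrow> real) set" where
  "BV D = {u. integrable (lebesgue_on D) u \<and>
              (\<exists>C. \<forall>p\<in>C1c D. (\<forall>x. norm (p x) \<le> 1) \<longrightarrow>
                     (LINT x|lebesgue_on D. u x * divg p x) \<le> C)}"

text \<open>
  \<open>H_curl D G\<close>: fields with square integrable weak curl whose tangential trace vanishes on
  \<open>frontier D - G\<close>. The test fields need not vanish on \<open>frontier D - G\<close>, so the integration by
  parts formula encodes the weak curl and the boundary condition at once.
\<close>

definition H_curl :: "R3 set \<Rightarrow> R3 set \<Rightarrow> (R3 \<Rightarrow> C3) set" where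
  "H_curl D G = {u \<in> L2 (lebesgue_on D). \<exists>w \<in> L2 (lebesgue_on D). \<forall>p\<in>C1c (- closure G).
      (LINT x|lebesgue_on D. cdot (u x) (curl p x)) = (LINT x|lebesgue_on D. cdot (w x) (p x))}"

section \<open>Surface measure and boundary traces\<close>

text \<open>Two-dimensional Hausdorff measure; the factor \<open>pi/4\<close> makes it agree with surface area.\<close>

definition hausdorff2_pre :: "real \<Rightarrow> R3 set \<Rightarrow> ennreal" where
  "hausdorff2_pre d A =
     (INF U\<in>{U :: nat \<Rightarrow> R3 set. A \<subseteq> (\<Union>i. U i) \<and> (\<forall>i. bounded (U i) \<and> diameter (U i) \<le> d)}.
        \<Sum>i. ennreal (pi / 4 * (diameter (U i))\<^sup>2))"

definition hausdorff2 :: "R3 set \<Rightarrow> ennreal" where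
  "hausdorff2 A = (SUP d\<in>{0<..}. hausdorff2_pre d A)"

definition surface_measure :: "R3 set \<Rightarrow> R3 measure" where
  "surface_measure G = restrict_space (measure_of UNIV (sets borel) hausdorff2) G"

text \<open>
  For convex \<open>D\<close> this is the outer normal wherever it is unique, i.e. at almost every boundary
  point; elsewhere the value is irrelevant.
\<close>

definition outer_normal :: "R3 set \<Rightarrow> R3 \<Rightarrow> R3" where
  "outer_normal D x = (THE v. norm v = 1 \<and> (\<forall>y\<in>D. v \<bullet> (y - x) \<le> 0))"

definition bdry_trace :: "R3 set \<Rightarrow> (R3 \<Rightarrow> C3) \<Rightarrow> R3 \<Rightarrow> C3" where
  "bdry_trace D E x = Lim (at x within D) E"

section \<open>The eddy current problem and its mesh\<close>

text \<open>
  \<open>m0\<close> and \<open>m1\<close> are the bounds \<open>m\<close> and \<open>M\<close> of the admissible set, \<open>sigC\<close> is the value of the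
  background conductivity in the conductor, \<open>mesh0\<close> and \<open>meshC\<close> are the sub-meshes.
\<close>

record eddy =
  Om :: "R3 set"
  Om0 :: "R3 set"
  Om1 :: "R3 set"
  Om2 :: "R3 set"
  Gam :: "R3 set"
  mu :: real
  eps :: "R3 \<Rightarrow> real"
  freq :: real
  Js :: "R3 \<Rightarrow> C3"
  sigC :: real
  Eobs :: "R3 \<Rightarrow> C3"
  mesh0 :: "R3 set set"
  meshC :: "R3 set set"
  shape_const :: real
  quasi_const :: real
  m0 :: real
  m1 :: real

definition OmC :: "eddy \<Rightarrow> R3 set" where
  "OmC P = Om1 P \<union> closure (Om2 P)"

definition mesh :: "eddy \<Rightarrow> R3 set set" where
  "mesh P = mesh0 P \<union> meshC P"

definition mesh_size :: "eddy \<Rightarrow> real" where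
  "mesh_size P = Max (diameter ` mesh P)"

definition sigma0 :: "eddy \<Rightarrow> R3 \<Rightarrow> real" where
  "sigma0 P x = (if x \<in> OmC P then sigC P else 0)"

definition ext0 :: "eddy \<Rightarrow> (R3 \<Rightarrow> real) \<Rightarrow> R3 \<Rightarrow> real" where
  "ext0 P s x = (if x \<in> OmC P then s x else 0)"

abbreviation nrm :: "eddy \<Rightarrow> R3 \<Rightarrow> C3" where
  "nrm P x \<equiv> cvec (outer_normal (Om P) x)"

abbreviation muC :: "eddy \<Rightarrow> R3 measure" where
  "muC P \<equiv> lebesgue_on (OmC P)"

abbreviation muG :: "eddy \<Rightarrow> R3 measure" where
  "muG P \<equiv> surface_measure (Gam P)"

definition polyhedral_domain :: "R3 set \<Rightarrow> bool" where
  "polyhedral_domain D \<longleftrightarrow> D \<noteq> {} \<and>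
     (\<exists>Q. finite Q \<and> (\<forall>q\<in>Q. polytope q) \<and> D = interior (\<Union>Q))"

definition valid_domain :: "eddy \<Rightarrow> bool" where
  "valid_domain P \<longleftrightarrow>
     open (Om P) \<and> convex (Om P) \<and> bounded (Om P) \<and>
     polyhedral_domain (Om0 P) \<and> polyhedral_domain (OmC P) \<and>
     Om0 P \<inter> OmC P = {} \<and> closure (Om P) = closure (Om0 P) \<union> closure (OmC P) \<and>
     open (Om1 P) \<and> open (Om2 P) \<and> Om1 P \<inter> Om2 P = {} \<and>
     Gam P \<subseteq> frontier (Om P) \<inter> frontier (Om0 P) \<and>
     (\<exists>F. finite F \<and> F \<noteq> {} \<and> (\<forall>f\<in>F. polytope f \<and> aff_dim f = 2) \<and> Gam P = \<Union>F)"

definition valid_data :: "eddy \<Rightarrow> bool" where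
  "valid_data P \<longleftrightarrow>
     mu P > 0 \<and> freq P > 0 \<and> sigC P > 0 \<and>
     eps P \<in> borel_measurable (lebesgue_on (Om0 P)) \<and>
     (\<exists>c C. 0 < c \<and> (\<forall>x\<in>Om0 P. c \<le> eps P x \<and> eps P x \<le> C)) \<and>
     Js P \<in> L2 (lebesgue_on (Om P)) \<and>
     (\<forall>p \<in> C1c (Om P). (LINT x|lebesgue_on (Om P). cdot (Js P x) (cvec (grad p x))) = 0) \<and>
     (\<lambda>x. ccross (Eobs P x) (nrm P x)) \<in> L2 (muG P) \<and>
     m1 P > m0 P \<and> m0 P > - sigC P"

definition valid_mesh :: "eddy \<Rightarrow> bool" where
  "valid_mesh P \<longleftrightarrow>
     triangulation (mesh P) \<and> (\<forall>T\<in>mesh P. 3 simplex T) \<and> \<Union>(mesh P) = closure (Om P) \<and>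
     \<Union>(mesh0 P) = closure (Om0 P) \<and> \<Union>(meshC P) = closure (OmC P) \<and>
     (\<forall>T\<in>mesh P. \<exists>c. \<exists>r>0. cball c r \<subseteq> T \<and> diameter T \<le> shape_const P * (2 * r)) \<and>
     (\<forall>T\<in>mesh P. mesh_size P \<le> quasi_const P * diameter T)"

section \<open>Finite element spaces\<close>

text \<open>
  Discrete functions are honest functions. Each is given its unique representative: edge element
  fields vanish outside the open tetrahedra, Lagrange functions vanish outside the closed
  (sub-)domain. Classical derivatives, which exist inside every tetrahedron, are then the weak
  derivatives.
\<close>

definition Rh :: "eddy \<Rightarrow> (R3 \<Rightarrow> C3) set" where
  "Rh P = {E \<in> H_curl (Om P) (Gam P).
      (\<forall>T\<in>mesh P. \<exists>a b. \<forall>x\<in>interior T. E x = a + ccross b (cvec x)) \<and>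
      (\<forall>x. x \<notin> (\<Union>T\<in>mesh P. interior T) \<longrightarrow> E x = 0)}"

definition Uh :: "eddy \<Rightarrow> (R3 \<Rightarrow> complex) set" where
  "Uh P = {v. continuous_on (closure (Om0 P)) v \<and>
      (\<forall>T\<in>mesh0 P. \<exists>a b. \<forall>x\<in>T. v x = a + cdot b (cvec x)) \<and>
      (\<forall>x\<in>frontier (Om0 P) - Gam P. v x = 0) \<and>
      (\<forall>x. x \<notin> closure (Om0 P) \<longrightarrow> v x = 0)}"

definition Vh :: "eddy \<Rightarrow> (R3 \<Rightarrow> real) set" where
  "Vh P = {v. continuous_on (closure (OmC P)) v \<and>
      (\<forall>T\<in>meshC P. \<exists>a b. \<forall>x\<in>T. v x = a + b \<bullet> x) \<and>
      (\<forall>x\<in>frontier (OmC P). v x = 0) \<and>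
      (\<forall>x. x \<notin> closure (OmC P) \<longrightarrow> v x = 0)}"

definition Kset :: "eddy \<Rightarrow> (R3 \<Rightarrow> real) set" where
  "Kset P = {s \<in> BV (OmC P).
      (\<exists>C. compact C \<and> C \<subseteq> OmC P \<and> (AE x in muC P. x \<notin> C \<longrightarrow> s x = 0)) \<and>
      (AE x in muC P. m0 P \<le> s x \<and> s x \<le> m1 P)}"

definition Kh :: "eddy \<Rightarrow> (R3 \<Rightarrow> real) set" where
  "Kh P = Vh P \<inter> Kset P"

section \<open>Discrete state, adjoint state, objective and gradient\<close>

definition a_form :: "eddy \<Rightarrow> (R3 \<Rightarrow> real) \<Rightarrow> (R3 \<Rightarrow> C3) \<Rightarrow> (R3 \<Rightarrow> C3) \<Rightarrow> complex" where
  "a_form P s E F = (LINT x|lebesgue_on (Om P).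
      of_real (inverse (mu P)) * cdot (curl E x) (cconj (curl F x))
      - \<i> * of_real (freq P * (ext0 P s x + sigma0 P x)) * cdot (E x) (cconj (F x)))"

definition b_form :: "eddy \<Rightarrow> (R3 \<Rightarrow> C3) \<Rightarrow> (R3 \<Rightarrow> C3) \<Rightarrow> complex" where
  "b_form P E F = (LINT x|lebesgue_on (Om0 P). of_real (eps P x) * cdot (E x) (cconj (F x)))"

definition is_state :: "eddy \<Rightarrow> (R3 \<Rightarrow> real) \<Rightarrow> (R3 \<Rightarrow> C3) \<Rightarrow> (R3 \<Rightarrow> complex) \<Rightarrow> bool" where
  "is_state P s E p \<longleftrightarrow> E \<in> Rh P \<and> p \<in> Uh P \<and>
     (\<forall>F\<in>Rh P. a_form P s E F + b_form P (grad p) F =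
        \<i> * of_real (freq P) * (LINT x|lebesgue_on (Om P). cdot (Js P x) (cconj (F x)))) \<and>
     (\<forall>q\<in>Uh P. b_form P E (grad q) = 0)"

definition Eh :: "eddy \<Rightarrow> (R3 \<Rightarrow> real) \<Rightarrow> R3 \<Rightarrow> C3" where
  "Eh P s = (THE E. \<exists>p. is_state P s E p)"

definition is_adjoint :: "eddy \<Rightarrow> (R3 \<Rightarrow> real) \<Rightarrow> (R3 \<Rightarrow> C3) \<Rightarrow> (R3 \<Rightarrow> complex) \<Rightarrow> bool" where
  "is_adjoint P s F p \<longleftrightarrow> F \<in> Rh P \<and> p \<in> Uh P \<and>
     (\<forall>E\<in>Rh P. a_form P s F E + b_form P (grad p) E =
        (LINT x|muG P.
           cdot (ccross (ccross (nrm P x) (cconj (Eobs P x - bdry_trace (Om P) (Eh P s) x))) (nrm P x))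
                (cconj (bdry_trace (Om P) E x)))) \<and>
     (\<forall>q\<in>Uh P. b_form P F (grad q) = 0)"

definition Fh :: "eddy \<Rightarrow> (R3 \<Rightarrow> real) \<Rightarrow> R3 \<Rightarrow> C3" where
  "Fh P s = (THE F. \<exists>p. is_adjoint P s F p)"

definition Gh :: "eddy \<Rightarrow> (R3 \<Rightarrow> real) \<Rightarrow> real" where
  "Gh P s = 1/2 * (L2norm (muG P)
     (\<lambda>x. ccross (bdry_trace (Om P) (Eh P s) x) (nrm P x) - ccross (Eobs P x) (nrm P x)))\<^sup>2"

definition Gh' :: "eddy \<Rightarrow> (R3 \<Rightarrow> real) \<Rightarrow> R3 \<Rightarrow> real" where
  "Gh' P s x = freq P * Im (cdot (Eh P s x) (Fh P s x))"

text \<open>Without this the \<open>THE\<close> in \<open>Eh\<close> and \<open>Fh\<close> would be meaningless.\<close>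

definition well_posed :: "eddy \<Rightarrow> bool" where
  "well_posed P \<longleftrightarrow> (\<forall>s\<in>Kh P. (\<exists>!(E, p). is_state P s E p) \<and> (\<exists>!(F, p). is_adjoint P s F p))"

definition setting :: "eddy \<Rightarrow> bool" where
  "setting P \<longleftrightarrow> valid_domain P \<and> valid_data P \<and> valid_mesh P \<and> well_posed P"

section \<open>The modified ADMM\<close>

definition ipC :: "eddy \<Rightarrow> (R3 \<Rightarrow> real) \<Rightarrow> (R3 \<Rightarrow> real) \<Rightarrow> real" where
  "ipC P f g = (LINT x|muC P. f x * g x)"

definition grad_L1 :: "eddy \<Rightarrow> (R3 \<Rightarrow> real) \<Rightarrow> real" where
  "grad_L1 P s = (LINT x|muC P. norm (grad s x))"

definition Lagr :: "eddy \<Rightarrow> real \<Rightarrow> real \<Rightarrow> (R3 \<Rightarrow> real) \<Rightarrow> (R3 \<Rightarrow> real) \<Rightarrow> (R3 \<Rightarrow> real) \<Rightarrow> real" where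
  "Lagr P \<alpha> \<beta> \<sigma> s y = Gh P \<sigma> + \<alpha> * grad_L1 P s + ipC P y (\<lambda>x. s x - \<sigma> x)
     + \<beta> / 2 * (L2norm (muC P) (\<lambda>x. grad s x - grad \<sigma> x))\<^sup>2"

definition modified_ADMM ::
  "eddy \<Rightarrow> real \<Rightarrow> real \<Rightarrow> (nat \<Rightarrow> R3 \<Rightarrow> real) \<Rightarrow> (nat \<Rightarrow> R3 \<Rightarrow> real) \<Rightarrow> (nat \<Rightarrow> R3 \<Rightarrow> real) \<Rightarrow> bool" where
  "modified_ADMM P \<alpha> \<beta> \<sigma> s y \<longleftrightarrow>
     \<sigma> 0 \<in> Kh P \<and> s 0 \<in> Kh P \<and> y 0 \<in> L2 (muC P) \<and>
     (\<forall>k. is_arg_min (\<lambda>\<tau>. Lagr P \<alpha> \<beta> \<tau> (s k) (y k)) (\<lambda>\<tau>. \<tau> \<in> Kh P) (\<sigma> (Suc k)) \<and>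
          is_arg_min (\<lambda>t. Lagr P \<alpha> \<beta> (\<sigma> (Suc k)) t (y k)) (\<lambda>t. t \<in> Kh P) (s (Suc k)) \<and>
          (AE x in muC P. y (Suc k) x = Gh' P (\<sigma> (Suc k)) x))"

definition L2_limit_point ::
  "eddy \<Rightarrow> (nat \<Rightarrow> R3 \<Rightarrow> real) \<Rightarrow> (nat \<Rightarrow> R3 \<Rightarrow> real) \<Rightarrow> (nat \<Rightarrow> R3 \<Rightarrow> real) \<Rightarrow>
     (R3 \<Rightarrow> real) \<Rightarrow> (R3 \<Rightarrow> real) \<Rightarrow> (R3 \<Rightarrow> real) \<Rightarrow> bool" where
  "L2_limit_point P \<sigma> s y \<sigma>' s' y' \<longleftrightarrow>
     \<sigma>' \<in> L2 (muC P) \<and> s' \<in> L2 (muC P) \<and> y' \<in> L2 (muC P) \<and>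
     (\<exists>r. strict_mono r \<and>
        (\<lambda>j. L2norm (muC P) (\<lambda>x. \<sigma> (r j) x - \<sigma>' x)) \<longlonglongrightarrow> 0 \<and>
        (\<lambda>j. L2norm (muC P) (\<lambda>x. s (r j) x - s' x)) \<longlonglongrightarrow> 0 \<and>
        (\<lambda>j. L2norm (muC P) (\<lambda>x. y (r j) x - y' x)) \<longlonglongrightarrow> 0)"

text \<open>
  The defining properties of the constants \<open>C\<^sub>s\<close> and \<open>C\<^sub>0\<close>, for the given mesh. A direction is
  admissible at a point of \<open>Kh\<close> if a small step along it stays in \<open>Kh\<close>.
\<close>

definition inverse_Poincare_const :: "eddy \<Rightarrow> real \<Rightarrow> bool" where
  "inverse_Poincare_const P Cs \<longleftrightarrow> Cs > 0 \<and>
     (\<forall>v\<in>Vh P. L2norm (muC P) v \<le> Cs * mesh_size P * L2norm (muC P) (grad v))"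

definition gradient_Lipschitz_const :: "eddy \<Rightarrow> real \<Rightarrow> bool" where
  "gradient_Lipschitz_const P C0 \<longleftrightarrow> C0 > 0 \<and>
     (\<forall>\<sigma>1\<in>Kh P. \<forall>\<sigma>2\<in>Kh P. \<forall>d\<in>Vh P.
        (\<exists>t>0. (\<lambda>x. \<sigma>1 x + t * d x) \<in> Kh P \<and> (\<lambda>x. \<sigma>2 x + t * d x) \<in> Kh P) \<longrightarrow>
        ipC P (\<lambda>x. Gh' P \<sigma>1 x - Gh' P \<sigma>2 x) d
          \<le> C0 / mesh_size P ^ 3 * L2norm (muC P) (\<lambda>x. \<sigma>1 x - \<sigma>2 x) * L2norm (muC P) d) \<and>
     (\<forall>\<sigma>1\<in>Kh P. \<forall>\<sigma>2\<in>Kh P.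
        Gh P \<sigma>1 - Gh P \<sigma>2 - ipC P (Gh' P \<sigma>2) (\<lambda>x. \<sigma>1 x - \<sigma>2 x)
          \<le> C0 / mesh_size P ^ 3 * (L2norm (muC P) (\<lambda>x. \<sigma>1 x - \<sigma>2 x))\<^sup>2)"

end

theory Submission
  imports Defs
begin

text \<open>
  Write \<open>L = C0 / h^3\<close> and \<open>\<kappa> = C0 * Cs^2 / h\<close>, so that \<open>\<beta> > 4 * \<kappa>\<close>, and measure everything by the
  gradient norm, in which \<open>L\<close> turns into \<open>\<kappa>\<close>. Let \<open>(\<sigma>, s)\<close> and \<open>(\<sigma>', s')\<close> be consecutive iterates and
  let \<open>D\<close>, \<open>S\<close> be the norms of \<open>\<sigma> - \<sigma>'\<close> and \<open>s - s'\<close>. Testing the optimality of \<open>\<sigma>'\<close> with \<open>s\<close> shows that the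
  norm of \<open>s - \<sigma>'\<close> is at most \<open>\<kappa> / \<beta> * D\<close>. The \<open>\<sigma>\<close>-step lowers the Lagrangian by at least
  \<open>(\<beta> / 2 - 5 / 4 * \<kappa>) * D^2\<close>, the \<open>s\<close>-step by at least \<open>\<beta> / 2 * S^2\<close>, and the multiplier update raises it
  by at most \<open>\<kappa> * D * (S + \<kappa> / \<beta> * D)\<close>; altogether it drops by at least \<open>\<kappa> * (D^2 / 4 + S^2)\<close>. The
  Lagrangian is nonnegative, hence \<open>D\<close> and \<open>S\<close> tend to zero, and so does \<open>s - \<sigma>\<close>.

  At a limit point the optimality conditions pass to the limit, because admissible functions lie in a
  finite-dimensional space. That the limit of \<open>Gh' \<sigma>\<close> is \<open>Gh' \<sigma>'\<close> needs continuity of the discrete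
  state and adjoint state in the conductivity: both solve a finite linear system whose homogeneous
  version is uniquely solvable at the limit, so solutions stay bounded and converge along a
  subsequence. In the boundary term of the adjoint equation, points lying on two tetrahedra are on
  edges, which are null sets for the surface measure; elsewhere traces are limits of affine functions.
\<close>

section \<open>L2 spaces, cardinal bases and limits of linear systems\<close>

text \<open>\<open>Gh\<close> need not be convex, so minimality of \<open>\<sigma>'\<close> is
  exploited only through a variational inequality along segments of \<open>Kh\<close>. Turning it
  into a drop of the Lagrangian takes a lower bound of \<open>Gh\<close> around
  \<open>\<sigma>'\<close>, whereas the assumed descent inequality bounds \<open>Gh\<close> only
  from above; obtaining that lower bound costs \<open>5/4 * \<kappa> * D^2\<close>. Once
  \<open>y = Gh' \<sigma>\<close>, the inequality tested with \<open>s\<close> compares two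
  gradients, so the size of a gradient itself never enters. Since \<open>y 0\<close> is arbitrary,
  this starts with the first computed multiplier.

  The other obstacle is one of representatives. Limit points are taken in \<open>L2\<close>, while
  \<open>Kh\<close> consists of everywhere defined functions and \<open>Eh\<close>,
  \<open>Fh\<close> are definite descriptions. A limit conductivity is therefore exchanged for a
  function in \<open>Kh\<close> that agrees with it almost everywhere and has the same discrete
  fields; at that function well-posedness is available.\<close>

lemma L2_measurable: "f \<in> L2 N \<Longrightarrow> f \<in> borel_measurable N"
  by (simp add: L2_def)

lemma L2_inner_integrable:
  fixes f g :: "'a \<Rightarrow> 'b::{real_inner, second_countable_topology}"
  assumes "f \<in> L2 N" "g \<in> L2 N"
  shows "integrable N (\<lambda>x. f x \<bullet> g x)"
proof (rule Bochner_Integration.integrable_bound)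
  show "integrable N (\<lambda>x. (norm (f x))\<^sup>2 + (norm (g x))\<^sup>2)"
    using assms by (simp add: L2_def)
  show "(\<lambda>x. f x \<bullet> g x) \<in> borel_measurable N"
    by (intro borel_measurable_inner L2_measurable assms)
  have "\<bar>f x \<bullet> g x\<bar> \<le> (norm (f x))\<^sup>2 + (norm (g x))\<^sup>2" for x
  proof -
    have "\<bar>f x \<bullet> g x\<bar> \<le> norm (f x) * norm (g x)"
      by (rule Cauchy_Schwarz_ineq2)
    moreover have "0 \<le> (norm (f x) - norm (g x))\<^sup>2" "0 \<le> (norm (f x))\<^sup>2" "0 \<le> (norm (g x))\<^sup>2"
      by simp_all
    ultimately show ?thesis
      by (simp add: power2_diff)
  qed
  then show "AE x in N. norm (f x \<bullet> g x) \<le> norm ((norm (f x))\<^sup>2 + (norm (g x))\<^sup>2)"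
    by simp
qed

lemma L2_linear:
  fixes f g :: "'a \<Rightarrow> 'b::{real_inner, second_countable_topology}"
  assumes "f \<in> L2 N" "g \<in> L2 N"
  shows "(\<lambda>x. a *\<^sub>R f x + b *\<^sub>R g x) \<in> L2 N"
proof -
  have "(norm (a *\<^sub>R f x + b *\<^sub>R g x))\<^sup>2 =
      a\<^sup>2 * (f x \<bullet> f x) + 2 * a * b * (f x \<bullet> g x) + b\<^sup>2 * (g x \<bullet> g x)" for x
    unfolding power2_norm_eq_inner
    by (simp add: inner_add_left inner_add_right inner_commute algebra_simps power2_eq_square)
  then have "integrable N (\<lambda>x. (norm (a *\<^sub>R f x + b *\<^sub>R g x))\<^sup>2)"
    using L2_inner_integrable[OF assms] L2_inner_integrable[OF assms(1) assms(1)]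
      L2_inner_integrable[OF assms(2) assms(2)] by simp
  moreover have "(\<lambda>x. a *\<^sub>R f x + b *\<^sub>R g x) \<in> borel_measurable N"
    by (intro borel_measurable_add borel_measurable_scaleR borel_measurable_const L2_measurable assms)
  ultimately show ?thesis
    by (simp add: L2_def)
qed

lemma L2_diff:
  fixes f g :: "'a \<Rightarrow> 'b::{real_inner, second_countable_topology}"
  shows "f \<in> L2 N \<Longrightarrow> g \<in> L2 N \<Longrightarrow> (\<lambda>x. f x - g x) \<in> L2 N"
  using L2_linear[of f N g 1 "-1"] by simp

lemma L2norm_nonneg [simp]: "0 \<le> L2norm N f"
  by (simp add: L2norm_def)

lemma L2norm_power2: "(L2norm N f)\<^sup>2 = (LINT x|N. f x \<bullet> f x)"
  by (simp add: L2norm_def power2_norm_eq_inner)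

lemma L2_Cauchy_Schwarz:
  fixes f g :: "'a \<Rightarrow> 'b::{real_inner, second_countable_topology}"
  assumes "f \<in> L2 N" "g \<in> L2 N"
  shows "\<bar>LINT x|N. f x \<bullet> g x\<bar> \<le> L2norm N f * L2norm N g"
proof -
  define a where "a = (L2norm N f)\<^sup>2"
  define b where "b = (LINT x|N. f x \<bullet> g x)"
  define c where "c = (L2norm N g)\<^sup>2"
  have q: "0 \<le> a * t\<^sup>2 + 2 * b * t + c" for t
  proof -
    have "0 \<le> (LINT x|N. (t *\<^sub>R f x + 1 *\<^sub>R g x) \<bullet> (t *\<^sub>R f x + 1 *\<^sub>R g x))"
      by simp
    also have "\<dots> = (LINT x|N. t\<^sup>2 * (f x \<bullet> f x) + 2 * t * (f x \<bullet> g x) + g x \<bullet> g x)"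
      by (intro Bochner_Integration.integral_cong)
        (simp_all add: inner_add_left inner_add_right inner_commute algebra_simps power2_eq_square)
    also have "\<dots> = t\<^sup>2 * a + 2 * t * b + c"
      unfolding a_def b_def c_def L2norm_power2
      using L2_inner_integrable[OF assms] L2_inner_integrable[OF assms(1) assms(1)]
        L2_inner_integrable[OF assms(2) assms(2)] by simp
    finally show ?thesis
      by (simp add: algebra_simps)
  qed
  have "b\<^sup>2 \<le> a * c"
  proof (cases "a = 0")
    case True
    have "b = 0"
    proof (rule ccontr)
      assume "b \<noteq> 0"
      \<comment> \<open>With \<open>a = 0\<close> the quadratic \<open>q\<close> is affine in
        \<open>t\<close>; at the \<open>t\<close> chosen here it would equal
        \<open>-1\<close>.\<close>
      then have "2 * b * (- (c + 1) / (2 * b)) = - (c + 1)"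
        by simp
      then show False
        using q[of "- (c + 1) / (2 * b)"] True by simp
    qed
    then show ?thesis
      using True by simp
  next
    case False
    then have "a > 0"
      by (simp add: a_def)
    have "0 \<le> a * (a * (- b / a)\<^sup>2 + 2 * b * (- b / a) + c)"
      using q[of "- b / a"] \<open>a > 0\<close> by simp
    also have "\<dots> = a * c - b\<^sup>2"
      using False by (simp add: power2_eq_square field_simps)
    finally show ?thesis
      by simp
  qed
  then have "\<bar>b\<bar>\<^sup>2 \<le> (L2norm N f * L2norm N g)\<^sup>2"
    by (simp add: a_def c_def power_mult_distrib)
  then show ?thesis
    unfolding b_def by (rule power2_le_imp_le) simp
qed

lemma L2norm_add_le:
  fixes f g :: "'a \<Rightarrow> 'b::{real_inner, second_countable_topology}"
  assumes "f \<in> L2 N" "g \<in> L2 N"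
  shows "L2norm N (\<lambda>x. f x + g x) \<le> L2norm N f + L2norm N g"
proof (rule power2_le_imp_le)
  have "(L2norm N (\<lambda>x. f x + g x))\<^sup>2 = (LINT x|N. f x \<bullet> f x + 2 * (f x \<bullet> g x) + g x \<bullet> g x)"
    unfolding L2norm_power2
    by (intro Bochner_Integration.integral_cong)
      (simp_all add: inner_add_left inner_add_right inner_commute)
  also have "\<dots> = (L2norm N f)\<^sup>2 + 2 * (LINT x|N. f x \<bullet> g x) + (L2norm N g)\<^sup>2"
    unfolding L2norm_power2
    using L2_inner_integrable[OF assms] L2_inner_integrable[OF assms(1) assms(1)]
      L2_inner_integrable[OF assms(2) assms(2)] by simp
  also have "\<dots> \<le> (L2norm N f + L2norm N g)\<^sup>2"
    using L2_Cauchy_Schwarz[OF assms] by (simp add: power2_sum)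
  finally show "(L2norm N (\<lambda>x. f x + g x))\<^sup>2 \<le> (L2norm N f + L2norm N g)\<^sup>2" .
qed simp

lemma L2norm_minus_commute: "L2norm N (\<lambda>x. f x - g x) = L2norm N (\<lambda>x. g x - f x)"
  by (simp add: L2norm_def norm_minus_commute)

lemma L2norm_triangle_diff:
  fixes f g h :: "'a \<Rightarrow> 'b::{real_inner, second_countable_topology}"
  assumes "f \<in> L2 N" "g \<in> L2 N" "h \<in> L2 N"
  shows "L2norm N (\<lambda>x. f x - h x) \<le> L2norm N (\<lambda>x. f x - g x) + L2norm N (\<lambda>x. g x - h x)"
  using L2norm_add_le[OF L2_diff[OF assms(1,2)] L2_diff[OF assms(2,3)]] by simp

lemma L2norm_zero_AE:
  fixes f :: "'a \<Rightarrow> 'b::{real_inner, second_countable_topology}"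
  assumes "f \<in> L2 N" "L2norm N f = 0"
  shows "AE x in N. f x = 0"
proof -
  have "(LINT x|N. (norm (f x))\<^sup>2) = 0"
    using assms(2) by (simp add: L2norm_def)
  then have "AE x in N. (norm (f x))\<^sup>2 = 0"
    using assms(1) by (subst (asm) integral_nonneg_eq_0_iff_AE) (auto simp: L2_def)
  then show ?thesis
    by simp
qed

text \<open>Take \<open>Y\<close> to be a minimal unisolvent subset of \<open>X\<close>: dropping \<open>y\<close> frees a function that vanishes
  on \<open>Y - {y}\<close> but not at \<open>y\<close>.\<close>

lemma nodal_basis:
  fixes S :: "('i \<Rightarrow> 'k::field) set"
  assumes lin: "\<And>f g a b. f \<in> S \<Longrightarrow> g \<in> S \<Longrightarrow> (\<lambda>x. a * f x + b * g x) \<in> S"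
    and "finite X"
    and unisolvent: "\<And>f. f \<in> S \<Longrightarrow> (\<forall>x\<in>X. f x = 0) \<Longrightarrow> f = (\<lambda>x. 0)"
  obtains Y e where "Y \<subseteq> X" "\<And>y. y \<in> Y \<Longrightarrow> e y \<in> S"
    "\<And>x y. x \<in> Y \<Longrightarrow> y \<in> Y \<Longrightarrow> e y x = (if x = y then 1 else 0)"
    "\<And>f. f \<in> S \<Longrightarrow> f = (\<lambda>x. \<Sum>y\<in>Y. f y * e y x)"
proof -
  define U where "U Z \<longleftrightarrow> (\<forall>f\<in>S. (\<forall>x\<in>Z. f x = 0) \<longrightarrow> f = (\<lambda>x. 0))" for Z
  have "U X"
    using unisolvent unfolding U_def by blast
  with \<open>finite X\<close> have "\<exists>Y. Y \<subseteq> X \<and> U Y \<and> (\<forall>Z. Z \<subset> Y \<longrightarrow> \<not> U Z)"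
  proof (induction X rule: finite_psubset_induct)
    case (psubset X)
    show ?case
    proof (cases "\<exists>Z. Z \<subset> X \<and> U Z")
      case True
      then obtain Z where "Z \<subset> X" "U Z"
        by blast
      then show ?thesis
        using psubset.IH[of Z] by (meson dual_order.trans psubset_imp_subset)
    qed (use psubset.prems in blast)
  qed
  then obtain Y where Y: "Y \<subseteq> X" "U Y" "\<And>Z. Z \<subset> Y \<Longrightarrow> \<not> U Z"
    by blast
  have "finite Y"
    using Y(1) \<open>finite X\<close> finite_subset by blast
  have "\<exists>g. g \<in> S \<and> g y = 1 \<and> (\<forall>x\<in>Y - {y}. g x = 0)" if "y \<in> Y" for y
  proof -
    have "\<not> U (Y - {y})"
      using that by (intro Y(3)) blast
    then obtain f where f: "f \<in> S" "\<forall>x\<in>Y - {y}. f x = 0" "f \<noteq> (\<lambda>x. 0)"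
      by (auto simp: U_def)
    then have "f y \<noteq> 0"
      using Y(2) unfolding U_def by blast
    then show ?thesis
      using lin[OF f(1) f(1), of "inverse (f y)" 0] f
      by (intro exI[of _ "\<lambda>x. inverse (f y) * f x + 0 * f x"]) auto
  qed
  then obtain e where e: "\<And>y. y \<in> Y \<Longrightarrow> e y \<in> S" "\<And>y. y \<in> Y \<Longrightarrow> e y y = 1"
    "\<And>x y. y \<in> Y \<Longrightarrow> x \<in> Y \<Longrightarrow> x \<noteq> y \<Longrightarrow> e y x = 0"
    by (metis DiffI singletonD)
  have repr: "f = (\<lambda>x. \<Sum>y\<in>Y. f y * e y x)" if "f \<in> S" for f
  proof -
    have residual: "(\<lambda>x. f x - (\<Sum>y\<in>Z. f y * e y x)) \<in> S" if "Z \<subseteq> Y" for Z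
      using finite_subset[OF that \<open>finite Y\<close>] that
    proof (induction Z rule: finite_induct)
      case (insert z Z)
      then show ?case
        using lin[of "\<lambda>x. f x - (\<Sum>y\<in>Z. f y * e y x)" "e z" 1 "- f z"] e(1)
        by (simp add: algebra_simps)
    qed (simp add: \<open>f \<in> S\<close>)
    have vanishes: "f x - (\<Sum>y\<in>Y. f y * e y x) = 0" if "x \<in> Y" for x
    proof -
      have "(\<Sum>y\<in>Y. f y * e y x) = (\<Sum>y\<in>Y. if y = x then f x else 0)"
        using that e by (intro sum.cong) auto
      then show ?thesis
        using that \<open>finite Y\<close> by simp
    qed
    have null: "(\<lambda>x. f x - (\<Sum>y\<in>Y. f y * e y x)) = (\<lambda>x. 0)"
      by (rule Y(2)[unfolded U_def, rule_format, OF residual[OF subset_refl]]) (rule vanishes)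
    show ?thesis
      by (rule ext) (rule eq_iff_diff_eq_0[THEN iffD2, OF fun_cong[OF null]])
  qed
  show thesis
    by (rule that[OF Y(1) e(1) _ repr]) (use e(2,3) in auto)
qed

section \<open>Compactness of coefficients and limits of linear systems\<close>

lemma convergent_coordinates_subseq:
  fixes c :: "nat \<Rightarrow> 'i \<Rightarrow> 'k::heine_borel"
  assumes "finite I" "\<And>i. i \<in> I \<Longrightarrow> bounded (range (\<lambda>j. c j i))"
  shows "\<exists>r l. strict_mono (r :: nat \<Rightarrow> nat) \<and> (\<forall>i\<in>I. (\<lambda>j. c (r j) i) \<longlonglongrightarrow> l i)"
  using assms
proof (induction I rule: finite_induct)
  case empty
  show ?case
    by (auto intro!: exI[of _ id] simp: strict_mono_id simp del: id_apply)
next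
  case (insert i I)
  then obtain r l where r: "strict_mono (r :: nat \<Rightarrow> nat)" "\<forall>i\<in>I. (\<lambda>j. c (r j) i) \<longlonglongrightarrow> l i"
    by blast
  have "bounded (range (\<lambda>j. c (r j) i))"
    using insert.prems[of i] by (rule bounded_subset) auto
  then obtain l' q where q: "strict_mono (q :: nat \<Rightarrow> nat)" "((\<lambda>j. c (r j) i) \<circ> q) \<longlonglongrightarrow> l'"
    using bounded_imp_convergent_subsequence by blast
  have "(\<lambda>j. c (r (q j)) k) \<longlonglongrightarrow> l k" if "k \<in> I" for k
    using LIMSEQ_subseq_LIMSEQ[OF r(2)[rule_format, OF that] q(1)] by (simp add: o_def)
  then show ?case
    using q r(1) insert.hyps
    by (intro exI[of _ "r \<circ> q"] exI[of _ "l(i := l')"])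
      (auto simp: strict_mono_def o_def)
qed

text \<open>If the unknowns were unbounded, dividing them by the sum of their norms would give in
  the limit a nonzero solution of the homogeneous limit system. Only the unknowns are finite in
  number, the rows range over an arbitrary type; injectivity of the limit system takes the place of
  invertibility.\<close>

lemma linear_systems_limit:
  fixes A :: "nat \<Rightarrow> 'm \<Rightarrow> 'i \<Rightarrow> 'k::{heine_borel, real_normed_field}"
  assumes "finite I"
    and A: "\<And>m i. i \<in> I \<Longrightarrow> (\<lambda>j. A j m i) \<longlonglongrightarrow> A' m i"
    and b: "\<And>m. (\<lambda>j. b j m) \<longlonglongrightarrow> b' m"
    and sol: "\<And>j m. (\<Sum>i\<in>I. A j m i * x j i) = b j m"
    and uniq: "\<And>z. (\<And>m. (\<Sum>i\<in>I. A' m i * z i) = 0) \<Longrightarrow> \<forall>i\<in>I. z i = 0"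
  shows "\<exists>r x'. strict_mono (r :: nat \<Rightarrow> nat) \<and> (\<forall>i\<in>I. (\<lambda>j. x (r j) i) \<longlonglongrightarrow> x' i) \<and>
    (\<forall>m. (\<Sum>i\<in>I. A' m i * x' i) = b' m)"
proof -
  define n where "n j = (\<Sum>i\<in>I. norm (x j i))" for j
  have le_n: "norm (x j i) \<le> n j" if "i \<in> I" for i j
    unfolding n_def using that \<open>finite I\<close> by (intro member_le_sum) auto
  have n0: "0 \<le> n j" for j
    by (simp add: n_def sum_nonneg)
  have "Bseq n"
  proof (rule ccontr)
    assume "\<not> Bseq n"
    have big: "\<exists>j>k. n j > C" for k C
    proof (rule ccontr)
      assume "\<not> ?thesis"
      then have "\<forall>j>k. norm (n j) \<le> C"
        using n0 by (metis abs_of_nonneg not_le_imp_less real_norm_def)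
      then have "eventually (\<lambda>j. norm (n j) \<le> C) sequentially"
        unfolding eventually_at_top_dense by blast
      then have "Bfun n sequentially"
        by (rule BfunI)
      then show False
        using \<open>\<not> Bseq n\<close> by simp
    qed
    \<comment> \<open>Recursive choice of indices along which \<open>n\<close> outgrows every bound.
      The first one is chosen with \<open>n > 0\<close>, so that the normalisation \<open>z\<close>
      makes sense for \<open>k = 0\<close> too.\<close>
    define q where "q = rec_nat (SOME j. j > 0 \<and> n j > 0) (\<lambda>k p. SOME j. j > p \<and> n j > real (Suc k))"
    have q: "n (q k) > real k \<and> q (Suc k) > q k" for k
    proof
      show "q (Suc k) > q k"
        unfolding q_def using someI_ex[OF big] by simp
      show "n (q k) > real k"
      proof (cases k)
        case 0
        then show ?thesis
          unfolding q_def using someI_ex[OF big[of 0 0]] by simp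
      next
        case (Suc l)
        then show ?thesis
          unfolding q_def using someI_ex[OF big] by simp
      qed
    qed
    then have "strict_mono q"
      by (simp add: strict_mono_Suc_iff)
    have npos: "n (q k) > 0" for k
      using q[of k] by (meson le_less_trans of_nat_0_le_iff)
    define z where "z k i = inverse (of_real (n (q k))) * x (q k) i" for k i
    have "norm (z k i) \<le> 1" if "i \<in> I" for k i
    proof -
      have "norm (z k i) = norm (x (q k) i) / n (q k)"
        using npos[of k] by (simp add: z_def norm_mult norm_inverse divide_inverse mult.commute)
      also have "\<dots> \<le> 1"
        using le_n[OF that, of "q k"] npos[of k] by simp
      finally show ?thesis .
    qed
    then have "bounded (range (\<lambda>j. z j i))" if "i \<in> I" for i
      using that by (auto simp: bounded_iff)
    then obtain r l where r: "strict_mono (r :: nat \<Rightarrow> nat)" "\<forall>i\<in>I. (\<lambda>j. z (r j) i) \<longlonglongrightarrow> l i"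
      using convergent_coordinates_subseq[OF \<open>finite I\<close>, of z] by blast
    have qr: "strict_mono (q \<circ> r)"
      using \<open>strict_mono q\<close> r(1) by (rule strict_mono_o)
    have "(\<Sum>i\<in>I. A' m i * l i) = 0" for m
    proof -
      have "(\<lambda>j. \<Sum>i\<in>I. A (q (r j)) m i * z (r j) i) \<longlonglongrightarrow> (\<Sum>i\<in>I. A' m i * l i)"
        using r(2) LIMSEQ_subseq_LIMSEQ[OF A qr]
        by (intro tendsto_sum tendsto_mult) (auto simp: o_def)
      moreover have "(\<Sum>i\<in>I. A (q (r j)) m i * z (r j) i) = inverse (of_real (n (q (r j)))) * b (q (r j)) m" for j
        unfolding sol[symmetric] sum_distrib_left z_def by (intro sum.cong) (auto simp: algebra_simps)
      moreover have "(\<lambda>j. inverse (of_real (n (q (r j)))) * b (q (r j)) m) \<longlonglongrightarrow> 0 * b' m"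
      proof (rule tendsto_mult)
        have "filterlim (\<lambda>j. n (q j)) at_top sequentially"
          by (rule filterlim_at_top_mono[OF filterlim_real_sequentially]) (auto intro!: always_eventually less_imp_le simp: q)
        then have "(\<lambda>j. inverse (n (q j))) \<longlonglongrightarrow> 0"
          by (rule tendsto_inverse_0_at_top)
        from LIMSEQ_subseq_LIMSEQ[OF this r(1)]
        have "(\<lambda>j. of_real (inverse (n (q (r j)))) :: 'k) \<longlonglongrightarrow> of_real 0"
          by (intro tendsto_of_real) (simp add: o_def)
        then show "(\<lambda>j. inverse (of_real (n (q (r j)))) :: 'k) \<longlonglongrightarrow> 0"
          by (simp add: of_real_inverse)
        show "(\<lambda>j. b (q (r j)) m) \<longlonglongrightarrow> b' m"
          using LIMSEQ_subseq_LIMSEQ[OF b qr] by (simp add: o_def)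
      qed
      ultimately show ?thesis
        using LIMSEQ_unique by fastforce
    qed
    then have l0: "\<forall>i\<in>I. l i = 0"
      by (rule uniq)
    have "(\<lambda>j. \<Sum>i\<in>I. norm (z (r j) i)) \<longlonglongrightarrow> (\<Sum>i\<in>I. norm (l i))"
      using r(2) by (intro tendsto_sum tendsto_norm) auto
    moreover have "(\<Sum>i\<in>I. norm (z (r j) i)) = 1" for j
      using npos[of "r j"]
      by (simp add: z_def norm_mult norm_inverse sum_distrib_left[symmetric] n_def[symmetric])
    ultimately have "(\<Sum>i\<in>I. norm (l i)) = 1"
      by (simp add: LIMSEQ_const_iff)
    then show False
      using l0 by simp
  qed
  then obtain C where "\<And>j. norm (n j) \<le> C"
    by (auto simp: Bseq_def)
  then have "norm (x j i) \<le> C" if "i \<in> I" for j i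
    using le_n[OF that, of j] by (smt (verit) real_norm_def)
  then have "bounded (range (\<lambda>j. x j i))" if "i \<in> I" for i
    using that by (auto simp: bounded_iff)
  then obtain r l where r: "strict_mono (r :: nat \<Rightarrow> nat)" "\<forall>i\<in>I. (\<lambda>j. x (r j) i) \<longlonglongrightarrow> l i"
    using convergent_coordinates_subseq[OF \<open>finite I\<close>, of x] by blast
  have "(\<Sum>i\<in>I. A' m i * l i) = b' m" for m
  proof -
    have "(\<lambda>j. \<Sum>i\<in>I. A (r j) m i * x (r j) i) \<longlonglongrightarrow> (\<Sum>i\<in>I. A' m i * l i)"
      using r(2) LIMSEQ_subseq_LIMSEQ[OF A r(1)]
      by (intro tendsto_sum tendsto_mult) (auto simp: o_def)
    then have "(\<lambda>j. b (r j) m) \<longlonglongrightarrow> (\<Sum>i\<in>I. A' m i * l i)"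
      by (simp add: sol)
    then show ?thesis
      by (rule LIMSEQ_unique) (use LIMSEQ_subseq_LIMSEQ[OF b r(1)] in \<open>simp add: o_def\<close>)
  qed
  then show ?thesis
    using r by blast
qed

section \<open>Bounded measurable fields and finite-dimensional spaces\<close>

lemma AE_lebesgue_on_iff_negligible:
  assumes "S \<in> sets lebesgue"
  shows "(AE x in lebesgue_on S. Q x) \<longleftrightarrow> negligible {x \<in> S. \<not> Q x}"
proof -
  have "(AE x in lebesgue_on S. Q x) \<longleftrightarrow> (\<exists>N\<in>null_sets lebesgue. {x. \<not> (x \<in> S \<longrightarrow> Q x)} \<subseteq> N)"
    using assms by (subst AE_restrict_space_iff) (simp_all add: eventually_ae_filter)
  also have "\<dots> \<longleftrightarrow> negligible {x \<in> S. \<not> Q x}"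
    by (blast intro: negligible_subset negligible_iff_null_sets[THEN iffD1] negligible_iff_null_sets[THEN iffD2])
  finally show ?thesis .
qed

text \<open>Lebesgue measure is complete, so whatever \<open>f\<close> does on the exceptional set
  is measurable. Gradients and curls take uncontrolled values on cell interfaces; this removes them
  from consideration.\<close>

lemma borel_measurable_lebesgue_on_AE:
  fixes f g :: "'a::euclidean_space \<Rightarrow> 'b::topological_space"
  assumes S: "S \<in> sets lebesgue" and g: "g \<in> borel_measurable (lebesgue_on S)"
    and eq: "AE x in lebesgue_on S. f x = g x"
  shows "f \<in> borel_measurable (lebesgue_on S)"
proof (rule measurableI)
  fix B :: "'b set" assume B: "B \<in> sets borel"
  define Z where "Z = {x \<in> S. f x \<noteq> g x}"
  have "negligible Z"
    using eq S by (simp add: AE_lebesgue_on_iff_negligible Z_def)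
  then have "Z \<in> sets lebesgue" "f -` B \<inter> Z \<in> sets lebesgue"
    by (auto intro: negligible_imp_sets negligible_subset)
  moreover have "g -` B \<inter> S \<in> sets lebesgue"
    using measurable_sets[OF g B] S by (simp add: sets_restrict_space_iff)
  moreover have "f -` B \<inter> S = (g -` B \<inter> S - Z) \<union> (f -` B \<inter> Z)"
    by (auto simp: Z_def)
  ultimately show "f -` B \<inter> space (lebesgue_on S) \<in> sets (lebesgue_on S)"
    using S by (auto simp: sets_restrict_space_iff)
qed simp

lemma finite_measure_lebesgue_on_bounded:
  fixes S :: "'a::euclidean_space set"
  assumes "S \<in> sets lebesgue" "bounded S"
  shows "finite_measure (lebesgue_on S)"
  using assms by (simp add: finite_measure_lebesgue_on bounded_set_imp_lmeasurable)

text \<open>Unlike square integrability, essential boundedness is stable under products. Finite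
  element fields, their derivatives, conductivities and traces all have it, so the integrands of the
  forms are handled by closure rules.\<close>

definition Linf :: "'a measure \<Rightarrow> ('a \<Rightarrow> 'b::real_normed_vector) \<Rightarrow> bool" where
  "Linf N f \<longleftrightarrow> f \<in> borel_measurable N \<and> (\<exists>B. AE x in N. norm (f x) \<le> B)"

lemma Linf_measurable: "Linf N f \<Longrightarrow> f \<in> borel_measurable N"
  by (simp add: Linf_def)

lemma Linf_bound:
  assumes "Linf N f"
  obtains B where "B > 0" "AE x in N. norm (f x) \<le> B"
proof -
  from assms obtain B where "AE x in N. norm (f x) \<le> B"
    by (auto simp: Linf_def)
  then have "AE x in N. norm (f x) \<le> max B 1"
    by (auto elim: eventually_mono)
  then show thesis
    by (intro that[of "max B 1"]) auto
qed

lemma Linf_const [simp]: "Linf N (\<lambda>x. c)"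
  by (auto simp: Linf_def)

lemma Linf_bilinear:
  fixes f :: "'a \<Rightarrow> 'b::{real_normed_vector, second_countable_topology}"
    and g :: "'a \<Rightarrow> 'c::{real_normed_vector, second_countable_topology}"
    and h :: "'b \<Rightarrow> 'c \<Rightarrow> 'd::real_normed_vector"
  assumes h: "bounded_bilinear h" and f: "Linf N f" and g: "Linf N g"
  shows "Linf N (\<lambda>x. h (f x) (g x))"
proof -
  obtain A where A: "AE x in N. norm (f x) \<le> A" "A > 0"
    using f by (rule Linf_bound)
  obtain B where B: "AE x in N. norm (g x) \<le> B"
    using g by (rule Linf_bound)
  obtain K where K: "\<And>u v. norm (h u v) \<le> norm u * norm v * K" "K > 0"
    using bounded_bilinear.pos_bounded[OF h] by blast
  have "AE x in N. norm (h (f x) (g x)) \<le> A * B * K"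
    using A(1) B
  proof eventually_elim
    case (elim x)
    have "norm (f x) * norm (g x) \<le> A * B"
      using elim A(2) by (intro mult_mono) auto
    then show ?case
      using K(1)[of "f x" "g x"] K(2) by (meson mult_right_mono less_imp_le order_trans)
  qed
  moreover have "(\<lambda>x. h (f x) (g x)) \<in> borel_measurable N"
    by (rule borel_measurable_continuous_Pair[OF Linf_measurable[OF f] Linf_measurable[OF g]])
      (intro bounded_bilinear.continuous_on[OF h] continuous_intros)
  ultimately show ?thesis
    by (auto simp: Linf_def)
qed

lemma Linf_bounded_linear:
  fixes f :: "'a \<Rightarrow> 'b::real_normed_vector" and h :: "'b \<Rightarrow> 'd::real_normed_vector"
  assumes h: "bounded_linear h" and f: "Linf N f"
  shows "Linf N (\<lambda>x. h (f x))"
proof -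
  obtain A where A: "AE x in N. norm (f x) \<le> A" "A > 0"
    using f by (rule Linf_bound)
  obtain K where K: "\<And>u. norm (h u) \<le> norm u * K" "K > 0"
    using bounded_linear.pos_bounded[OF h] by blast
  have "AE x in N. norm (h (f x)) \<le> A * K"
    using A(1) by eventually_elim (use K in \<open>meson mult_right_mono less_imp_le order_trans\<close>)
  moreover have "(\<lambda>x. h (f x)) \<in> borel_measurable N"
    by (rule borel_measurable_continuous_on[OF bounded_linear.continuous_on[OF h continuous_on_id]])
      (use f in \<open>simp add: Linf_def\<close>)
  ultimately show ?thesis
    by (auto simp: Linf_def)
qed

lemma Linf_add:
  fixes f g :: "'a \<Rightarrow> 'b::{real_normed_vector, second_countable_topology}"
  assumes "Linf N f" "Linf N g"
  shows "Linf N (\<lambda>x. f x + g x)"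
proof -
  obtain A where A: "AE x in N. norm (f x) \<le> A"
    using assms(1) by (rule Linf_bound)
  obtain B where B: "AE x in N. norm (g x) \<le> B"
    using assms(2) by (rule Linf_bound)
  have "AE x in N. norm (f x + g x) \<le> A + B"
    using A B by eventually_elim (metis add_mono norm_triangle_ineq order_trans)
  then show ?thesis
    using assms by (auto simp: Linf_def)
qed

lemma Linf_diff:
  fixes f g :: "'a \<Rightarrow> 'b::{real_normed_vector, second_countable_topology}"
  assumes "Linf N f" "Linf N g"
  shows "Linf N (\<lambda>x. f x - g x)"
  using Linf_add[OF assms(1) Linf_bounded_linear[OF bounded_linear_minus[OF bounded_linear_ident] assms(2)]]
  by simp

lemma Linf_integrable:
  fixes f :: "'a \<Rightarrow> 'b::{banach, second_countable_topology}"
  assumes "finite_measure N" "Linf N f"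
  shows "integrable N f"
  using assms finite_measure.integrable_const_bound unfolding Linf_def by blast

lemma Linf_L2:
  fixes f :: "'a \<Rightarrow> 'b::{real_normed_vector, second_countable_topology}"
  assumes "finite_measure N" "Linf N f"
  shows "f \<in> L2 N"
proof -
  obtain A where A: "AE x in N. norm (f x) \<le> A" "A > 0"
    using assms(2) by (rule Linf_bound)
  have "AE x in N. norm ((norm (f x))\<^sup>2) \<le> A\<^sup>2"
    using A(1) by eventually_elim (simp add: power_mono)
  then have "integrable N (\<lambda>x. (norm (f x))\<^sup>2)"
    using assms(2) by (intro finite_measure.integrable_const_bound[OF assms(1)]) (auto simp: Linf_def)
  then show ?thesis
    using assms(2) by (simp add: L2_def Linf_def)
qed

lemma L2_norm_integrable:
  fixes f :: "'a \<Rightarrow> 'b::{real_normed_vector, second_countable_topology}"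
  assumes "finite_measure N" "f \<in> L2 N"
  shows "integrable N (\<lambda>x. norm (f x))"
proof -
  have "(\<lambda>x. norm (f x)) \<in> L2 N"
    using assms(2) measurable_compose[OF L2_measurable[OF assms(2)] borel_measurable_norm] by (simp add: L2_def)
  from L2_inner_integrable[OF this Linf_L2[OF assms(1) Linf_const[of N "1::real"]]]
  show ?thesis
    by simp
qed

text \<open>On a finite measure space \<open>L2\<close> lies in \<open>L1\<close>, and a bounded
  factor preserves that. It serves the weak curl and the observed data, which are only square
  integrable.\<close>

lemma integrable_L2_Linf:
  fixes f :: "'a \<Rightarrow> 'b::{real_normed_vector, second_countable_topology}"
    and g :: "'a \<Rightarrow> 'c::{real_normed_vector, second_countable_topology}"
    and h :: "'b \<Rightarrow> 'c \<Rightarrow> 'd::{banach, second_countable_topology}"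
  assumes N: "finite_measure N" and h: "bounded_bilinear h" and f: "f \<in> L2 N" and g: "Linf N g"
  shows "integrable N (\<lambda>x. h (f x) (g x))"
proof -
  obtain B where B: "AE x in N. norm (g x) \<le> B" "B > 0"
    using g by (rule Linf_bound)
  obtain K where K: "\<And>u v. norm (h u v) \<le> norm u * norm v * K" "K > 0"
    using bounded_bilinear.pos_bounded[OF h] by blast
  show ?thesis
  proof (rule Bochner_Integration.integrable_bound)
    show "integrable N (\<lambda>x. norm (f x) * (B * K))"
      using L2_norm_integrable[OF N f] by simp
    show "(\<lambda>x. h (f x) (g x)) \<in> borel_measurable N"
      by (rule borel_measurable_continuous_Pair[OF L2_measurable[OF f] Linf_measurable[OF g]])
        (intro bounded_bilinear.continuous_on[OF h] continuous_intros)
    show "AE x in N. norm (h (f x) (g x)) \<le> norm (norm (f x) * (B * K))"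
      using B(1)
    proof eventually_elim
      case (elim x)
      have "norm (f x) * norm (g x) * K \<le> norm (f x) * B * K"
        using elim K(2) by (intro mult_right_mono mult_left_mono) auto
      then show ?case
        using K(1)[of "f x" "g x"] K(2) B(2) by (simp add: abs_mult mult.assoc)
    qed
  qed
qed

section \<open>Vector operations and finite linear combinations\<close>

lemma bounded_bilinearI_linear:
  fixes h :: "'a::euclidean_space \<Rightarrow> 'b::euclidean_space \<Rightarrow> 'c::real_normed_vector"
  assumes "\<And>v. linear (\<lambda>u. h u v)" "\<And>u. linear (h u)"
  shows "bounded_bilinear h"
  using bilinear_conv_bounded_bilinear assms unfolding bilinear_def by blast

lemma bounded_bilinear_cdot: "bounded_bilinear cdot"
  by (rule bounded_bilinearI_linear; rule linearI)
    (simp_all add: cdot_def sum.distrib distrib_left distrib_right scaleR_sum_right)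

lemma bounded_bilinear_ccross: "bounded_bilinear ccross"
  by (rule bounded_bilinearI_linear; rule linearI)
    (simp_all add: ccross_def vec_eq_iff forall_3 algebra_simps scaleR_diff_right)

lemma bounded_linear_cconj: "bounded_linear cconj"
  unfolding linear_conv_bounded_linear[symmetric]
  by (rule linearI) (simp_all add: cconj_def vec_eq_iff)

lemma bounded_linear_cvec: "bounded_linear cvec"
  unfolding linear_conv_bounded_linear[symmetric]
  by (rule linearI) (simp_all add: cvec_def vec_eq_iff scaleR_conv_of_real[where 'a = complex])

lemma bounded_linear_scalar_vec:
  fixes a :: complex shows "bounded_linear (\<lambda>v::C3. a *s v)"
  unfolding linear_conv_bounded_linear[symmetric]
  by (rule linearI) (simp_all add: vec_eq_iff algebra_simps)

lemma cdot_scalar_left: "cdot (a *s u + b *s v) w = a * cdot u w + b * cdot v w"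
  by (simp add: cdot_def sum.distrib sum_distrib_left algebra_simps)

text \<open>The forms are linear on the discrete spaces, where integrands are integrable and
  derivatives exist almost everywhere, but not on all functions. Hence \<open>\<phi>\<close> is
  linear on \<open>S\<close> alone, and membership of the partial sums is carried through the same
  induction. The parameter \<open>sm\<close> covers scalar functions as well as vector
  fields.\<close>

lemma linear_combination_sum:
  fixes sm :: "'k::comm_ring_1 \<Rightarrow> 'b::comm_monoid_add \<Rightarrow> 'b"
  assumes sm: "\<And>v. sm 1 v = v" "\<And>v. sm 0 v = 0"
    and lin: "\<And>f g a b. f \<in> S \<Longrightarrow> g \<in> S \<Longrightarrow> (\<lambda>x. sm a (f x) + sm b (g x)) \<in> S"
    and "f0 \<in> S" "finite Y" "\<And>y. y \<in> Y \<Longrightarrow> e y \<in> S"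
  shows "(\<lambda>x. \<Sum>y\<in>Y. sm (c y) (e y x)) \<in> S \<and>
    (\<forall>\<phi> :: _ \<Rightarrow> 'k. (\<forall>f\<in>S. \<forall>g\<in>S. \<forall>a b. \<phi> (\<lambda>x. sm a (f x) + sm b (g x)) = a * \<phi> f + b * \<phi> g) \<longrightarrow>
      \<phi> (\<lambda>x. \<Sum>y\<in>Y. sm (c y) (e y x)) = (\<Sum>y\<in>Y. c y * \<phi> (e y)))"
  using assms(5,6)
proof (induction Y rule: finite_induct)
  case empty
  \<comment> \<open>The empty sum is in \<open>S\<close> as a multiple of \<open>f0\<close> by zero;
    the same combination forces \<open>\<phi>\<close> to vanish there.\<close>
  have zero: "(\<lambda>x. sm 0 (f0 x) + sm 0 (f0 x)) = (\<lambda>x. 0)"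
    by (simp add: sm)
  show ?case
    using lin[OF \<open>f0 \<in> S\<close> \<open>f0 \<in> S\<close>, of 0 0] \<open>f0 \<in> S\<close> zero
    by (auto dest!: bspec[where x = f0] spec[where x = 0])
next
  case (insert y Y)
  define g where "g x = (\<Sum>y\<in>Y. sm (c y) (e y x))" for x
  have g: "g \<in> S" "e y \<in> S"
    using insert by (auto simp: g_def[abs_def])
  have eq: "(\<lambda>x. \<Sum>y\<in>insert y Y. sm (c y) (e y x)) = (\<lambda>x. sm (c y) (e y x) + sm 1 (g x))"
    using insert.hyps by (simp add: g_def sm)
  show ?case
    unfolding eq
  proof (intro conjI allI impI)
    show "(\<lambda>x. sm (c y) (e y x) + sm 1 (g x)) \<in> S"
      by (rule lin[OF g(2) g(1)])
    fix \<phi> :: "_ \<Rightarrow> 'k"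
    assume \<phi>: "\<forall>f\<in>S. \<forall>g\<in>S. \<forall>a b. \<phi> (\<lambda>x. sm a (f x) + sm b (g x)) = a * \<phi> f + b * \<phi> g"
    then have "\<phi> g = (\<Sum>y\<in>Y. c y * \<phi> (e y))"
      using insert by (auto simp: g_def[abs_def])
    then show "\<phi> (\<lambda>x. sm (c y) (e y x) + sm 1 (g x)) = (\<Sum>y\<in>insert y Y. c y * \<phi> (e y))"
      using \<phi>[rule_format, OF g(2) g(1), of "c y" 1] insert.hyps by simp
  qed
qed

text \<open>A vector field is a scalar function of point and component, so
  \<open>nodal_basis\<close> applies after uncurrying; the nodes become pairs.\<close>

lemma nodal_basis_vec:
  fixes S :: "('a \<Rightarrow> 'k::field^'n::finite) set"
  assumes lin: "\<And>f g a b. f \<in> S \<Longrightarrow> g \<in> S \<Longrightarrow> (\<lambda>x. a *s f x + b *s g x) \<in> S"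
    and "finite X"
    and unisolvent: "\<And>f. f \<in> S \<Longrightarrow> (\<forall>x\<in>X. f x = 0) \<Longrightarrow> f = (\<lambda>x. 0)"
  obtains Y e where "Y \<subseteq> X \<times> UNIV" "\<And>y. y \<in> Y \<Longrightarrow> e y \<in> S"
    "\<And>x y. x \<in> Y \<Longrightarrow> y \<in> Y \<Longrightarrow> e y (fst x) $ snd x = (if x = y then 1 else 0)"
    "\<And>f. f \<in> S \<Longrightarrow> f = (\<lambda>x. \<Sum>y\<in>Y. (f (fst y) $ snd y) *s e y x)"
proof -
  define S' where "S' = (\<lambda>f (x, i). f x $ i) ` S"
  have lin': "(\<lambda>z. a * f z + b * g z) \<in> S'" if fg: "f \<in> S'" "g \<in> S'" for f g a b
  proof -
    from fg obtain f1 g1 where "f1 \<in> S" "g1 \<in> S" and fg1: "f = (\<lambda>(x, i). f1 x $ i)" "g = (\<lambda>(x, i). g1 x $ i)"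
      by (auto simp: S'_def)
    then have "(\<lambda>x. a *s f1 x + b *s g1 x) \<in> S"
      by (intro lin)
    then have "(\<lambda>(x, i). (a *s f1 x + b *s g1 x) $ i) \<in> S'"
      unfolding S'_def by (rule rev_image_eqI) (rule refl)
    moreover have "(\<lambda>(x, i). (a *s f1 x + b *s g1 x) $ i) = (\<lambda>z. a * f z + b * g z)"
      by (auto simp: fg1)
    ultimately show ?thesis
      by simp
  qed
  have un': "f = (\<lambda>z. 0)" if f: "f \<in> S'" "\<forall>z\<in>X \<times> UNIV. f z = 0" for f
  proof -
    from f(1) obtain f1 where f1: "f1 \<in> S" "f = (\<lambda>(x, i). f1 x $ i)"
      by (auto simp: S'_def)
    have "f1 = (\<lambda>x. 0)"
      using f(2) by (intro unisolvent[OF f1(1)]) (auto simp: f1(2) vec_eq_iff)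
    then show ?thesis
      by (auto simp: f1(2))
  qed
  obtain Y e where Y: "Y \<subseteq> X \<times> UNIV" "\<And>y. y \<in> Y \<Longrightarrow> e y \<in> S'"
    "\<And>x y. x \<in> Y \<Longrightarrow> y \<in> Y \<Longrightarrow> e y x = (if x = y then 1 else 0)"
    "\<And>f. f \<in> S' \<Longrightarrow> f = (\<lambda>z. \<Sum>y\<in>Y. f y * e y z)"
    by (rule nodal_basis[of S' "X \<times> UNIV", OF lin' _ un']) (use \<open>finite X\<close> in auto)
  have "\<forall>y\<in>Y. \<exists>g\<in>S. e y = (\<lambda>(x, i). g x $ i)"
    using Y(2) by (auto simp: S'_def)
  then obtain e' where e': "\<And>y. y \<in> Y \<Longrightarrow> e' y \<in> S" "\<And>y. y \<in> Y \<Longrightarrow> e y = (\<lambda>(x, i). e' y x $ i)"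
    by metis
  show thesis
  proof (rule that[OF Y(1) e'(1), rotated])
    fix f assume f: "f \<in> S"
    then have "(\<lambda>(x, i). f x $ i) \<in> S'"
      by (auto simp: S'_def)
    note repr = Y(4)[OF this]
    have *: "f x $ i = (\<Sum>y\<in>Y. f (fst y) $ snd y * e' y x $ i)" for x i
      using fun_cong[OF repr, of "(x, i)"] by (simp add: e'(2) case_prod_unfold)
    show "f = (\<lambda>x. \<Sum>y\<in>Y. f (fst y) $ snd y *s e' y x)"
      by (intro ext vec_eq_iff[THEN iffD2] allI, simp only: sum_component vector_smult_component) (rule *)
  next
    show "e' y (fst x) $ snd x = (if x = y then 1 else 0)" if "x \<in> Y" "y \<in> Y" for x y
      using Y(3)[OF that] e'(2)[OF that(2)] by (simp add: case_prod_unfold)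
  qed
qed

section \<open>Piecewise affine fields\<close>

text \<open>By completeness \<open>f\<close> and \<open>g\<close> are measurable together; if
  neither is, both integrals have the default value for non-integrable functions. Thus no
  measurability has to be checked.\<close>

lemma integral_lebesgue_on_cong_AE:
  fixes f g :: "'a::euclidean_space \<Rightarrow> 'b::{banach, second_countable_topology}"
  assumes S: "S \<in> sets lebesgue" and eq: "AE x in lebesgue_on S. f x = g x"
  shows "(LINT x|lebesgue_on S. f x) = (LINT x|lebesgue_on S. g x)"
proof (cases "f \<in> borel_measurable (lebesgue_on S)")
  case True
  have "AE x in lebesgue_on S. g x = f x"
    using eq by (auto elim: eventually_mono)
  then have "g \<in> borel_measurable (lebesgue_on S)"
    by (rule borel_measurable_lebesgue_on_AE[OF S True])
  then show ?thesis
    using True eq by (intro integral_cong_AE)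
next
  case False
  then have "g \<notin> borel_measurable (lebesgue_on S)"
    using borel_measurable_lebesgue_on_AE[OF S _ eq] by blast
  then have "\<not> integrable (lebesgue_on S) f" "\<not> integrable (lebesgue_on S) g"
    using False by (auto dest: borel_measurable_integrable)
  then show ?thesis
    by (simp add: not_integrable_integral_eq)
qed

definition meshed :: "R3 set \<Rightarrow> R3 set set \<Rightarrow> bool" where
  "meshed S M \<longleftrightarrow> open S \<and> bounded S \<and> finite M \<and> S \<subseteq> \<Union>M \<and>
     (\<forall>T\<in>M. compact T \<and> convex T \<and> interior T \<noteq> {})"

lemma meshed_sets: "meshed S M \<Longrightarrow> S \<in> sets lebesgue"
  by (simp add: meshed_def borel_open sets_completionI_sets)

lemma meshed_finite_measure:
  assumes "meshed S M"
  shows "finite_measure (lebesgue_on S)"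
  using finite_measure_lebesgue_on_bounded[OF meshed_sets[OF assms]] assms by (simp add: meshed_def)

text \<open>The missed points lie on the frontiers of finitely many convex cells, and these are
  negligible.\<close>

lemma meshed_AE:
  assumes "meshed S M"
  shows "AE x in lebesgue_on S. \<exists>T\<in>M. x \<in> interior T"
proof -
  have "negligible (\<Union>T\<in>M. frontier T)"
    using assms by (intro negligible_Union) (auto simp: meshed_def intro: negligible_convex_frontier)
  moreover have "{x \<in> S. \<not> (\<exists>T\<in>M. x \<in> interior T)} \<subseteq> (\<Union>T\<in>M. frontier T)"
    using assms closure_subset unfolding meshed_def frontier_def by blast
  ultimately show ?thesis
    unfolding AE_lebesgue_on_iff_negligible[OF meshed_sets[OF assms]] by (rule negligible_subset)
qed

lemma Linf_piecewise:
  fixes f :: "R3 \<Rightarrow> 'b::euclidean_space"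
  assumes M: "meshed S M"
    and f: "\<And>T. T \<in> M \<Longrightarrow> \<exists>g. continuous_on UNIV g \<and> (\<forall>x\<in>interior T. f x = g x)"
  shows "Linf (lebesgue_on S) f"
proof -
  from f obtain g where g: "\<And>T. T \<in> M \<Longrightarrow> continuous_on UNIV (g T)"
    "\<And>T x. T \<in> M \<Longrightarrow> x \<in> interior T \<Longrightarrow> f x = g T x"
    by metis
  define W where "W = (\<Union>T\<in>M. interior T)"
  \<comment> \<open>On the interfaces \<open>f\<close> is uncontrolled; \<open>f0\<close> is zero
    there, is measurable by gluing, and agrees with \<open>f\<close> almost everywhere, which
    suffices by completeness.\<close>
  define f0 where "f0 x = (if x \<in> W then f x else 0)" for x
  have "open W"
    by (auto simp: W_def)
  have f0: "f0 \<in> borel_measurable (lebesgue_on S)"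
  proof (rule measurable_piecewise_restrict)
    show "countable (insert (- W) (interior ` M))"
      using M by (auto simp: meshed_def intro: countable_finite)
    show "space (lebesgue_on S) \<subseteq> \<Union> (insert (- W) (interior ` M))"
      by (auto simp: W_def)
    fix X assume X: "X \<in> insert (- W) (interior ` M)"
    then have "X \<in> sets lebesgue"
      using \<open>open W\<close> by (auto simp: sets_completionI_sets)
    then show "X \<inter> space (lebesgue_on S) \<in> sets (lebesgue_on S)"
      using meshed_sets[OF M] by (auto simp: sets_restrict_space)
    show "f0 \<in> borel_measurable (restrict_space (lebesgue_on S) X)"
    proof (cases "X = - W")
      case True
      have "f0 \<in> borel_measurable (restrict_space (lebesgue_on S) X) \<longleftrightarrow>
          (\<lambda>x. 0 :: 'b) \<in> borel_measurable (restrict_space (lebesgue_on S) X)"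
        by (rule measurable_cong) (simp add: True f0_def space_restrict_space)
      then show ?thesis
        by simp
    next
      case False
      then obtain T where T: "T \<in> M" "X = interior T"
        using X by auto
      have "f0 \<in> borel_measurable (restrict_space (lebesgue_on S) X) \<longleftrightarrow>
          g T \<in> borel_measurable (restrict_space (lebesgue_on S) X)"
        by (rule measurable_cong) (use T g(2) in \<open>auto simp: f0_def W_def space_restrict_space\<close>)
      moreover have "g T \<in> borel_measurable borel"
        using g(1)[OF T(1)] by (rule borel_measurable_continuous_onI)
      then have "g T \<in> borel_measurable (restrict_space (lebesgue_on S) X)"
        by (intro measurable_restrict_space1 measurable_completion) simp
      ultimately show ?thesis
        by simp
    qed
  qed
  have AE: "AE x in lebesgue_on S. f x = f0 x"
    using meshed_AE[OF M] by eventually_elim (auto simp: f0_def W_def)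
  have "\<exists>B. \<forall>x\<in>interior T. norm (f x) \<le> B" if "T \<in> M" for T
  proof -
    have "compact (g T ` T)"
      using g(1)[OF that] M that
      by (intro compact_continuous_image) (auto simp: meshed_def intro: continuous_on_subset)
    then obtain B where "\<forall>y\<in>g T ` T. norm y \<le> B"
      using compact_imp_bounded bounded_iff by metis
    then show ?thesis
      using g(2)[OF that] interior_subset by (intro exI[of _ B]) auto
  qed
  then obtain B where B: "\<And>T x. T \<in> M \<Longrightarrow> x \<in> interior T \<Longrightarrow> norm (f x) \<le> B T"
    by metis
  have "AE x in lebesgue_on S. norm (f x) \<le> Max (B ` M)"
    using meshed_AE[OF M]
  proof eventually_elim
    case (elim x)
    then obtain T where T: "T \<in> M" "x \<in> interior T"
      by blast
    have "B T \<le> Max (B ` M)"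
      using M T(1) by (intro Max_ge) (auto simp: meshed_def)
    then show ?case
      using B[OF T] by simp
  qed
  then show ?thesis
    using borel_measurable_lebesgue_on_AE[OF meshed_sets[OF M] f0 AE] by (auto simp: Linf_def)
qed

text \<open>Only open cells count: an edge element field may jump across faces and is set to zero on
  them.\<close>

definition pw_affine :: "R3 set set \<Rightarrow> (R3 \<Rightarrow> 'b::euclidean_space) \<Rightarrow> bool" where
  "pw_affine M f \<longleftrightarrow> (\<forall>T\<in>M. \<exists>c L. linear L \<and> (\<forall>x\<in>interior T. f x = c + L x))"

lemma pw_affine_subset: "pw_affine M f \<Longrightarrow> M' \<subseteq> M \<Longrightarrow> pw_affine M' f"
  by (auto simp: pw_affine_def)

lemma partial_eq: "(f has_derivative D) (at x) \<Longrightarrow> partial i f x = D (axis i 1)"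
  by (simp add: partial_def frechet_derivative_at[symmetric])

lemma pw_affine_has_derivative:
  fixes f :: "R3 \<Rightarrow> 'b::euclidean_space"
  assumes "linear L" "\<forall>x\<in>interior T. f x = c + L x" "x \<in> interior T"
  shows "(f has_derivative L) (at x)"
proof (rule has_derivative_transform_within_open)
  show "((\<lambda>x. c + L x) has_derivative L) (at x)"
    using has_derivative_add[OF has_derivative_const linear_imp_has_derivative[OF assms(1)], of c]
    by simp
  show "open (interior T)" "x \<in> interior T"
    using assms(3) by auto
qed (use assms(2) in auto)

lemma pw_affine_Linf:
  fixes f :: "R3 \<Rightarrow> 'b::euclidean_space"
  assumes "meshed S M" "pw_affine M f"
  shows "Linf (lebesgue_on S) f"
proof (rule Linf_piecewise[OF assms(1)])
  fix T assume "T \<in> M"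
  then obtain c L where "linear L" "\<forall>x\<in>interior T. f x = c + L x"
    using assms(2) unfolding pw_affine_def by blast
  then show "\<exists>g. continuous_on UNIV g \<and> (\<forall>x\<in>interior T. f x = g x)"
    by (intro exI[of _ "\<lambda>x. c + L x"] conjI continuous_intros linear_continuous_on)
      (simp_all add: linear_conv_bounded_linear)
qed

lemma pw_affine_differentiable:
  fixes f :: "R3 \<Rightarrow> 'b::euclidean_space"
  assumes "meshed S M" "pw_affine M f"
  shows "AE x in lebesgue_on S. f differentiable at x"
  using meshed_AE[OF assms(1)]
proof eventually_elim
  case (elim x)
  then obtain T c L where "linear L" "\<forall>x\<in>interior T. f x = c + L x" "x \<in> interior T"
    using assms(2) unfolding pw_affine_def by blast
  from pw_affine_has_derivative[OF this] show ?case
    by (auto simp: differentiable_def)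
qed

text \<open>Partial derivatives are constant on each open cell, so any function \<open>h\<close> of
  them is a step function; \<open>grad\<close> and \<open>curl\<close> are the instances.\<close>

lemma pw_affine_partials_Linf:
  fixes f :: "R3 \<Rightarrow> 'b::euclidean_space" and h :: "(3 \<Rightarrow> 'b) \<Rightarrow> 'c::euclidean_space"
  assumes M: "meshed S M" and f: "pw_affine M f"
  shows "Linf (lebesgue_on S) (\<lambda>x. h (\<lambda>i. partial i f x))"
proof (rule Linf_piecewise[OF M])
  fix T assume "T \<in> M"
  then obtain c L where L: "linear L" "\<forall>x\<in>interior T. f x = c + L x"
    using f unfolding pw_affine_def by blast
  then show "\<exists>g. continuous_on UNIV g \<and> (\<forall>x\<in>interior T. h (\<lambda>i. partial i f x) = g x)"
    by (intro exI[of _ "\<lambda>x. h (\<lambda>i. L (axis i 1))"])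
      (auto simp: partial_eq[OF pw_affine_has_derivative[OF L]])
qed

lemma grad_Linf:
  fixes f :: "R3 \<Rightarrow> 'b::euclidean_space"
  assumes "meshed S M" "pw_affine M f"
  shows "Linf (lebesgue_on S) (grad f)"
  unfolding grad_def[abs_def] by (rule pw_affine_partials_Linf[OF assms])

lemma curl_Linf:
  assumes "meshed S M" "pw_affine M E"
  shows "Linf (lebesgue_on S) (curl E)"
  using pw_affine_partials_Linf[OF assms, of "\<lambda>p. vector [p 2 $ 3 - p 3 $ 2, p 3 $ 1 - p 1 $ 3, p 1 $ 2 - p 2 $ 1]"]
  by (simp add: curl_def[abs_def])

text \<open>Arbitrary bounded linear \<open>h\<close>, \<open>k\<close> serve real and complex
  multiples and the scaling of vectors at once.\<close>

lemma partial_lincomb: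
  assumes f: "f differentiable at x" and g: "g differentiable at x"
    and h: "bounded_linear h" and k: "bounded_linear k"
  shows "partial i (\<lambda>x. h (f x) + k (g x)) x = h (partial i f x) + k (partial i g x)"
proof -
  have "((\<lambda>x. h (f x) + k (g x)) has_derivative
      (\<lambda>v. h (frechet_derivative f (at x) v) + k (frechet_derivative g (at x) v))) (at x)"
    using f g unfolding frechet_derivative_works
    by (intro has_derivative_add bounded_linear.has_derivative[OF h] bounded_linear.has_derivative[OF k])
  from partial_eq[OF this] show ?thesis
    by (simp add: partial_def)
qed

lemma grad_lincomb_real:
  fixes f g :: "R3 \<Rightarrow> real"
  assumes "f differentiable at x" "g differentiable at x"
  shows "grad (\<lambda>x. a * f x + b * g x) x = a *\<^sub>R grad f x + b *\<^sub>R grad g x"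
  using partial_lincomb[OF assms bounded_linear_mult_right bounded_linear_mult_right]
  by (simp add: grad_def vec_eq_iff)

lemma grad_lincomb_complex:
  fixes f g :: "R3 \<Rightarrow> complex"
  assumes "f differentiable at x" "g differentiable at x"
  shows "grad (\<lambda>x. a * f x + b * g x) x = a *s grad f x + b *s grad g x"
  using partial_lincomb[OF assms bounded_linear_mult_right bounded_linear_mult_right]
  by (simp add: grad_def vec_eq_iff)

lemma curl_lincomb:
  assumes "E differentiable at x" "F differentiable at x"
  shows "curl (\<lambda>x. a *s E x + b *s F x) x = a *s curl E x + b *s curl F x"
  using partial_lincomb[OF assms bounded_linear_scalar_vec bounded_linear_scalar_vec]
  by (simp add: curl_def vec_eq_iff forall_3 algebra_simps)

lemma divg_lincomb:
  assumes "p differentiable at x" "q differentiable at x"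
  shows "divg (\<lambda>x. a *\<^sub>R p x + b *\<^sub>R q x) x = a * divg p x + b * divg q x"
  using partial_lincomb[OF assms bounded_linear_scaleR_right bounded_linear_scaleR_right]
  by (simp add: divg_def sum.distrib sum_distrib_left)

section \<open>Compactly supported test fields and the weak curl\<close>

lemma C1c_differentiable: "p \<in> C1c S \<Longrightarrow> p differentiable at x"
  by (auto simp: C1c_def differentiable_def)

text \<open>Off the compact support \<open>p\<close> vanishes on an open set, hence so does its
  derivative; on the support continuity gives the bound.\<close>

lemma C1c_partials_Linf:
  fixes p :: "R3 \<Rightarrow> 'b::euclidean_space" and h :: "(3 \<Rightarrow> 'b) \<Rightarrow> 'c::euclidean_space"
  assumes p: "p \<in> C1c S" and U: "U \<in> sets lebesgue"
  shows "Linf (lebesgue_on U) (partial i p)"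
proof -
  obtain D :: "R3 \<Rightarrow> (R3 \<Rightarrow>\<^sub>L 'b)" where D: "continuous_on UNIV D"
      "\<And>x. (p has_derivative blinfun_apply (D x)) (at x)"
    and K: "compact (closure {x. p x \<noteq> 0})"
    using p by (auto simp: C1c_def)
  let ?K = "closure {x. p x \<noteq> 0}"
  have eq: "partial i p = (\<lambda>x. blinfun_apply (D x) (axis i 1))"
    using partial_eq[OF D(2)] by auto
  have cont: "continuous_on UNIV (partial i p)"
    unfolding eq using D(1) by (intro continuous_intros)
  have "compact (partial i p ` ?K)"
    using cont K by (intro compact_continuous_image) (auto intro: continuous_on_subset)
  then obtain B where B: "\<forall>y\<in>partial i p ` ?K. norm y \<le> B"
    using compact_imp_bounded bounded_iff by metis
  have "norm (partial i p x) \<le> max B 0" for x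
  proof (cases "x \<in> ?K")
    case True
    then show ?thesis
      using B by auto
  next
    case False
    have "(p has_derivative (\<lambda>v. 0)) (at x)"
    proof (rule has_derivative_transform_within_open)
      show "((\<lambda>x. 0 :: 'b) has_derivative (\<lambda>v. 0)) (at x)"
        by simp
      show "open (- ?K)" "x \<in> - ?K"
        using False by auto
      show "0 = p y" if "y \<in> - ?K" for y
        using that closure_subset[of "{x. p x \<noteq> 0}"] by auto
    qed
    then show ?thesis
      by (simp add: partial_eq)
  qed
  moreover have "partial i p \<in> borel_measurable (lebesgue_on U)"
    using borel_measurable_continuous_onI[OF cont]
    by (intro measurable_restrict_space1 measurable_completion) simp
  ultimately show ?thesis
    by (auto simp: Linf_def)
qed

lemma C1c_curl_Linf:
  assumes "p \<in> C1c S" "U \<in> sets lebesgue"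
  shows "Linf (lebesgue_on U) (curl p)"
proof -
  have nth: "Linf (lebesgue_on U) (\<lambda>x. partial i p x $ j)" for i j
    by (rule Linf_bounded_linear[OF bounded_linear_vec_nth C1c_partials_Linf[OF assms]])
  have ax: "Linf (lebesgue_on U) (\<lambda>x. axis j (f x) :: C3)" if "Linf (lebesgue_on U) f" for f j
    using that by (rule Linf_bounded_linear[rotated])
      (simp add: linear_conv_bounded_linear[symmetric] linear_iff axis_def vec_eq_iff)
  have "curl p = (\<lambda>x. axis 1 (partial 2 p x $ 3 - partial 3 p x $ 2) +
      axis 2 (partial 3 p x $ 1 - partial 1 p x $ 3) + axis 3 (partial 1 p x $ 2 - partial 2 p x $ 1))"
    by (auto simp: curl_def vec_eq_iff forall_3 axis_def)
  then show ?thesis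
    by (simp only:) (intro Linf_add ax Linf_diff nth)
qed

lemma C1c_divg_Linf:
  assumes "p \<in> C1c S" "U \<in> sets lebesgue"
  shows "Linf (lebesgue_on U) (divg p)"
proof -
  have nth: "Linf (lebesgue_on U) (\<lambda>x. partial i p x $ j)" for i j
    by (rule Linf_bounded_linear[OF bounded_linear_vec_nth C1c_partials_Linf[OF assms]])
  show ?thesis
    unfolding divg_def[abs_def] sum_3 by (intro Linf_add nth)
qed

lemma C1c_Linf:
  fixes p :: "R3 \<Rightarrow> 'b::euclidean_space"
  assumes p: "p \<in> C1c S" and U: "U \<in> sets lebesgue"
  shows "Linf (lebesgue_on U) p"
proof -
  let ?K = "closure {x. p x \<noteq> 0}"
  have cont: "continuous_on UNIV p"
    using C1c_differentiable[OF p]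
    by (intro differentiable_imp_continuous_on) (auto simp: differentiable_on_def differentiable_at_withinI)
  have "compact (p ` ?K)"
    using cont p by (intro compact_continuous_image) (auto simp: C1c_def intro: continuous_on_subset)
  then obtain B where B: "\<forall>y\<in>p ` ?K. norm y \<le> B"
    using compact_imp_bounded bounded_iff by metis
  have "norm (p x) \<le> max B 0" for x
  proof (cases "p x = 0")
    case False
    then have "x \<in> ?K"
      using closure_subset[of "{x. p x \<noteq> 0}"] by auto
    then show ?thesis
      using B by auto
  qed simp
  moreover have "p \<in> borel_measurable (lebesgue_on U)"
    using borel_measurable_continuous_onI[OF cont]
    by (intro measurable_restrict_space1 measurable_completion) simp
  ultimately show ?thesis
    by (auto simp: Linf_def)
qed

lemma L2_scalar_vec:
  fixes u v :: "'a \<Rightarrow> C3"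
  assumes "u \<in> L2 N" "v \<in> L2 N"
  shows "(\<lambda>x. a *s u x + b *s v x) \<in> L2 N"
proof -
  have "(\<lambda>x. c *s w x) \<in> L2 N" if w: "w \<in> L2 N" for c and w :: "'a \<Rightarrow> C3"
  proof -
    have "norm (c *s z) = cmod c * norm z" for z :: C3
      by (simp add: norm_vec_def norm_mult L2_set_right_distrib)
    then have "(norm (c *s w x))\<^sup>2 = (cmod c)\<^sup>2 * (norm (w x))\<^sup>2" for x
      by (simp add: power_mult_distrib)
    moreover have "(\<lambda>x. c *s w x) \<in> borel_measurable N"
      by (rule borel_measurable_continuous_on[OF bounded_linear.continuous_on[OF bounded_linear_scalar_vec continuous_on_id] L2_measurable[OF w]])
    ultimately show ?thesis
      using w by (simp add: L2_def)
  qed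
  from L2_linear[OF this[OF assms(1)] this[OF assms(2)], of 1 a 1 b] show ?thesis
    by simp
qed

text \<open>The combination of the weak curls serves as weak curl. The integrals may be split
  because test fields and their curls are bounded.\<close>

lemma H_curl_lincomb:
  assumes D: "open D" "bounded D" and u: "u \<in> H_curl D G" and v: "v \<in> H_curl D G"
  shows "(\<lambda>x. a *s u x + b *s v x) \<in> H_curl D G"
proof -
  let ?N = "lebesgue_on D"
  have DL: "D \<in> sets lebesgue"
    using D by (simp add: sets_completionI_sets)
  have N: "finite_measure ?N"
    using DL D by (intro finite_measure_lebesgue_on_bounded)
  obtain w where w: "w \<in> L2 ?N" "\<And>p. p \<in> C1c (- closure G) \<Longrightarrow>
      (LINT x|?N. cdot (u x) (curl p x)) = (LINT x|?N. cdot (w x) (p x))"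
    using u by (auto simp: H_curl_def)
  obtain z where z: "z \<in> L2 ?N" "\<And>p. p \<in> C1c (- closure G) \<Longrightarrow>
      (LINT x|?N. cdot (v x) (curl p x)) = (LINT x|?N. cdot (z x) (p x))"
    using v by (auto simp: H_curl_def)
  have uv: "u \<in> L2 ?N" "v \<in> L2 ?N"
    using u v by (auto simp: H_curl_def)
  have "(LINT x|?N. cdot (a *s u x + b *s v x) (curl p x)) = (LINT x|?N. cdot (a *s w x + b *s z x) (p x))"
    if p: "p \<in> C1c (- closure G)" for p
  proof -
    have int: "integrable ?N (\<lambda>x. cdot (f x) (g x))" if "f \<in> L2 ?N" "Linf ?N g" for f g
      by (rule integrable_L2_Linf[OF N bounded_bilinear_cdot that])
    note lc = C1c_curl_Linf[OF p DL] and lp = C1c_Linf[OF p DL]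
    show ?thesis
      unfolding cdot_scalar_left
      using int[OF uv(1) lc] int[OF uv(2) lc] int[OF w(1) lp] int[OF z(1) lp]
      by (simp add: w(2)[OF p] z(2)[OF p])
  qed
  then show ?thesis
    unfolding H_curl_def
    by (intro CollectI conjI L2_scalar_vec[OF uv] bexI[OF _ L2_scalar_vec[OF w(1) z(1)]] ballI)
qed

text \<open>Four points suffice: the centre of a small ball and one step along each axis.
  Differences of the values determine \<open>L\<close> on the standard basis.\<close>

lemma affine_unisolvent:
  fixes U :: "R3 set"
  assumes "open U" "U \<noteq> {}"
  shows "\<exists>X. finite X \<and> X \<subseteq> U \<and>
    (\<forall>c (L :: R3 \<Rightarrow> 'b::real_vector) x. linear L \<longrightarrow> (\<forall>z\<in>X. c + L z = 0) \<longrightarrow> c + L x = 0)"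
proof -
  obtain x0 r where r: "r > 0" "ball x0 r \<subseteq> U"
    using assms by (meson all_not_in_conv open_contains_ball_eq)
  define X where "X = insert x0 ((\<lambda>b. x0 + (r / 2) *\<^sub>R b) ` Basis)"
  show ?thesis
  proof (intro exI[of _ X] conjI allI impI)
    show "finite X"
      by (simp add: X_def)
    have "X \<subseteq> ball x0 r"
      using r by (auto simp: X_def dist_norm)
    then show "X \<subseteq> U"
      using r(2) by blast
    fix c and L :: "R3 \<Rightarrow> 'b" and x
    assume L: "linear L" and z: "\<forall>z\<in>X. c + L z = 0"
    have "L b = 0" if "b \<in> Basis" for b
    proof -
      have "c + L x0 = 0" "c + (L x0 + (r / 2) *\<^sub>R L b) = 0"
        using z that by (auto simp: X_def linear_add[OF L] linear_cmul[OF L])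
      then have "(r / 2) *\<^sub>R L b = 0"
        by (metis add.assoc add_cancel_right_right)
      then show ?thesis
        using r(1) by simp
    qed
    then have "L = (\<lambda>x. 0)"
      by (intro linear_eq_stdbasis[OF L]) (auto simp: linear_iff)
    moreover have "c + L x0 = 0"
      using z by (simp add: X_def)
    ultimately show "c + L x = 0"
      by simp
  qed
qed

text \<open>The sample points avoid the interfaces, where the value of an edge element field carries
  no information. One finite set for all cells supplies the unisolvence required by
  \<open>nodal_basis\<close>.\<close>

lemma mesh_unisolvent:
  assumes "finite M" "\<And>T. T \<in> M \<Longrightarrow> interior T \<noteq> {}"
  obtains X where "finite X" "X \<subseteq> (\<Union>T\<in>M. interior T)"
    "\<And>T c (L :: R3 \<Rightarrow> 'b::real_vector) x.
      T \<in> M \<Longrightarrow> linear L \<Longrightarrow> (\<forall>z\<in>X \<inter> interior T. c + L z = 0) \<Longrightarrow> c + L x = 0"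
proof -
  have "\<exists>X. finite X \<and> X \<subseteq> interior T \<and>
    (\<forall>c (L :: R3 \<Rightarrow> 'b) x. linear L \<longrightarrow> (\<forall>z\<in>X. c + L z = 0) \<longrightarrow> c + L x = 0)" if "T \<in> M" for T
    by (rule affine_unisolvent[OF open_interior assms(2)[OF that]])
  then obtain X where X: "\<And>T. T \<in> M \<Longrightarrow> finite (X T)" "\<And>T. T \<in> M \<Longrightarrow> X T \<subseteq> interior T"
    "\<And>T c (L :: R3 \<Rightarrow> 'b) x. T \<in> M \<Longrightarrow> linear L \<Longrightarrow> (\<forall>z\<in>X T. c + L z = 0) \<Longrightarrow> c + L x = 0"
    by metis
  show thesis
  proof (rule that[of "\<Union>T\<in>M. X T"])
    show "finite (\<Union>T\<in>M. X T)" "(\<Union>T\<in>M. X T) \<subseteq> (\<Union>T\<in>M. interior T)"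
      using assms(1) X(1,2) by auto
    fix T c and L :: "R3 \<Rightarrow> 'b" and x
    assume T: "T \<in> M" "linear L" "\<forall>z\<in>(\<Union>T\<in>M. X T) \<inter> interior T. c + L z = 0"
    then show "c + L x = 0"
      using X(2)[OF T(1)] T(1) by (intro X(3)[OF T(1,2)]) auto
  qed
qed

section \<open>Finite element spaces\<close>

text \<open>A violation would spread to a nonempty open set, which is not negligible. This turns the
  almost everywhere bounds in \<open>Kset\<close> into bounds at every point.\<close>

lemma AE_ge_continuous_imp:
  fixes v :: "'a::euclidean_space \<Rightarrow> real"
  assumes S: "open S" and v: "continuous_on S v" and ae: "AE x in lebesgue_on S. a \<le> v x" and x: "x \<in> S"
  shows "a \<le> v x"
proof (rule ccontr)
  assume "\<not> a \<le> v x"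
  have "negligible {x \<in> S. \<not> a \<le> v x}"
    using ae S by (simp add: AE_lebesgue_on_iff_negligible sets_completionI_sets)
  moreover have "open {x \<in> S. \<not> a \<le> v x}"
  proof -
    have "{x \<in> S. \<not> a \<le> v x} = S \<inter> v -` {..<a}"
      by auto
    then show ?thesis
      using continuous_open_preimage[OF v S, of "{..<a}"] by simp
  qed
  ultimately show False
    using open_not_negligible \<open>\<not> a \<le> v x\<close> x by blast
qed

locale eddy_setting =
  fixes P :: eddy
  assumes setting: "setting P"
begin

lemma domain: "valid_domain P" and data: "valid_data P" and mesh: "valid_mesh P"
  and well_posed: "well_posed P"
  using setting by (auto simp: setting_def)

lemma finite_mesh: "finite (mesh P)"
  using mesh by (auto simp: valid_mesh_def triangulation_def)

lemma mesh_cell: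
  assumes "T \<in> mesh P"
  shows "compact T" "convex T" "interior T \<noteq> {}" "aff_dim T = 3" "polytope T"
proof -
  have T: "3 simplex T"
    using mesh assms by (auto simp: valid_mesh_def)
  then show "compact T" "convex T" "aff_dim T = 3" "polytope T"
    by (simp_all add: compact_simplex convex_simplex aff_dim_simplex simplex_imp_polytope)
  obtain c r where "r > 0" "cball c r \<subseteq> T"
    using mesh assms unfolding valid_mesh_def by blast
  then have "ball c r \<subseteq> interior T"
    using ball_subset_cball by (intro interior_maximal) auto
  then show "interior T \<noteq> {}"
    using \<open>r > 0\<close> by auto
qed

lemma polyhedral_domain_open_bounded:
  assumes "polyhedral_domain D"
  shows "open D" "bounded D"
proof -
  obtain Q where Q: "finite Q" "\<forall>q\<in>Q. polytope q" "D = interior (\<Union>Q)"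
    using assms by (auto simp: polyhedral_domain_def)
  show "open D"
    using Q by simp
  have "bounded (\<Union>Q)"
    using Q by (intro bounded_Union) (auto intro: polytope_imp_bounded)
  then show "bounded D"
    using Q(3) interior_subset bounded_subset by blast
qed

lemma meshed_subdomain:
  assumes "open S" "bounded S" "closure S = \<Union>M" "M \<subseteq> mesh P"
  shows "meshed S M"
  unfolding meshed_def
proof (intro conjI ballI)
  show "finite M"
    using finite_mesh assms(4) by (rule rev_finite_subset)
  show "S \<subseteq> \<Union>M"
    using closure_subset assms(3) by blast
qed (use assms mesh_cell in blast)+

lemma meshed_Om: "meshed (Om P) (mesh P)"
  using domain mesh by (intro meshed_subdomain) (auto simp: valid_domain_def valid_mesh_def)

lemma meshed_Om0: "meshed (Om0 P) (mesh0 P)"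
  using domain mesh polyhedral_domain_open_bounded
  by (intro meshed_subdomain) (auto simp: valid_domain_def valid_mesh_def mesh_def)

lemma meshed_OmC: "meshed (OmC P) (meshC P)"
  using domain mesh polyhedral_domain_open_bounded
  by (intro meshed_subdomain) (auto simp: valid_domain_def valid_mesh_def mesh_def)

lemma closure_Om0: "closure (Om0 P) = \<Union>(mesh0 P)"
  and closure_OmC: "closure (OmC P) = \<Union>(meshC P)"
  using mesh by (auto simp: valid_mesh_def)

lemma open_OmC: "open (OmC P)" and sets_OmC: "OmC P \<in> sets lebesgue"
  using meshed_OmC meshed_sets by (auto simp: meshed_def)

lemmas fin_Om = meshed_finite_measure[OF meshed_Om]
  and fin_Om0 = meshed_finite_measure[OF meshed_Om0]
  and fin_OmC = meshed_finite_measure[OF meshed_OmC]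

lemma mesh_size_pos: "mesh_size P > 0"
proof -
  have "OmC P \<noteq> {}"
    using domain by (auto simp: valid_domain_def polyhedral_domain_def)
  then obtain T where T: "T \<in> mesh P"
    using meshed_OmC by (auto simp: meshed_def mesh_def)
  obtain c r where r: "r > 0" "cball c r \<subseteq> T"
    using mesh T unfolding valid_mesh_def by blast
  have "0 < diameter (cball c r)"
    using r(1) by simp
  also have "\<dots> \<le> diameter T"
    by (rule diameter_subset[OF r(2) compact_imp_bounded[OF mesh_cell(1)[OF T]]])
  also have "\<dots> \<le> mesh_size P"
    unfolding mesh_size_def using T finite_mesh by (intro Max_ge) auto
  finally show ?thesis .
qed

section \<open>The finite element spaces as spaces of cellwise affine functions\<close>

lemma Rh_pw_affine: "E \<in> Rh P \<Longrightarrow> pw_affine (mesh P) E"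
  unfolding pw_affine_def
proof
  fix T assume "E \<in> Rh P" "T \<in> mesh P"
  then obtain a b where ab: "\<forall>x\<in>interior T. E x = a + ccross b (cvec x)"
    unfolding Rh_def by blast
  have "linear (\<lambda>x. ccross b (cvec x))"
    by (intro bounded_linear.linear bounded_linear_compose[OF _ bounded_linear_cvec]
        bounded_bilinear.bounded_linear_right[OF bounded_bilinear_ccross])
  then show "\<exists>c L. linear L \<and> (\<forall>x\<in>interior T. E x = c + L x)"
    using ab by blast
qed

lemma Rh_pw_affine': "E \<in> Rh P \<Longrightarrow> pw_affine (mesh0 P) E" "E \<in> Rh P \<Longrightarrow> pw_affine (meshC P) E"
  by (auto dest!: Rh_pw_affine elim: pw_affine_subset simp: mesh_def)

lemma Uh_cell:
  assumes "v \<in> Uh P" "T \<in> mesh0 P"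
  shows "\<exists>c L. linear L \<and> (\<forall>x\<in>T. v x = c + L x)"
proof -
  obtain a b where ab: "\<forall>x\<in>T. v x = a + cdot b (cvec x)"
    using assms unfolding Uh_def by blast
  have "linear (\<lambda>x. cdot b (cvec x))"
    by (intro bounded_linear.linear bounded_linear_compose[OF _ bounded_linear_cvec]
        bounded_bilinear.bounded_linear_right[OF bounded_bilinear_cdot])
  then show ?thesis
    using ab by blast
qed

lemma Uh_pw_affine: "v \<in> Uh P \<Longrightarrow> pw_affine (mesh0 P) v"
  unfolding pw_affine_def using Uh_cell interior_subset by (meson subset_iff)

lemma Vh_cell:
  assumes "v \<in> Vh P" "T \<in> meshC P"
  shows "\<exists>c L. linear L \<and> (\<forall>x\<in>T. v x = c + L x)"
proof -
  obtain a b where ab: "\<forall>x\<in>T. v x = a + b \<bullet> x"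
    using assms unfolding Vh_def by blast
  have "linear (\<lambda>x. b \<bullet> x)"
    by (intro bounded_linear.linear bounded_linear_inner_right)
  then show ?thesis
    using ab by blast
qed

lemma Vh_pw_affine: "v \<in> Vh P \<Longrightarrow> pw_affine (meshC P) v"
  unfolding pw_affine_def using Vh_cell interior_subset by (meson subset_iff)

lemma Rh_lincomb:
  assumes "E \<in> Rh P" "F \<in> Rh P"
  shows "(\<lambda>x. a *s E x + b *s F x) \<in> Rh P"
proof -
  have "\<exists>c d. \<forall>x\<in>interior T. a *s E x + b *s F x = c + ccross d (cvec x)" if T: "T \<in> mesh P" for T
  proof -
    obtain c1 d1 where 1: "\<forall>x\<in>interior T. E x = c1 + ccross d1 (cvec x)"
      using assms(1) T unfolding Rh_def by blast
    obtain c2 d2 where 2: "\<forall>x\<in>interior T. F x = c2 + ccross d2 (cvec x)"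
      using assms(2) T unfolding Rh_def by blast
    show ?thesis
      by (rule exI[of _ "a *s c1 + b *s c2"], rule exI[of _ "a *s d1 + b *s d2"])
        (auto simp: 1 2 ccross_def vec_eq_iff forall_3 algebra_simps)
  qed
  moreover have "(\<lambda>x. a *s E x + b *s F x) \<in> H_curl (Om P) (Gam P)"
    using assms domain by (intro H_curl_lincomb) (auto simp: Rh_def valid_domain_def)
  ultimately show ?thesis
    using assms unfolding Rh_def by simp
qed

lemma Uh_lincomb:
  assumes "v \<in> Uh P" "w \<in> Uh P"
  shows "(\<lambda>x. a * v x + b * w x) \<in> Uh P"
proof -
  have "\<exists>c d. \<forall>x\<in>T. a * v x + b * w x = c + cdot d (cvec x)" if T: "T \<in> mesh0 P" for T
  proof -
    obtain c1 d1 where 1: "\<forall>x\<in>T. v x = c1 + cdot d1 (cvec x)"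
      using assms(1) T unfolding Uh_def by blast
    obtain c2 d2 where 2: "\<forall>x\<in>T. w x = c2 + cdot d2 (cvec x)"
      using assms(2) T unfolding Uh_def by blast
    show ?thesis
      by (rule exI[of _ "a * c1 + b * c2"], rule exI[of _ "a *s d1 + b *s d2"])
        (auto simp: 1 2 cdot_scalar_left algebra_simps)
  qed
  then show ?thesis
    using assms unfolding Uh_def by (auto intro!: continuous_intros)
qed

lemma Vh_lincomb:
  assumes "v \<in> Vh P" "w \<in> Vh P"
  shows "(\<lambda>x. a * v x + b * w x) \<in> Vh P"
proof -
  have "\<exists>c d. \<forall>x\<in>T. a * v x + b * w x = c + d \<bullet> x" if T: "T \<in> meshC P" for T
  proof -
    obtain c1 d1 where 1: "\<forall>x\<in>T. v x = c1 + d1 \<bullet> x"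
      using assms(1) T unfolding Vh_def by blast
    obtain c2 d2 where 2: "\<forall>x\<in>T. w x = c2 + d2 \<bullet> x"
      using assms(2) T unfolding Vh_def by blast
    show ?thesis
      by (rule exI[of _ "a * c1 + b * c2"], rule exI[of _ "a *\<^sub>R d1 + b *\<^sub>R d2"])
        (auto simp: 1 2 inner_add_left algebra_simps)
  qed
  then show ?thesis
    using assms unfolding Vh_def by (auto intro!: continuous_intros)
qed

text \<open>The zero extension is glued along two closed sets that overlap in the frontier, where
  functions in \<open>Vh\<close> vanish.\<close>

lemma Vh_continuous:
  assumes "v \<in> Vh P"
  shows "continuous_on UNIV v"
proof -
  have zero: "v x = 0" if "x \<in> - OmC P" for x
    using assms that open_OmC by (cases "x \<in> closure (OmC P)") (auto simp: Vh_def frontier_def interior_open)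
  have "continuous_on (closure (OmC P) \<union> - OmC P) v"
  proof (rule continuous_on_closed_Un)
    show "continuous_on (closure (OmC P)) v"
      using assms by (simp add: Vh_def)
    show "continuous_on (- OmC P) v"
      using zero by (subst continuous_on_cong[OF refl zero]) auto
  qed (use open_OmC in auto)
  moreover have "closure (OmC P) \<union> - OmC P = UNIV"
    using closure_subset by blast
  ultimately show ?thesis
    by simp
qed

lemma Vh_zero_outside: "v \<in> Vh P \<Longrightarrow> x \<notin> OmC P \<Longrightarrow> v x = 0"
  using open_OmC by (cases "x \<in> closure (OmC P)") (auto simp: Vh_def frontier_def interior_open)

text \<open>A vector space containing \<open>Kh\<close>: only the pointwise bounds are dropped. Its basis functions are
  again of bounded variation, so limits of admissible functions need no separate argument.\<close>

definition Wh :: "(R3 \<Rightarrow> real) set" where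
  "Wh = {v \<in> Vh P. v \<in> BV (OmC P) \<and>
     (\<exists>C. compact C \<and> C \<subseteq> OmC P \<and> (AE x in muC P. x \<notin> C \<longrightarrow> v x = 0))}"

lemma Kh_Wh: "\<sigma> \<in> Kh P \<longleftrightarrow> \<sigma> \<in> Wh \<and> (AE x in muC P. m0 P \<le> \<sigma> x \<and> \<sigma> x \<le> m1 P)"
  by (auto simp: Kh_def Kset_def Wh_def)

lemma Kh_Vh: "\<sigma> \<in> Kh P \<Longrightarrow> \<sigma> \<in> Vh P"
  by (simp add: Kh_def)

text \<open>The definition of \<open>BV\<close> bounds the functional only from above. Since
  \<open>- p\<close> is again a test field, its modulus is bounded too, as coefficients of either
  sign demand.\<close>

lemma BV_lincomb:
  assumes "u \<in> BV (OmC P)" "v \<in> BV (OmC P)"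
  shows "(\<lambda>x. a * u x + b * v x) \<in> BV (OmC P)"
proof -
  have int: "integrable (muC P) (\<lambda>x. w x * divg p x)" if w: "w \<in> BV (OmC P)" and p: "p \<in> C1c (OmC P)" for w p
  proof -
    have "Linf (muC P) (divg p)"
      using C1c_divg_Linf[OF p sets_OmC] .
    then obtain B where B: "AE x in muC P. norm (divg p x) \<le> B" and m: "divg p \<in> borel_measurable (muC P)"
      by (auto simp: Linf_def)
    have w': "integrable (muC P) w"
      using w by (simp add: BV_def)
    show ?thesis
    proof (rule Bochner_Integration.integrable_bound)
      show "integrable (muC P) (\<lambda>x. B * w x)"
        using w' by simp
      show "(\<lambda>x. w x * divg p x) \<in> borel_measurable (muC P)"
        using m w' by (intro borel_measurable_times) auto
      show "AE x in muC P. norm (w x * divg p x) \<le> norm (B * w x)"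
        using B
      proof eventually_elim
        case (elim x)
        then have "\<bar>divg p x\<bar> \<le> \<bar>B\<bar>"
          by simp
        then show ?case
          by (simp add: abs_mult mult.commute[of "\<bar>B\<bar>"] mult_left_mono)
      qed
    qed
  qed
  have bound: "\<exists>C\<ge>0. \<forall>p\<in>C1c (OmC P). (\<forall>x. norm (p x) \<le> 1) \<longrightarrow> \<bar>LINT x|muC P. w x * divg p x\<bar> \<le> C"
    if w: "w \<in> BV (OmC P)" for w
  proof -
    obtain C where C: "\<forall>p\<in>C1c (OmC P). (\<forall>x. norm (p x) \<le> 1) \<longrightarrow> (LINT x|muC P. w x * divg p x) \<le> C"
      using w by (auto simp: BV_def)
    have "\<bar>LINT x|muC P. w x * divg p x\<bar> \<le> max C 0" if p: "p \<in> C1c (OmC P)" "\<forall>x. norm (p x) \<le> 1" for p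
    proof -
      obtain D :: "R3 \<Rightarrow> (R3 \<Rightarrow>\<^sub>L R3)" where D: "continuous_on UNIV D"
          "\<And>x. (p has_derivative blinfun_apply (D x)) (at x)"
        using p(1) by (auto simp: C1c_def)
      have "continuous_on UNIV (\<lambda>x. - D x)" "\<And>x. ((\<lambda>x. - p x) has_derivative blinfun_apply (- D x)) (at x)"
        using D by (auto intro!: continuous_intros derivative_eq_intros simp: uminus_blinfun.rep_eq)
      then have "(\<lambda>x. - p x) \<in> C1c (OmC P)"
        using p(1) unfolding C1c_def by auto
      then have "(LINT x|muC P. w x * divg (\<lambda>x. - p x) x) \<le> C"
        using C p(2) by simp
      moreover have "divg (\<lambda>x. - p x) x = - divg p x" for x
        using divg_lincomb[OF C1c_differentiable[OF p(1)] C1c_differentiable[OF p(1)], of "-1" 0 x] by simp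
      ultimately show ?thesis
        using C p by auto
    qed
    then show ?thesis
      by (intro exI[of _ "max C 0"]) auto
  qed
  obtain Cu where Cu: "Cu \<ge> 0" "\<forall>p\<in>C1c (OmC P). (\<forall>x. norm (p x) \<le> 1) \<longrightarrow> \<bar>LINT x|muC P. u x * divg p x\<bar> \<le> Cu"
    using bound[OF assms(1)] by blast
  obtain Cv where Cv: "Cv \<ge> 0" "\<forall>p\<in>C1c (OmC P). (\<forall>x. norm (p x) \<le> 1) \<longrightarrow> \<bar>LINT x|muC P. v x * divg p x\<bar> \<le> Cv"
    using bound[OF assms(2)] by blast
  have "(LINT x|muC P. (a * u x + b * v x) * divg p x) \<le> \<bar>a\<bar> * Cu + \<bar>b\<bar> * Cv"
    if p: "p \<in> C1c (OmC P)" "\<forall>x. norm (p x) \<le> 1" for p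
  proof -
    have "(LINT x|muC P. (a * u x + b * v x) * divg p x) =
        a * (LINT x|muC P. u x * divg p x) + b * (LINT x|muC P. v x * divg p x)"
      using int[OF assms(1) p(1)] int[OF assms(2) p(1)] by (simp add: distrib_right mult.assoc)
    also have "\<dots> \<le> \<bar>a * (LINT x|muC P. u x * divg p x)\<bar> + \<bar>b * (LINT x|muC P. v x * divg p x)\<bar>"
      by (intro add_mono) auto
    also have "\<dots> \<le> \<bar>a\<bar> * Cu + \<bar>b\<bar> * Cv"
      unfolding abs_mult using Cu Cv p by (intro add_mono mult_left_mono) auto
    finally show ?thesis .
  qed
  moreover have "integrable (muC P) (\<lambda>x. a * u x + b * v x)"
    using assms by (simp add: BV_def)
  ultimately show ?thesis
    unfolding BV_def by blast
qed

lemma Wh_lincomb: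
  assumes "u \<in> Wh" "v \<in> Wh"
  shows "(\<lambda>x. a * u x + b * v x) \<in> Wh"
proof -
  obtain C where C: "compact C" "C \<subseteq> OmC P" "AE x in muC P. x \<notin> C \<longrightarrow> u x = 0"
    using assms(1) by (auto simp: Wh_def)
  obtain D where D: "compact D" "D \<subseteq> OmC P" "AE x in muC P. x \<notin> D \<longrightarrow> v x = 0"
    using assms(2) by (auto simp: Wh_def)
  have "AE x in muC P. x \<notin> C \<union> D \<longrightarrow> a * u x + b * v x = 0"
    using C(3) D(3) by eventually_elim auto
  then have "\<exists>C. compact C \<and> C \<subseteq> OmC P \<and> (AE x in muC P. x \<notin> C \<longrightarrow> a * u x + b * v x = 0)"
    using C D by (intro exI[of _ "C \<union> D"]) auto
  then show ?thesis
    using assms Vh_lincomb BV_lincomb by (simp add: Wh_def)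
qed

lemma Kh_convex:
  assumes "u \<in> Kh P" "v \<in> Kh P" "0 \<le> a" "0 \<le> b" "a + b = 1"
  shows "(\<lambda>x. a * u x + b * v x) \<in> Kh P"
proof -
  have uv: "AE x in muC P. m0 P \<le> u x \<and> u x \<le> m1 P" "AE x in muC P. m0 P \<le> v x \<and> v x \<le> m1 P"
    using assms by (auto simp: Kh_Wh)
  have "AE x in muC P. m0 P \<le> a * u x + b * v x \<and> a * u x + b * v x \<le> m1 P"
    using uv
  proof eventually_elim
    case (elim x)
    have "a * m0 P + b * m0 P \<le> a * u x + b * v x" "a * u x + b * v x \<le> a * m1 P + b * m1 P"
      using elim assms by (auto intro!: add_mono mult_left_mono)
    then show ?case
      using assms(5) by (metis distrib_right mult_1)
  qed
  then show ?thesis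
    using assms Wh_lincomb by (simp add: Kh_Wh)
qed

lemma Kh_bound:
  assumes "\<sigma> \<in> Kh P"
  shows "\<bar>\<sigma> x\<bar> \<le> max \<bar>m0 P\<bar> \<bar>m1 P\<bar>"
proof (cases "x \<in> OmC P")
  case True
  have cont: "continuous_on (OmC P) \<sigma>"
    using Vh_continuous[OF Kh_Vh[OF assms]] by (rule continuous_on_subset) auto
  have "AE x in muC P. m0 P \<le> \<sigma> x" "AE x in muC P. - m1 P \<le> - \<sigma> x"
    using assms by (auto simp: Kh_Wh)
  from AE_ge_continuous_imp[OF open_OmC cont this(1) True]
    AE_ge_continuous_imp[OF open_OmC continuous_on_minus[OF cont] this(2) True]
  show ?thesis
    by auto
next
  case False
  then show ?thesis
    using Vh_zero_outside[OF Kh_Vh[OF assms]] by simp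
qed

section \<open>Finite bases of the discrete spaces\<close>

lemma Rh_basis:
  obtains Y e where "finite Y" "\<And>y. y \<in> Y \<Longrightarrow> e y \<in> Rh P"
    "\<And>x y. x \<in> Y \<Longrightarrow> y \<in> Y \<Longrightarrow> e y (fst x) $ snd x = (if x = y then 1 else 0)"
    "\<And>E. E \<in> Rh P \<Longrightarrow> E = (\<lambda>x. \<Sum>y\<in>Y. (E (fst y) $ snd y) *s e y x)"
proof -
  obtain X where X: "finite X" "X \<subseteq> (\<Union>T\<in>mesh P. interior T)"
    "\<And>T c (L :: R3 \<Rightarrow> C3) x. T \<in> mesh P \<Longrightarrow> linear L \<Longrightarrow> (\<forall>z\<in>X \<inter> interior T. c + L z = 0) \<Longrightarrow> c + L x = 0"
    using mesh_unisolvent[OF finite_mesh mesh_cell(3)] by metis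
  have un: "E = (\<lambda>x. 0)" if E: "E \<in> Rh P" "\<forall>x\<in>X. E x = 0" for E
  proof
    fix x
    show "E x = 0"
    proof (cases "x \<in> (\<Union>T\<in>mesh P. interior T)")
      case True
      then obtain T where T: "T \<in> mesh P" "x \<in> interior T"
        by blast
      then obtain c L where L: "linear L" "\<forall>x\<in>interior T. E x = c + L x"
        using Rh_pw_affine[OF E(1)] unfolding pw_affine_def by blast
      have "\<forall>z\<in>X \<inter> interior T. c + L z = 0"
        using E(2) L(2) by fastforce
      then show ?thesis
        using X(3)[OF T(1) L(1)] L(2) T(2) by simp
    qed (use E(1) in \<open>auto simp: Rh_def\<close>)
  qed
  obtain Y e where Y: "Y \<subseteq> X \<times> UNIV" "\<And>y. y \<in> Y \<Longrightarrow> e y \<in> Rh P"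
    "\<And>x y. x \<in> Y \<Longrightarrow> y \<in> Y \<Longrightarrow> e y (fst x) $ snd x = (if x = y then 1 else 0)"
    "\<And>f. f \<in> Rh P \<Longrightarrow> f = (\<lambda>x. \<Sum>y\<in>Y. (f (fst y) $ snd y) *s e y x)"
    by (rule nodal_basis_vec[of "Rh P" X, OF Rh_lincomb X(1) un]) auto
  have "finite Y"
    by (rule finite_subset[OF Y(1)]) (simp add: X(1))
  from that[OF this Y(2-4)] show thesis
    by blast
qed

lemma cellwise_zero:
  fixes v :: "R3 \<Rightarrow> 'b::real_vector"
  assumes "\<And>T c (L :: R3 \<Rightarrow> 'b) x. T \<in> M \<Longrightarrow> linear L \<Longrightarrow> (\<forall>z\<in>X \<inter> interior T. c + L z = 0) \<Longrightarrow> c + L x = 0"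
    and "\<And>T. T \<in> M \<Longrightarrow> \<exists>c L. linear L \<and> (\<forall>x\<in>T. v x = c + L x)"
    and "\<forall>x\<in>X. v x = 0" "\<And>x. x \<notin> \<Union>M \<Longrightarrow> v x = 0"
  shows "v = (\<lambda>x. 0)"
proof
  fix x
  show "v x = 0"
  proof (cases "x \<in> \<Union>M")
    case True
    then obtain T where T: "T \<in> M" "x \<in> T"
      by blast
    then obtain c L where L: "linear L" "\<forall>x\<in>T. v x = c + L x"
      using assms(2) by blast
    have "\<forall>z\<in>X \<inter> interior T. c + L z = 0"
      using assms(3) L(2) interior_subset by fastforce
    then show ?thesis
      using assms(1)[OF T(1) L(1)] L(2) T(2) by simp
  qed (use assms(4) in auto)
qed

lemma Uh_basis:
  obtains Y e where "finite Y" "\<And>y. y \<in> Y \<Longrightarrow> e y \<in> Uh P"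
    "\<And>x y. x \<in> Y \<Longrightarrow> y \<in> Y \<Longrightarrow> e y x = (if x = y then 1 else 0)"
    "\<And>v. v \<in> Uh P \<Longrightarrow> v = (\<lambda>x. \<Sum>y\<in>Y. v y * e y x)"
proof -
  have M: "finite (mesh0 P)" "\<And>T. T \<in> mesh0 P \<Longrightarrow> interior T \<noteq> {}"
    using meshed_Om0 by (auto simp: meshed_def)
  obtain X where X: "finite X" "X \<subseteq> (\<Union>T\<in>mesh0 P. interior T)"
    "\<And>T c (L :: R3 \<Rightarrow> complex) x. T \<in> mesh0 P \<Longrightarrow> linear L \<Longrightarrow> (\<forall>z\<in>X \<inter> interior T. c + L z = 0) \<Longrightarrow> c + L x = 0"
    using mesh_unisolvent[OF M] by metis
  have un: "v = (\<lambda>x. 0)" if v: "v \<in> Uh P" "\<forall>x\<in>X. v x = 0" for v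
  proof (rule cellwise_zero[of "mesh0 P" X v])
    show "c + L x = 0" if "T \<in> mesh0 P" "linear L" "\<forall>z\<in>X \<inter> interior T. c + L z = 0"
      for T c and L :: "R3 \<Rightarrow> complex" and x
      by (rule X(3)[OF that])
    show "\<exists>c L. linear L \<and> (\<forall>x\<in>T. v x = c + L x)" if "T \<in> mesh0 P" for T
      by (rule Uh_cell[OF v(1) that])
  qed (use v closure_Om0 in \<open>auto simp: Uh_def\<close>)
  obtain Y e where Y: "Y \<subseteq> X" "\<And>y. y \<in> Y \<Longrightarrow> e y \<in> Uh P"
    "\<And>x y. x \<in> Y \<Longrightarrow> y \<in> Y \<Longrightarrow> e y x = (if x = y then 1 else 0)"
    "\<And>f. f \<in> Uh P \<Longrightarrow> f = (\<lambda>x. \<Sum>y\<in>Y. f y * e y x)"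
    by (rule nodal_basis[of "Uh P" X, OF Uh_lincomb X(1) un]) auto
  have "finite Y"
    using Y(1) X(1) by (rule finite_subset)
  from that[OF this Y(2-4)] show thesis
    by blast
qed

lemma Wh_basis:
  obtains Y e where "finite Y" "\<And>y. y \<in> Y \<Longrightarrow> e y \<in> Wh"
    "\<And>v. v \<in> Wh \<Longrightarrow> v = (\<lambda>x. \<Sum>y\<in>Y. v y * e y x)"
proof -
  have M: "finite (meshC P)" "\<And>T. T \<in> meshC P \<Longrightarrow> interior T \<noteq> {}"
    using meshed_OmC by (auto simp: meshed_def)
  obtain X where X: "finite X" "X \<subseteq> (\<Union>T\<in>meshC P. interior T)"
    "\<And>T c (L :: R3 \<Rightarrow> real) x. T \<in> meshC P \<Longrightarrow> linear L \<Longrightarrow> (\<forall>z\<in>X \<inter> interior T. c + L z = 0) \<Longrightarrow> c + L x = 0"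
    using mesh_unisolvent[OF M] by metis
  have un: "v = (\<lambda>x. 0)" if v: "v \<in> Wh" "\<forall>x\<in>X. v x = 0" for v
  proof -
    have "v \<in> Vh P"
      using v(1) by (simp add: Wh_def)
    show ?thesis
    proof (rule cellwise_zero[of "meshC P" X v])
      show "c + L x = 0" if "T \<in> meshC P" "linear L" "\<forall>z\<in>X \<inter> interior T. c + L z = 0"
        for T c and L :: "R3 \<Rightarrow> real" and x
        by (rule X(3)[OF that])
      show "\<exists>c L. linear L \<and> (\<forall>x\<in>T. v x = c + L x)" if "T \<in> meshC P" for T
        by (rule Vh_cell[OF \<open>v \<in> Vh P\<close> that])
    qed (use v \<open>v \<in> Vh P\<close> closure_OmC in \<open>auto simp: Vh_def\<close>)
  qed
  obtain Y e where Y: "Y \<subseteq> X" "\<And>y. y \<in> Y \<Longrightarrow> e y \<in> Wh"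
    "\<And>f. f \<in> Wh \<Longrightarrow> f = (\<lambda>x. \<Sum>y\<in>Y. f y * e y x)"
    by (rule nodal_basis[of Wh X, OF Wh_lincomb X(1) un]) auto
  have "finite Y"
    using Y(1) X(1) by (rule finite_subset)
  from that[OF this Y(2,3)] show thesis
    by blast
qed

end

section \<open>Dependence of the discrete fields on the conductivity\<close>

context eddy_setting
begin

lemma Linf_scalar_cdot:
  assumes "Linf N r" "Linf N u" "Linf N v"
  shows "Linf N (\<lambda>x. r x * cdot (u x) (cconj (v x)))"
  by (intro Linf_bilinear[OF bounded_bilinear_mult] Linf_bilinear[OF bounded_bilinear_cdot]
      Linf_bounded_linear[OF bounded_linear_cconj] assms)

lemma eps_Linf: "Linf (lebesgue_on (Om0 P)) (\<lambda>x. complex_of_real (eps P x))"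
proof (rule Linf_bounded_linear[OF bounded_linear_of_real])
  obtain c C where C: "0 < c" "\<forall>x\<in>Om0 P. c \<le> eps P x \<and> eps P x \<le> C"
    using data by (auto simp: valid_data_def)
  then have "AE x in lebesgue_on (Om0 P). norm (eps P x) \<le> C"
    by (intro AE_I2) fastforce
  then show "Linf (lebesgue_on (Om0 P)) (eps P)"
    using data by (auto simp: Linf_def valid_data_def)
qed

lemma b_form_lincomb_left:
  assumes "Linf (lebesgue_on (Om0 P)) u" "Linf (lebesgue_on (Om0 P)) v" "Linf (lebesgue_on (Om0 P)) w"
  shows "b_form P (\<lambda>x. a *s u x + b *s v x) w = a * b_form P u w + b * b_form P v w"
proof -
  have int: "integrable (lebesgue_on (Om0 P)) (\<lambda>x. of_real (eps P x) * cdot (z x) (cconj (w x)))"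
    if "Linf (lebesgue_on (Om0 P)) z" for z
    by (rule Linf_integrable[OF fin_Om0 Linf_scalar_cdot[OF eps_Linf that assms(3)]])
  have "b_form P (\<lambda>x. a *s u x + b *s v x) w = (LINT x|lebesgue_on (Om0 P).
      a * (of_real (eps P x) * cdot (u x) (cconj (w x))) + b * (of_real (eps P x) * cdot (v x) (cconj (w x))))"
    unfolding b_form_def by (simp add: cdot_scalar_left algebra_simps)
  then show ?thesis
    unfolding b_form_def using int[OF assms(1)] int[OF assms(2)] by simp
qed

lemma b_form_cong_AE:
  assumes "AE x in lebesgue_on (Om0 P). u x = v x"
  shows "b_form P u w = b_form P v w"
  unfolding b_form_def
  by (rule integral_lebesgue_on_cong_AE[OF meshed_sets[OF meshed_Om0]]) (use assms in \<open>auto elim: eventually_mono\<close>)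

lemma b_form_grad_lincomb:
  assumes "p \<in> Uh P" "q \<in> Uh P" "Linf (lebesgue_on (Om0 P)) w"
  shows "b_form P (grad (\<lambda>x. a * p x + b * q x)) w = a * b_form P (grad p) w + b * b_form P (grad q) w"
proof -
  note pw = Uh_pw_affine[OF assms(1)] Uh_pw_affine[OF assms(2)]
  have "AE x in lebesgue_on (Om0 P). grad (\<lambda>x. a * p x + b * q x) x = a *s grad p x + b *s grad q x"
    using pw_affine_differentiable[OF meshed_Om0 pw(1)] pw_affine_differentiable[OF meshed_Om0 pw(2)]
    by eventually_elim (rule grad_lincomb_complex)
  then have "b_form P (grad (\<lambda>x. a * p x + b * q x)) w = b_form P (\<lambda>x. a *s grad p x + b *s grad q x) w"
    by (rule b_form_cong_AE)
  also have "\<dots> = a * b_form P (grad p) w + b * b_form P (grad q) w"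
    by (intro b_form_lincomb_left grad_Linf[OF meshed_Om0] pw assms(3))
  finally show ?thesis .
qed

lemma Rh_Linf0: "E \<in> Rh P \<Longrightarrow> Linf (lebesgue_on (Om0 P)) E"
  by (rule pw_affine_Linf[OF meshed_Om0 Rh_pw_affine'(1)])

lemma Rh_LinfC: "E \<in> Rh P \<Longrightarrow> Linf (muC P) E"
  by (rule pw_affine_Linf[OF meshed_OmC Rh_pw_affine'(2)])

lemma Rh_Linf: "E \<in> Rh P \<Longrightarrow> Linf (lebesgue_on (Om P)) E"
  by (rule pw_affine_Linf[OF meshed_Om Rh_pw_affine])

lemma Uh_grad_Linf: "p \<in> Uh P \<Longrightarrow> Linf (lebesgue_on (Om0 P)) (grad p)"
  by (rule grad_Linf[OF meshed_Om0 Uh_pw_affine])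

lemma Rh_curl_Linf: "E \<in> Rh P \<Longrightarrow> Linf (lebesgue_on (Om P)) (curl E)"
  by (rule curl_Linf[OF meshed_Om Rh_pw_affine])

lemma conductivity_measurable:
  assumes "\<sigma> \<in> Vh P"
  shows "(\<lambda>x. ext0 P \<sigma> x + sigma0 P x) \<in> borel_measurable (lebesgue_on (Om P))"
proof -
  have "ext0 P \<sigma> = \<sigma>"
    using Vh_zero_outside[OF assms] by (auto simp: ext0_def)
  moreover have "\<sigma> \<in> borel_measurable borel"
    using Vh_continuous[OF assms] by (rule borel_measurable_continuous_onI)
  moreover have "sigma0 P \<in> borel_measurable borel"
  proof -
    have "sigma0 P = (\<lambda>x. indicator (OmC P) x * sigC P)"
      by (auto simp: sigma0_def)
    then show ?thesis
      using open_OmC by simp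
  qed
  ultimately have "(\<lambda>x. ext0 P \<sigma> x + sigma0 P x) \<in> borel_measurable borel"
    by simp
  then show ?thesis
    by (intro measurable_restrict_space1 measurable_completion) simp
qed

lemma conductivity_bound:
  assumes "\<sigma> \<in> Kh P"
  shows "norm (ext0 P \<sigma> x + sigma0 P x) \<le> max \<bar>m0 P\<bar> \<bar>m1 P\<bar> + sigC P"
  using Kh_bound[OF assms, of x] data by (auto simp: ext0_def sigma0_def valid_data_def)

lemma conductivity_Linf:
  assumes "\<sigma> \<in> Kh P"
  shows "Linf (lebesgue_on (Om P)) (\<lambda>x. complex_of_real (freq P * (ext0 P \<sigma> x + sigma0 P x)))"
proof -
  have "Linf (lebesgue_on (Om P)) (\<lambda>x. ext0 P \<sigma> x + sigma0 P x)"
    unfolding Linf_def using conductivity_measurable[OF Kh_Vh[OF assms]] conductivity_bound[OF assms]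
    by (auto intro!: AE_I2)
  from Linf_bounded_linear[OF bounded_linear_of_real Linf_bounded_linear[OF bounded_linear_mult_right this]]
  show ?thesis .
qed

lemma a_form_integrand_Linf:
  assumes "\<sigma> \<in> Kh P" "E \<in> Rh P" "F \<in> Rh P"
  shows "Linf (lebesgue_on (Om P)) (\<lambda>x. of_real (inverse (mu P)) * cdot (curl E x) (cconj (curl F x))
      - \<i> * of_real (freq P * (ext0 P \<sigma> x + sigma0 P x)) * cdot (E x) (cconj (F x)))"
  using assms
  by (intro Linf_diff Linf_scalar_cdot Linf_const Rh_Linf Rh_curl_Linf
      Linf_bilinear[OF bounded_bilinear_mult Linf_const] conductivity_Linf)

lemma a_form_lincomb_left:
  assumes "\<sigma> \<in> Kh P" "E \<in> Rh P" "E' \<in> Rh P" "F \<in> Rh P"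
  shows "a_form P \<sigma> (\<lambda>x. a *s E x + b *s E' x) F = a * a_form P \<sigma> E F + b * a_form P \<sigma> E' F"
proof -
  let ?i = "\<lambda>E x. of_real (inverse (mu P)) * cdot (curl E x) (cconj (curl F x))
      - \<i> * of_real (freq P * (ext0 P \<sigma> x + sigma0 P x)) * cdot (E x) (cconj (F x))"
  note pw = Rh_pw_affine[OF assms(2)] Rh_pw_affine[OF assms(3)]
  have "AE x in lebesgue_on (Om P). ?i (\<lambda>x. a *s E x + b *s E' x) x = a * ?i E x + b * ?i E' x"
    using pw_affine_differentiable[OF meshed_Om pw(1)] pw_affine_differentiable[OF meshed_Om pw(2)]
  proof eventually_elim
    case (elim x)
    show ?case
      unfolding curl_lincomb[OF elim] cdot_scalar_left by (simp add: algebra_simps)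
  qed
  then have "a_form P \<sigma> (\<lambda>x. a *s E x + b *s E' x) F = (LINT x|lebesgue_on (Om P). a * ?i E x + b * ?i E' x)"
    unfolding a_form_def by (rule integral_lebesgue_on_cong_AE[OF meshed_sets[OF meshed_Om]])
  also have "\<dots> = a * a_form P \<sigma> E F + b * a_form P \<sigma> E' F"
    unfolding a_form_def
    using Linf_integrable[OF fin_Om a_form_integrand_Linf[OF assms(1,2,4)]]
      Linf_integrable[OF fin_Om a_form_integrand_Linf[OF assms(1,3,4)]]
    by (subst Bochner_Integration.integral_add) simp_all
  finally show ?thesis .
qed

text \<open>Only the conductivity varies with \<open>j\<close>, and the members of \<open>Kh\<close>
  share one pointwise bound, so a constant dominates all integrands almost everywhere.\<close>

lemma a_form_limit:
  assumes \<sigma>: "\<And>j. \<sigma> j \<in> Kh P" and t: "t \<in> Kh P" and lim: "\<And>x. (\<lambda>j. \<sigma> j x) \<longlonglongrightarrow> t x"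
    and EF: "E \<in> Rh P" "F \<in> Rh P"
  shows "(\<lambda>j. a_form P (\<sigma> j) E F) \<longlonglongrightarrow> a_form P t E F"
proof -
  obtain A where "A > 0" and A: "AE x in lebesgue_on (Om P).
      norm (of_real (inverse (mu P)) * cdot (curl E x) (cconj (curl F x))) \<le> A"
    by (rule Linf_bound[OF Linf_scalar_cdot[OF Linf_const Rh_curl_Linf[OF EF(1)] Rh_curl_Linf[OF EF(2)]]])
  obtain B where "B > 0" and B: "AE x in lebesgue_on (Om P). norm (1 * cdot (E x) (cconj (F x))) \<le> B"
    by (rule Linf_bound[OF Linf_scalar_cdot[OF Linf_const Rh_Linf[OF EF(1)] Rh_Linf[OF EF(2)]]])
  define C where "C = \<bar>freq P\<bar> * (max \<bar>m0 P\<bar> \<bar>m1 P\<bar> + sigC P)"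
  show ?thesis
    unfolding a_form_def
  proof (rule integral_dominated_convergence[where w = "\<lambda>x. A + C * B"])
    show "integrable (lebesgue_on (Om P)) (\<lambda>x. A + C * B)"
      by (rule Linf_integrable[OF fin_Om Linf_const])
    show "AE x in lebesgue_on (Om P). norm (of_real (inverse (mu P)) * cdot (curl E x) (cconj (curl F x))
        - \<i> * of_real (freq P * (ext0 P (\<sigma> j) x + sigma0 P x)) * cdot (E x) (cconj (F x))) \<le> A + C * B" for j
      using A B
    proof eventually_elim
      case (elim x)
      have "norm (\<i> * of_real (freq P * (ext0 P (\<sigma> j) x + sigma0 P x)) * cdot (E x) (cconj (F x))) =
          \<bar>freq P\<bar> * norm (ext0 P (\<sigma> j) x + sigma0 P x) * norm (cdot (E x) (cconj (F x)))"
        by (simp add: norm_mult abs_mult del: of_real_add of_real_mult)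
      also have "\<dots> \<le> C * B"
        unfolding C_def
      proof (intro mult_mono mult_left_mono conductivity_bound[OF \<sigma>])
        show "norm (cdot (E x) (cconj (F x))) \<le> B"
          using elim(2) by simp
        show "0 \<le> \<bar>freq P\<bar> * (max \<bar>m0 P\<bar> \<bar>m1 P\<bar> + sigC P)"
          using order_trans[OF norm_ge_zero conductivity_bound[OF \<sigma>]] by (intro mult_nonneg_nonneg) auto
      qed simp_all
      finally show ?case
        using elim(1) by (intro order_trans[OF norm_triangle_ineq4 add_mono])
    qed
    show "AE x in lebesgue_on (Om P). (\<lambda>j. of_real (inverse (mu P)) * cdot (curl E x) (cconj (curl F x))
        - \<i> * of_real (freq P * (ext0 P (\<sigma> j) x + sigma0 P x)) * cdot (E x) (cconj (F x)))
        \<longlonglongrightarrow> of_real (inverse (mu P)) * cdot (curl E x) (cconj (curl F x))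
        - \<i> * of_real (freq P * (ext0 P t x + sigma0 P x)) * cdot (E x) (cconj (F x))"
    proof (rule AE_I2)
      fix x
      have "(\<lambda>j. ext0 P (\<sigma> j) x) \<longlonglongrightarrow> ext0 P t x"
        using lim[of x] by (simp add: ext0_def)
      then show "(\<lambda>j. of_real (inverse (mu P)) * cdot (curl E x) (cconj (curl F x))
        - \<i> * of_real (freq P * (ext0 P (\<sigma> j) x + sigma0 P x)) * cdot (E x) (cconj (F x)))
        \<longlonglongrightarrow> of_real (inverse (mu P)) * cdot (curl E x) (cconj (curl F x))
        - \<i> * of_real (freq P * (ext0 P t x + sigma0 P x)) * cdot (E x) (cconj (F x))"
        by (intro tendsto_intros)
    qed
  qed (use a_form_integrand_Linf[OF \<sigma> EF] a_form_integrand_Linf[OF t EF] in \<open>auto dest: Linf_measurable\<close>)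
qed

text \<open>State and adjoint state solve the same saddle point system with different right-hand sides.\<close>

definition solves :: "(R3 \<Rightarrow> real) \<Rightarrow> ((R3 \<Rightarrow> C3) \<Rightarrow> complex) \<Rightarrow> (R3 \<Rightarrow> C3) \<Rightarrow> (R3 \<Rightarrow> complex) \<Rightarrow> bool" where
  "solves \<sigma> R E p \<longleftrightarrow> E \<in> Rh P \<and> p \<in> Uh P \<and>
     (\<forall>F\<in>Rh P. a_form P \<sigma> E F + b_form P (grad p) F = R F) \<and> (\<forall>q\<in>Uh P. b_form P E (grad q) = 0)"

definition state_rhs :: "(R3 \<Rightarrow> C3) \<Rightarrow> complex" where
  "state_rhs F = \<i> * of_real (freq P) * (LINT x|lebesgue_on (Om P). cdot (Js P x) (cconj (F x)))"

definition adjoint_rhs :: "(R3 \<Rightarrow> C3) \<Rightarrow> (R3 \<Rightarrow> C3) \<Rightarrow> complex" where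
  "adjoint_rhs E0 E = (LINT x|muG P.
     cdot (ccross (ccross (nrm P x) (cconj (Eobs P x - bdry_trace (Om P) E0 x))) (nrm P x))
       (cconj (bdry_trace (Om P) E x)))"

lemma is_state_solves: "is_state P \<sigma> E p \<longleftrightarrow> solves \<sigma> state_rhs E p"
  by (simp add: is_state_def solves_def state_rhs_def)

lemma is_adjoint_solves: "is_adjoint P \<sigma> F p \<longleftrightarrow> solves \<sigma> (adjoint_rhs (Eh P \<sigma>)) F p"
  by (simp add: is_adjoint_def solves_def adjoint_rhs_def)

lemma solves_lincomb:
  assumes \<sigma>: "\<sigma> \<in> Kh P" and "solves \<sigma> R E p" "solves \<sigma> R' E' p'"
  shows "solves \<sigma> (\<lambda>F. a * R F + b * R' F) (\<lambda>x. a *s E x + b *s E' x) (\<lambda>x. a * p x + b * p' x)"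
  unfolding solves_def
proof (intro conjI ballI)
  note s = assms(2,3)[unfolded solves_def]
  show "(\<lambda>x. a *s E x + b *s E' x) \<in> Rh P" "(\<lambda>x. a * p x + b * p' x) \<in> Uh P"
    using s Rh_lincomb Uh_lincomb by auto
  show "a_form P \<sigma> (\<lambda>x. a *s E x + b *s E' x) F + b_form P (grad (\<lambda>x. a * p x + b * p' x)) F = a * R F + b * R' F"
    if F: "F \<in> Rh P" for F
  proof -
    have R: "R F = a_form P \<sigma> E F + b_form P (grad p) F" "R' F = a_form P \<sigma> E' F + b_form P (grad p') F"
      using s F by auto
    have m: "E \<in> Rh P" "E' \<in> Rh P" "p \<in> Uh P" "p' \<in> Uh P"
      using s by auto
    show ?thesis
      unfolding R a_form_lincomb_left[OF \<sigma> m(1,2) F] b_form_grad_lincomb[OF m(3,4) Rh_Linf0[OF F]]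
      by (simp add: algebra_simps)
  qed
  show "b_form P (\<lambda>x. a *s E x + b *s E' x) (grad q) = 0" if q: "q \<in> Uh P" for q
    using s q by (simp add: b_form_lincomb_left Rh_Linf0 Uh_grad_Linf)
qed

section \<open>Solvability and uniqueness of the discrete problems\<close>

lemma Ex1_state: "\<sigma> \<in> Kh P \<Longrightarrow> \<exists>!z. case z of (E, p) \<Rightarrow> solves \<sigma> state_rhs E p"
  using well_posed by (simp add: well_posed_def is_state_solves)

lemma Ex1_adjoint: "\<sigma> \<in> Kh P \<Longrightarrow> \<exists>!z. case z of (F, p) \<Rightarrow> solves \<sigma> (adjoint_rhs (Eh P \<sigma>)) F p"
  using well_posed by (simp add: well_posed_def is_adjoint_solves)

text \<open>Well-posedness is assumed for two specific right-hand sides only. Adding a homogeneous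
  solution to the state would give a second solution of the state problem.\<close>

lemma solves_homogeneous:
  assumes \<sigma>: "\<sigma> \<in> Kh P" and h: "solves \<sigma> (\<lambda>F. 0) E p"
  shows "E = (\<lambda>x. 0)" "p = (\<lambda>x. 0)"
proof -
  obtain E0 p0 where 0: "solves \<sigma> state_rhs E0 p0"
    using Ex1_state[OF \<sigma>] by auto
  have "solves \<sigma> state_rhs (\<lambda>x. E0 x + E x) (\<lambda>x. p0 x + p x)"
    using solves_lincomb[OF \<sigma> 0 h, of 1 1] by simp
  then have "(\<lambda>x. E0 x + E x, \<lambda>x. p0 x + p x) = (E0, p0)"
    using Ex1_state[OF \<sigma>] 0 by (metis (mono_tags, lifting) case_prod_conv)
  then have "\<forall>x. E0 x + E x = E0 x" "\<forall>x. p0 x + p x = p0 x"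
    by (auto dest: fun_cong)
  then show "E = (\<lambda>x. 0)" "p = (\<lambda>x. 0)"
    by auto
qed

lemma solves_unique:
  assumes \<sigma>: "\<sigma> \<in> Kh P" and "solves \<sigma> R E p" "solves \<sigma> R E' p'"
  shows "E = E'" "p = p'"
proof -
  have h: "solves \<sigma> (\<lambda>F. 0) (\<lambda>x. E x - E' x) (\<lambda>x. p x - p' x)"
    using solves_lincomb[OF assms, of 1 "-1"] by simp
  show "E = E'" "p = p'"
    using solves_homogeneous[OF \<sigma> h] by (auto simp: fun_eq_iff)
qed

text \<open>Well-posedness speaks of pairs, whereas \<open>Eh\<close> describes the field alone;
  \<open>solves_unique\<close> excludes two fields that come with different potentials.\<close>

lemma Eh_solves:
  assumes "\<sigma> \<in> Kh P"
  shows "\<exists>p. solves \<sigma> state_rhs (Eh P \<sigma>) p"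
proof -
  have "\<exists>!E. \<exists>p. solves \<sigma> state_rhs E p"
    using Ex1_state[OF assms] solves_unique(1)[OF assms] by (metis (mono_tags, lifting) case_prodE)
  from theI'[OF this] show ?thesis
    by (simp add: Eh_def is_state_solves)
qed

lemma Fh_solves:
  assumes "\<sigma> \<in> Kh P"
  shows "\<exists>p. solves \<sigma> (adjoint_rhs (Eh P \<sigma>)) (Fh P \<sigma>) p"
proof -
  have "\<exists>!F. \<exists>p. solves \<sigma> (adjoint_rhs (Eh P \<sigma>)) F p"
    using Ex1_adjoint[OF assms] solves_unique(1)[OF assms] by (metis (mono_tags, lifting) case_prodE)
  from theI'[OF this] show ?thesis
    by (simp add: Fh_def is_adjoint_solves)
qed

lemma Eh_Rh: "\<sigma> \<in> Kh P \<Longrightarrow> Eh P \<sigma> \<in> Rh P"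
  using Eh_solves by (auto simp: solves_def)

lemma Fh_Rh: "\<sigma> \<in> Kh P \<Longrightarrow> Fh P \<sigma> \<in> Rh P"
  using Fh_solves by (auto simp: solves_def)

lemma Gh'_Linf:
  assumes "\<sigma> \<in> Kh P"
  shows "Linf (muC P) (Gh' P \<sigma>)"
proof -
  have "Linf (muC P) (\<lambda>x. cdot (Eh P \<sigma> x) (Fh P \<sigma> x))"
    using assms by (intro Linf_bilinear[OF bounded_bilinear_cdot] Rh_LinfC Eh_Rh Fh_Rh)
  from Linf_bounded_linear[OF bounded_linear_mult_right Linf_bounded_linear[OF bounded_linear_Im this]]
  show ?thesis
    by (simp add: Gh'_def[abs_def])
qed

text \<open>Discrete fields depend on the conductivity only through integrals, hence only on its class
  modulo null sets.\<close>

lemma a_form_cong_AE: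
  assumes "AE x in muC P. \<sigma> x = \<tau> x"
  shows "a_form P \<sigma> = a_form P \<tau>"
proof (intro ext)
  fix E F
  have "negligible {x \<in> OmC P. \<sigma> x \<noteq> \<tau> x}"
    using assms by (simp add: AE_lebesgue_on_iff_negligible[OF sets_OmC])
  then have "negligible {x \<in> Om P. ext0 P \<sigma> x \<noteq> ext0 P \<tau> x}"
    by (rule negligible_subset) (auto simp: ext0_def)
  then have "AE x in lebesgue_on (Om P). ext0 P \<sigma> x = ext0 P \<tau> x"
    by (simp add: AE_lebesgue_on_iff_negligible[OF meshed_sets[OF meshed_Om]])
  then show "a_form P \<sigma> E F = a_form P \<tau> E F"
    unfolding a_form_def
    by (intro integral_lebesgue_on_cong_AE[OF meshed_sets[OF meshed_Om]]) (auto elim!: eventually_mono)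
qed

lemma Gh'_cong_AE:
  assumes "AE x in muC P. \<sigma> x = \<tau> x"
  shows "Gh' P \<sigma> = Gh' P \<tau>"
proof -
  have E: "Eh P \<sigma> = Eh P \<tau>"
    by (simp add: Eh_def is_state_def a_form_cong_AE[OF assms])
  then have "Fh P \<sigma> = Fh P \<tau>"
    by (simp add: Fh_def is_adjoint_def a_form_cong_AE[OF assms])
  with E show ?thesis
    by (simp add: Gh'_def[abs_def])
qed

text \<open>In nodal coordinates the saddle point problem is a linear system to which
  \<open>linear_systems_limit\<close> applies. Every test function gives a row, not just those of a
  basis: the forms are conjugate-linear in the test argument, and this way only linearity in the
  first argument is used.\<close>

lemma solves_limit:
  assumes \<sigma>: "\<And>j. \<sigma> j \<in> Kh P" and t: "t \<in> Kh P" and lim: "\<And>x. (\<lambda>j. \<sigma> j x) \<longlonglongrightarrow> t x"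
    and sol: "\<And>j. solves (\<sigma> j) (R j) (E j) (p j)"
    and R: "\<And>F. F \<in> Rh P \<Longrightarrow> (\<lambda>j. R j F) \<longlonglongrightarrow> R' F"
  shows "\<exists>r E' p'. strict_mono (r :: nat \<Rightarrow> nat) \<and> solves t R' E' p' \<and> (\<forall>x. (\<lambda>j. E (r j) x) \<longlonglongrightarrow> E' x)"
proof -
  obtain Y e where Y: "finite Y" "\<And>y. y \<in> Y \<Longrightarrow> e y \<in> Rh P"
    "\<And>x y. x \<in> Y \<Longrightarrow> y \<in> Y \<Longrightarrow> e y (fst x) $ snd x = (if x = y then 1 else 0)"
    "\<And>E. E \<in> Rh P \<Longrightarrow> E = (\<lambda>x. \<Sum>y\<in>Y. (E (fst y) $ snd y) *s e y x)"
    by (rule Rh_basis) (rule that)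
  obtain Z q where Z: "finite Z" "\<And>z. z \<in> Z \<Longrightarrow> q z \<in> Uh P"
    "\<And>x y. x \<in> Z \<Longrightarrow> y \<in> Z \<Longrightarrow> q y x = (if x = y then 1 else 0)"
    "\<And>v. v \<in> Uh P \<Longrightarrow> v = (\<lambda>x. \<Sum>z\<in>Z. v z * q z x)"
    by (rule Uh_basis) (rule that)
  define cE where "cE c x = (\<Sum>y\<in>Y. c (Inl y) *s e y x)" for c :: "(R3 \<times> 3) + R3 \<Rightarrow> complex" and x
  define cp where "cp c x = (\<Sum>z\<in>Z. c (Inr z) * q z x)" for c :: "(R3 \<times> 3) + R3 \<Rightarrow> complex" and x
  define I where "I = Y <+> Z"
  \<comment> \<open>Rows are indexed by all functions of the right type; those outside the test
    spaces contribute \<open>0 = 0\<close>.\<close>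
  define A where "A s m i = (case m of
      Inl F \<Rightarrow> if F \<in> Rh P then (case i of Inl y \<Rightarrow> a_form P s (e y) F | Inr z \<Rightarrow> b_form P (grad (q z)) F) else 0
    | Inr \<psi> \<Rightarrow> if \<psi> \<in> Uh P then (case i of Inl y \<Rightarrow> b_form P (e y) (grad \<psi>) | Inr z \<Rightarrow> 0) else 0)"
    for s and m :: "(R3 \<Rightarrow> C3) + (R3 \<Rightarrow> complex)" and i
  define b where "b R m = (case m of Inl F \<Rightarrow> if F \<in> Rh P then R F else 0 | Inr \<psi> \<Rightarrow> 0)"
    for R :: "(R3 \<Rightarrow> C3) \<Rightarrow> complex" and m :: "(R3 \<Rightarrow> C3) + (R3 \<Rightarrow> complex)"
  obtain E0 p0 where "E0 \<in> Rh P" "p0 \<in> Uh P"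
    using sol[of 0] by (auto simp: solves_def)
  have "cE c \<in> Rh P \<and> (\<forall>\<phi> :: (R3 \<Rightarrow> C3) \<Rightarrow> complex.
      (\<forall>f\<in>Rh P. \<forall>g\<in>Rh P. \<forall>a b. \<phi> (\<lambda>x. a *s f x + b *s g x) = a * \<phi> f + b * \<phi> g) \<longrightarrow>
      \<phi> (cE c) = (\<Sum>y\<in>Y. c (Inl y) * \<phi> (e y)))" for c
    unfolding cE_def[abs_def]
    by (rule linear_combination_sum[where sm = "(*s)" and S = "Rh P" and e = e, OF _ _ Rh_lincomb \<open>E0 \<in> Rh P\<close> Y(1,2)])
      simp_all
  then have sumE: "cE c \<in> Rh P"
      "(\<And>f g a b. f \<in> Rh P \<Longrightarrow> g \<in> Rh P \<Longrightarrow> \<phi> (\<lambda>x. a *s f x + b *s g x) = a * \<phi> f + b * \<phi> g) \<Longrightarrow>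
        \<phi> (cE c) = (\<Sum>y\<in>Y. c (Inl y) * \<phi> (e y))" for c and \<phi> :: "(R3 \<Rightarrow> C3) \<Rightarrow> complex"
    by blast+
  have "cp c \<in> Uh P \<and> (\<forall>\<phi> :: (R3 \<Rightarrow> complex) \<Rightarrow> complex.
      (\<forall>f\<in>Uh P. \<forall>g\<in>Uh P. \<forall>a b. \<phi> (\<lambda>x. a * f x + b * g x) = a * \<phi> f + b * \<phi> g) \<longrightarrow>
      \<phi> (cp c) = (\<Sum>z\<in>Z. c (Inr z) * \<phi> (q z)))" for c
    unfolding cp_def[abs_def]
    by (rule linear_combination_sum[where sm = "(*)" and S = "Uh P" and e = q, OF _ _ Uh_lincomb \<open>p0 \<in> Uh P\<close> Z(1,2)])
      simp_all
  then have sump: "cp c \<in> Uh P"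
      "(\<And>f g a b. f \<in> Uh P \<Longrightarrow> g \<in> Uh P \<Longrightarrow> \<phi> (\<lambda>x. a * f x + b * g x) = a * \<phi> f + b * \<phi> g) \<Longrightarrow>
        \<phi> (cp c) = (\<Sum>z\<in>Z. c (Inr z) * \<phi> (q z))" for c and \<phi> :: "(R3 \<Rightarrow> complex) \<Rightarrow> complex"
    by blast+
  have sys: "solves s R (cE c) (cp c) \<longleftrightarrow> (\<forall>m. (\<Sum>i\<in>I. A s m i * c i) = b R m)" if s: "s \<in> Kh P" for s R c
  proof -
    have a: "a_form P s (cE c) F = (\<Sum>y\<in>Y. c (Inl y) * a_form P s (e y) F)" if "F \<in> Rh P" for F
      by (rule sumE(2)) (rule a_form_lincomb_left[OF s _ _ that])
    have b1: "b_form P (cE c) (grad \<psi>) = (\<Sum>y\<in>Y. c (Inl y) * b_form P (e y) (grad \<psi>))" if "\<psi> \<in> Uh P" for \<psi>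
      by (rule sumE(2)) (intro b_form_lincomb_left Rh_Linf0 Uh_grad_Linf that)
    have b2: "b_form P (grad (cp c)) F = (\<Sum>z\<in>Z. c (Inr z) * b_form P (grad (q z)) F)" if "F \<in> Rh P" for F
      by (rule sump(2)[of "\<lambda>p. b_form P (grad p) F"]) (intro b_form_grad_lincomb Rh_Linf0 that)
    define row where "row m = (\<Sum>i\<in>I. A s m i * c i)" for m
    have row1: "row (Inl F) = a_form P s (cE c) F + b_form P (grad (cp c)) F" if "F \<in> Rh P" for F
      unfolding row_def I_def using Y(1) Z(1) that by (subst sum.Plus) (simp_all add: A_def a b2 mult.commute)
    have row2: "row (Inr \<psi>) = b_form P (cE c) (grad \<psi>)" if "\<psi> \<in> Uh P" for \<psi>
      unfolding row_def I_def using Y(1) Z(1) that by (subst sum.Plus) (simp_all add: A_def b1 mult.commute)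
    have trivial_row: "F \<notin> Rh P \<Longrightarrow> row (Inl F) = 0" "\<psi> \<notin> Uh P \<Longrightarrow> row (Inr \<psi>) = 0" for F \<psi>
      by (simp_all add: row_def A_def)
    have "(\<forall>m. row m = b R m) \<longleftrightarrow> (\<forall>F. row (Inl F) = b R (Inl F)) \<and> (\<forall>\<psi>. row (Inr \<psi>) = b R (Inr \<psi>))"
      by (rule split_sum_all)
    also have "\<dots> \<longleftrightarrow> (\<forall>F\<in>Rh P. row (Inl F) = R F) \<and> (\<forall>\<psi>\<in>Uh P. row (Inr \<psi>) = 0)"
      using trivial_row by (auto simp: b_def)
    also have "\<dots> \<longleftrightarrow> solves s R (cE c) (cp c)"
      using sumE(1) sump(1) by (simp add: solves_def row1 row2)
    finally show ?thesis
      by (simp add: row_def)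
  qed
  define c where "c j i = (case i of Inl y \<Rightarrow> E j (fst y) $ snd y | Inr z \<Rightarrow> p j z)" for j i
  have solR: "E j \<in> Rh P" "p j \<in> Uh P" for j
    using sol[of j] by (auto simp: solves_def)
  have Ec: "cE (c j) = E j" for j
  proof -
    have "cE (c j) = (\<lambda>x. \<Sum>y\<in>Y. (E j (fst y) $ snd y) *s e y x)"
      by (simp add: cE_def[abs_def] c_def)
    then show ?thesis
      using Y(4)[OF solR(1)] by (rule trans[OF _ sym])
  qed
  have pc: "cp (c j) = p j" for j
  proof -
    have "cp (c j) = (\<lambda>x. \<Sum>z\<in>Z. p j z * q z x)"
      by (simp add: cp_def[abs_def] c_def)
    then show ?thesis
      using Z(4)[OF solR(2)] by (rule trans[OF _ sym])
  qed
  have "\<exists>r c'. strict_mono (r :: nat \<Rightarrow> nat) \<and> (\<forall>i\<in>I. (\<lambda>j. c (r j) i) \<longlonglongrightarrow> c' i) \<and>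
      (\<forall>m. (\<Sum>i\<in>I. A t m i * c' i) = b R' m)"
  proof (rule linear_systems_limit)
    show "finite I"
      using Y(1) Z(1) by (simp add: I_def)
    show "(\<Sum>i\<in>I. A (\<sigma> j) m i * c j i) = b (R j) m" for j m
      using sol[of j] sys[OF \<sigma>, of j "R j" "c j"] by (simp add: Ec pc)
    show "(\<lambda>j. A (\<sigma> j) m i) \<longlonglongrightarrow> A t m i" if "i \<in> I" for m i
      using that Y(2) a_form_limit[OF \<sigma> t lim] by (auto simp: A_def I_def split: sum.split)
    show "(\<lambda>j. b (R j) m) \<longlonglongrightarrow> b R' m" for m
      using R by (auto simp: b_def split: sum.split)
    fix c :: "(R3 \<times> 3) + R3 \<Rightarrow> complex"
    assume "\<And>m. (\<Sum>i\<in>I. A t m i * c i) = 0"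
    then have "solves t (\<lambda>F. 0) (cE c) (cp c)"
      unfolding sys[OF t] by (auto simp: b_def split: sum.split)
    from solves_homogeneous[OF t this] have 0: "cE c = (\<lambda>x. 0)" "cp c = (\<lambda>x. 0)"
      by auto
    \<comment> \<open>The cardinal property makes evaluation at a node read off one coefficient, so
      the zero field has only zero coefficients.\<close>
    have "c (Inl y) = 0" if "y \<in> Y" for y
    proof -
      have "0 = cE c (fst y) $ snd y"
        by (simp add: 0)
      also have "\<dots> = (\<Sum>x\<in>Y. if y = x then c (Inl x) else 0)"
        unfolding cE_def using that Y(3) by (simp add: sum_component) (auto intro!: sum.cong)
      also have "\<dots> = c (Inl y)"
        using that Y(1) by simp
      finally show ?thesis
        by simp
    qed
    moreover have "c (Inr z) = 0" if "z \<in> Z" for z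
    proof -
      have "0 = cp c z"
        by (simp add: 0)
      also have "\<dots> = (\<Sum>x\<in>Z. if z = x then c (Inr x) else 0)"
        unfolding cp_def using that Z(3) by (auto intro!: sum.cong)
      also have "\<dots> = c (Inr z)"
        using that Z(1) by simp
      finally show ?thesis
        by simp
    qed
    ultimately show "\<forall>i\<in>I. c i = 0"
      by (auto simp: I_def)
  qed
  then obtain r c' where r: "strict_mono r" "\<And>i. i \<in> I \<Longrightarrow> (\<lambda>j. c (r j) i) \<longlonglongrightarrow> c' i"
    "\<forall>m. (\<Sum>i\<in>I. A t m i * c' i) = b R' m"
    by blast
  have "solves t R' (cE c') (cp c')"
    using r(3) by (simp add: sys[OF t])
  moreover have "(\<lambda>j. E (r j) x) \<longlonglongrightarrow> cE c' x" for x
    unfolding Ec[symmetric] cE_def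
  proof (rule tendsto_sum)
    fix y assume "y \<in> Y"
    have "(\<lambda>j. \<chi> i. c (r j) (Inl y) * e y x $ i) \<longlonglongrightarrow> (\<chi> i. c' (Inl y) * e y x $ i)"
      by (intro tendsto_vec_lambda tendsto_mult_right r(2)) (use \<open>y \<in> Y\<close> in \<open>auto simp: I_def\<close>)
    then show "(\<lambda>j. c (r j) (Inl y) *s e y x) \<longlonglongrightarrow> c' (Inl y) *s e y x"
      by (simp add: vector_scalar_mult_def)
  qed
  ultimately show ?thesis
    using r(1) by blast
qed

end

section \<open>Hausdorff measure of polygons and segments\<close>

lemma hausdorff2_pre_le:
  assumes "A \<subseteq> (\<Union>i<m. V i)" "\<And>i. i < m \<Longrightarrow> bounded (V i)" "\<And>i. i < m \<Longrightarrow> diameter (V i) \<le> \<delta>"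
    and "0 \<le> \<delta>" "\<delta> \<le> d"
  shows "hausdorff2_pre d A \<le> ennreal (real m * (pi / 4 * \<delta>\<^sup>2))"
proof -
  \<comment> \<open>The definition asks for a sequence of sets; empty sets, of diameter zero, fill
    it up.\<close>
  define U where "U i = (if i < m then V i else {})" for i
  have U: "U \<in> {U. A \<subseteq> (\<Union>i. U i) \<and> (\<forall>i. bounded (U i) \<and> diameter (U i) \<le> d)}"
  proof -
    have "A \<subseteq> (\<Union>i. U i)"
    proof
      fix x assume "x \<in> A"
      then obtain i where "i < m" "x \<in> V i"
        using assms(1) by blast
      then have "x \<in> U i"
        by (simp add: U_def)
      then show "x \<in> (\<Union>i. U i)"
        by blast
    qed
    moreover have "bounded (U i) \<and> diameter (U i) \<le> d" for i
      using assms(2)[of i] assms(3)[of i] assms(4,5) by (auto simp: U_def)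
    ultimately show ?thesis
      by blast
  qed
  have "(\<Sum>i. ennreal (pi / 4 * (diameter (U i))\<^sup>2)) = (\<Sum>i<m. ennreal (pi / 4 * (diameter (U i))\<^sup>2))"
    by (rule suminf_finite) (auto simp: U_def)
  also have "\<dots> \<le> (\<Sum>i<m. ennreal (pi / 4 * \<delta>\<^sup>2))"
  proof (rule sum_mono)
    fix i assume "i \<in> {..<m}"
    then have "(diameter (U i))\<^sup>2 \<le> \<delta>\<^sup>2"
      using assms(2,3) by (intro power_mono diameter_ge_0) (auto simp: U_def)
    then show "ennreal (pi / 4 * (diameter (U i))\<^sup>2) \<le> ennreal (pi / 4 * \<delta>\<^sup>2)"
      by (intro ennreal_leI mult_left_mono) auto
  qed
  also have "\<dots> = ennreal (real m * (pi / 4 * \<delta>\<^sup>2))"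
    by (simp only: sum_constant card_lessThan ennreal_mult'[OF of_nat_0_le_iff] ennreal_of_nat_eq_real_of_nat)
  finally show ?thesis
    unfolding hausdorff2_pre_def by (intro INF_lower2[OF U])
qed

lemma unit_interval_cell:
  fixes t :: real
  assumes "0 \<le> t" "t \<le> 1" "n > 0"
  obtains p where "p < n" "real p / real n \<le> t" "t \<le> real p / real n + 1 / real n"
proof -
  \<comment> \<open>The minimum puts \<open>t = 1\<close>, where the floor is \<open>n\<close>, into
    the last cell.\<close>
  define p where "p = min (nat \<lfloor>t * n\<rfloor>) (n - 1)"
  have "real (nat \<lfloor>t * n\<rfloor>) \<le> t * n" "t * n < real (nat \<lfloor>t * n\<rfloor>) + 1"
    using assms by (auto simp: of_nat_nat)
  moreover have "t * n \<le> n"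
    using assms by (simp add: mult_left_le_one_le)
  ultimately have "real p \<le> t * n" "t * n \<le> real p + 1"
    unfolding p_def using assms(3) by (auto simp: min_def of_nat_diff)
  then show thesis
    using assms(3) by (intro that[of p]) (auto simp: p_def field_simps)
qed

text \<open>A grid of \<open>n * n\<close> pieces of diameter at most \<open>L / n\<close>
  contributes \<open>pi / 4 * L^2\<close>, whatever \<open>n\<close> is. The bound is thus uniform
  in \<open>d\<close>, as the supremum in the definition demands.\<close>

lemma hausdorff2_parallelogram:
  fixes a u v :: R3
  assumes "A \<subseteq> {a + x *\<^sub>R u + y *\<^sub>R v |x y. 0 \<le> x \<and> x \<le> 1 \<and> 0 \<le> y \<and> y \<le> 1}"
  shows "hausdorff2 A < \<infinity>"
proof -
  define L where "L = norm u + norm v"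
  have "hausdorff2_pre d A \<le> ennreal (pi / 4 * L\<^sup>2)" if "d > 0" for d
  proof -
    \<comment> \<open>Makes the pieces smaller than \<open>d\<close>; the maximum with 0 forces
      \<open>n > 0\<close>.\<close>
    obtain n :: nat where n: "real n > L / d" "n > 0"
      using reals_Archimedean2[of "max (L / d) 0"] by (metis max_less_iff_conj of_nat_0_less_iff)
    \<comment> \<open>A single index for the two-dimensional grid: quotient and remainder by
      \<open>n\<close> select the strip in the direction of \<open>u\<close> and of
      \<open>v\<close>.\<close>
    define V where "V i = {a + x *\<^sub>R u + y *\<^sub>R v |x y.
      real (i div n) / n \<le> x \<and> x \<le> real (i div n) / n + 1 / n \<and>
      real (i mod n) / n \<le> y \<and> y \<le> real (i mod n) / n + 1 / n}" for i
    have V: "norm (z - w) \<le> L / n" if zw: "z \<in> V i" "w \<in> V i" for z w i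
    proof -
      obtain x y where z: "z = a + x *\<^sub>R u + y *\<^sub>R v"
        "real (i div n) / n \<le> x" "x \<le> real (i div n) / n + 1 / n"
        "real (i mod n) / n \<le> y" "y \<le> real (i mod n) / n + 1 / n"
        using zw(1) unfolding V_def by blast
      obtain x' y' where w: "w = a + x' *\<^sub>R u + y' *\<^sub>R v"
        "real (i div n) / n \<le> x'" "x' \<le> real (i div n) / n + 1 / n"
        "real (i mod n) / n \<le> y'" "y' \<le> real (i mod n) / n + 1 / n"
        using zw(2) unfolding V_def by blast
      have xy: "\<bar>x - x'\<bar> \<le> 1 / n" "\<bar>y - y'\<bar> \<le> 1 / n"
        using z(2-) w(2-) by linarith+
      have "z - w = (x - x') *\<^sub>R u + (y - y') *\<^sub>R v"
        by (simp add: z(1) w(1) algebra_simps)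
      then have "norm (z - w) \<le> \<bar>x - x'\<bar> * norm u + \<bar>y - y'\<bar> * norm v"
        by (metis norm_scaleR norm_triangle_ineq)
      also have "\<dots> \<le> 1 / n * norm u + 1 / n * norm v"
        using xy by (intro add_mono mult_right_mono) auto
      finally show ?thesis
        by (simp add: L_def add_divide_distrib)
    qed
    have "hausdorff2_pre d A \<le> ennreal (real (n * n) * (pi / 4 * (L / n)\<^sup>2))"
    proof (rule hausdorff2_pre_le)
      show "A \<subseteq> (\<Union>i<n * n. V i)"
      proof
        fix z assume "z \<in> A"
        then obtain x y where z: "z = a + x *\<^sub>R u + y *\<^sub>R v" "0 \<le> x" "x \<le> 1" "0 \<le> y" "y \<le> 1"
          using assms by blast
        obtain p where p: "p < n" "real p / n \<le> x" "x \<le> real p / n + 1 / n"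
          using unit_interval_cell[OF z(2,3) n(2)] by blast
        obtain q where q: "q < n" "real q / n \<le> y" "y \<le> real q / n + 1 / n"
          using unit_interval_cell[OF z(4,5) n(2)] by blast
        have "z \<in> V (p * n + q)"
          using p q by (auto simp: V_def z(1))
        moreover have "p * n + q < n * n"
        proof -
          have "p * n + q < Suc p * n"
            using q(1) by simp
          also have "\<dots> \<le> n * n"
            using p(1) by (intro mult_right_mono) auto
          finally show ?thesis .
        qed
        ultimately show "z \<in> (\<Union>i<n * n. V i)"
          by blast
      qed
      show "bounded (V i)" for i
        using V by (auto simp: bounded_two_points dist_norm)
      show "diameter (V i) \<le> L / n" for i
        by (rule diameter_le[OF _ V]) (auto simp: L_def)
      show "0 \<le> L / n"
        by (simp add: L_def)
      show "L / n \<le> d"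
        using n \<open>d > 0\<close> by (simp add: field_simps)
    qed
    also have "real (n * n) * (pi / 4 * (L / n)\<^sup>2) = pi / 4 * L\<^sup>2"
      using n(2) by (simp add: power2_eq_square field_simps)
    finally show ?thesis .
  qed
  then have "hausdorff2 A \<le> ennreal (pi / 4 * L\<^sup>2)"
    unfolding hausdorff2_def by (intro SUP_least) auto
  then show ?thesis
    by (rule le_less_trans) simp
qed

text \<open>Here \<open>n\<close> pieces of diameter at most \<open>norm u / n\<close> contribute a
  multiple of \<open>1 / n\<close>, which tends to zero.\<close>

lemma hausdorff2_segment:
  fixes a u :: R3
  assumes "A \<subseteq> {a + x *\<^sub>R u |x. 0 \<le> x \<and> x \<le> 1}"
  shows "hausdorff2 A = 0"
proof -
  have "hausdorff2_pre d A \<le> 0" if "d > 0" for d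
  proof (rule LIMSEQ_le_const)
    show "(\<lambda>n. ennreal (pi / 4 * (norm u)\<^sup>2 * (1 / real n))) \<longlonglongrightarrow> 0"
      using tendsto_ennrealI[OF tendsto_mult_right[OF lim_1_over_n[where 'a = real]], of "pi / 4 * (norm u)\<^sup>2"]
      by (simp add: mult.commute)
    obtain N :: nat where N: "real N > norm u / d" "N > 0"
      using reals_Archimedean2[of "max (norm u / d) 0"] by (metis max_less_iff_conj of_nat_0_less_iff)
    have "hausdorff2_pre d A \<le> ennreal (pi / 4 * (norm u)\<^sup>2 * (1 / real n))" if "n \<ge> N" for n
    proof -
      have n: "n > 0" "real n > norm u / d"
        using that N by auto
      define V where "V p = {a + x *\<^sub>R u |x. real p / n \<le> x \<and> x \<le> real p / n + 1 / n}" for p :: nat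
      have V: "norm (z - w) \<le> norm u / n" if zw: "z \<in> V i" "w \<in> V i" for z w i
      proof -
        obtain x where z: "z = a + x *\<^sub>R u" "real i / n \<le> x" "x \<le> real i / n + 1 / n"
          using zw(1) unfolding V_def by blast
        obtain x' where w: "w = a + x' *\<^sub>R u" "real i / n \<le> x'" "x' \<le> real i / n + 1 / n"
          using zw(2) unfolding V_def by blast
        have x: "\<bar>x - x'\<bar> \<le> 1 / n"
          using z(2-) w(2-) by linarith
        have "z - w = (x - x') *\<^sub>R u"
          by (simp add: z(1) w(1) algebra_simps)
        then show ?thesis
          using mult_right_mono[OF x norm_ge_zero[of u]] by simp
      qed
      have "hausdorff2_pre d A \<le> ennreal (real n * (pi / 4 * (norm u / n)\<^sup>2))"
      proof (rule hausdorff2_pre_le)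
        show "A \<subseteq> (\<Union>i<n. V i)"
        proof
          fix z assume "z \<in> A"
          then obtain x where z: "z = a + x *\<^sub>R u" "0 \<le> x" "x \<le> 1"
            using assms by blast
          obtain p where "p < n" "real p / n \<le> x" "x \<le> real p / n + 1 / n"
            using unit_interval_cell[OF z(2,3) n(1)] by blast
          then show "z \<in> (\<Union>i<n. V i)"
            by (auto simp: V_def z(1))
        qed
        show "bounded (V i)" for i
          using V by (auto simp: bounded_two_points dist_norm)
        show "diameter (V i) \<le> norm u / n" for i
          by (rule diameter_le[OF _ V]) auto
        show "norm u / n \<le> d"
          using n \<open>d > 0\<close> by (simp add: field_simps)
      qed simp
      also have "real n * (pi / 4 * (norm u / n)\<^sup>2) = pi / 4 * (norm u)\<^sup>2 * (1 / real n)"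
        using n(1) by (simp add: power2_eq_square field_simps)
      finally show ?thesis .
    qed
    then show "\<exists>N. \<forall>n\<ge>N. hausdorff2_pre d A \<le> ennreal (pi / 4 * (norm u)\<^sup>2 * (1 / real n))"
      by blast
  qed
  then have "hausdorff2 A \<le> 0"
    unfolding hausdorff2_def by (intro SUP_least) auto
  then show ?thesis
    by simp
qed

section \<open>Bounded sets of affine dimension at most two\<close>

lemma orthonormal_span_coordinates:
  fixes B :: "'a::euclidean_space set"
  assumes B: "finite B" "pairwise orthogonal B" "\<And>b. b \<in> B \<Longrightarrow> norm b = 1" and w: "w \<in> span B"
  shows "w = (\<Sum>b\<in>B. (w \<bullet> b) *\<^sub>R b)"
proof -
  obtain c where c: "w = (\<Sum>b\<in>B. c b *\<^sub>R b)"
    using w B(1) by (auto simp: span_finite)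
  have "w \<bullet> b = c b" if "b \<in> B" for b
  proof -
    have "w \<bullet> b = (\<Sum>b'\<in>B. c b' * (b' \<bullet> b))"
      by (simp add: c inner_sum_left)
    also have "\<dots> = (\<Sum>b'\<in>B. if b' = b then c b else 0)"
      using B(2,3) that by (intro sum.cong)
        (auto simp: pairwise_def orthogonal_def norm_eq_1)
    finally show ?thesis
      using B(1) that by simp
  qed
  then show ?thesis
    using c by simp
qed

text \<open>Along orthonormal directions Cauchy-Schwarz bounds each coordinate. The number of
  directions is the affine dimension, so dimension 2 leads to a parallelogram and dimension at most
  1 to a segment.\<close>

lemma bounded_aff_dim_coordinates:
  fixes S :: "'a::euclidean_space set"
  assumes "bounded S" "S \<noteq> {}"
  obtains a R B where "finite B" "int (card B) = aff_dim S" "R > 0"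
    "\<And>z. z \<in> S \<Longrightarrow> \<exists>c. (\<forall>b\<in>B. \<bar>c b\<bar> \<le> R) \<and> z = a + (\<Sum>b\<in>B. c b *\<^sub>R b)"
proof -
  obtain a where a: "a \<in> S"
    using assms(2) by blast
  define W where "W = span ((+) (- a) ` S)"
  obtain B where B: "B \<subseteq> W" "pairwise orthogonal B" "\<And>x. x \<in> B \<Longrightarrow> norm x = 1"
    "independent B" "card B = dim W" "span B = W"
    using orthonormal_basis_subspace[of W] by (metis W_def subspace_span)
  have "finite B"
    using B(4) by (rule independent_imp_finite)
  have dim: "int (card B) = aff_dim S"
    using aff_dim_eq_dim[of a S] a B(5) by (simp add: W_def hull_inc)
  obtain R where R: "R > 0" "\<And>z. z \<in> S \<Longrightarrow> norm z \<le> R"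
    using assms(1) bounded_pos by metis
  show thesis
  proof (rule that[OF \<open>finite B\<close> dim])
    show "norm a + R > 0"
      using R(1) by (simp add: add_nonneg_pos)
    fix z assume z: "z \<in> S"
    then have "- a + z \<in> span B"
      unfolding B(6) W_def by (intro span_base) blast
    from orthonormal_span_coordinates[OF \<open>finite B\<close> B(2,3) this]
    have "z = a + (\<Sum>b\<in>B. ((- a + z) \<bullet> b) *\<^sub>R b)"
      by (simp add: algebra_simps)
    moreover have "\<bar>(- a + z) \<bullet> b\<bar> \<le> norm a + R" if "b \<in> B" for b
    proof -
      have "\<bar>(- a + z) \<bullet> b\<bar> \<le> norm (- a + z) * norm b"
        by (rule Cauchy_Schwarz_ineq2)
      also have "\<dots> \<le> norm a + R"
        using norm_triangle_ineq[of "- a" z] R(2)[OF z] B(3)[OF that] by simp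
      finally show ?thesis .
    qed
    ultimately show "\<exists>c. (\<forall>b\<in>B. \<bar>c b\<bar> \<le> norm a + R) \<and> z = a + (\<Sum>b\<in>B. c b *\<^sub>R b)"
      by (intro exI[of _ "\<lambda>b. (- a + z) \<bullet> b"]) blast
  qed
qed

lemma unit_rescale:
  fixes b :: "'a::real_vector"
  assumes "\<bar>c\<bar> \<le> R" "R > 0"
  obtains x where "0 \<le> x" "x \<le> 1" "c *\<^sub>R b = x *\<^sub>R ((2 * R) *\<^sub>R b) - R *\<^sub>R b"
proof
  show "0 \<le> (c + R) / (2 * R)" "(c + R) / (2 * R) \<le> 1"
    using assms by (auto simp: field_simps)
  have "(c + R) / (2 * R) * (2 * R) = c + R"
    using assms(2) by simp
  then show "c *\<^sub>R b = ((c + R) / (2 * R)) *\<^sub>R ((2 * R) *\<^sub>R b) - R *\<^sub>R b"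
    unfolding scaleR_scaleR by (simp add: scaleR_add_left)
qed

lemma hausdorff2_bounded_finite:
  assumes S: "bounded S" "aff_dim S = 2"
  shows "hausdorff2 S < \<infinity>"
proof -
  have "S \<noteq> {}"
    using S(2) by auto
  obtain a R and B :: "R3 set" where B: "finite B" "int (card B) = aff_dim S" "R > 0"
    "\<And>z. z \<in> S \<Longrightarrow> \<exists>c. (\<forall>b\<in>B. \<bar>c b\<bar> \<le> R) \<and> z = a + (\<Sum>b\<in>B. c b *\<^sub>R b)"
    by (rule bounded_aff_dim_coordinates[OF S(1) \<open>S \<noteq> {}\<close>]) (rule that)
  have "card B = 2"
    using B(2) S(2) by simp
  then obtain u v where uv: "B = {u, v}" "u \<noteq> v"
    by (auto simp: card_2_iff)
  show ?thesis
  proof (rule hausdorff2_parallelogram, rule subsetI)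
    fix z assume "z \<in> S"
    then obtain c where c: "\<bar>c u\<bar> \<le> R" "\<bar>c v\<bar> \<le> R" "z = a + (c u *\<^sub>R u + c v *\<^sub>R v)"
      using B(4) uv by fastforce
    obtain x where x: "0 \<le> x" "x \<le> 1" "c u *\<^sub>R u = x *\<^sub>R ((2 * R) *\<^sub>R u) - R *\<^sub>R u"
      using unit_rescale[OF c(1) B(3)] by blast
    obtain y where y: "0 \<le> y" "y \<le> 1" "c v *\<^sub>R v = y *\<^sub>R ((2 * R) *\<^sub>R v) - R *\<^sub>R v"
      using unit_rescale[OF c(2) B(3)] by blast
    have "z = (a - R *\<^sub>R u - R *\<^sub>R v) + x *\<^sub>R ((2 * R) *\<^sub>R u) + y *\<^sub>R ((2 * R) *\<^sub>R v)"
      unfolding c(3) x(3) y(3) by simp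
    then show "z \<in> {(a - R *\<^sub>R u - R *\<^sub>R v) + x *\<^sub>R ((2 * R) *\<^sub>R u) + y *\<^sub>R ((2 * R) *\<^sub>R v) |x y.
        0 \<le> x \<and> x \<le> 1 \<and> 0 \<le> y \<and> y \<le> 1}"
      using x y by blast
  qed
qed

lemma hausdorff2_null:
  assumes S: "bounded S" "aff_dim S \<le> 1"
  shows "hausdorff2 S = 0"
proof (cases "S = {}")
  case False
  obtain a R and B :: "R3 set" where B: "finite B" "int (card B) = aff_dim S" "R > 0"
    "\<And>z. z \<in> S \<Longrightarrow> \<exists>c. (\<forall>b\<in>B. \<bar>c b\<bar> \<le> R) \<and> z = a + (\<Sum>b\<in>B. c b *\<^sub>R b)"
    by (rule bounded_aff_dim_coordinates[OF S(1) \<open>S \<noteq> {}\<close>]) (rule that)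
  have "card B \<le> 1"
    using B(2) S(2) by simp
  then obtain u where u: "B = {} \<or> B = {u}"
    using B(1) by (cases "card B = 0") (auto simp: le_Suc_eq card_1_singleton_iff)
  show ?thesis
  proof (rule hausdorff2_segment, rule subsetI)
    fix z assume "z \<in> S"
    then obtain c where c: "\<forall>b\<in>B. \<bar>c b\<bar> \<le> R" "z = a + (\<Sum>b\<in>B. c b *\<^sub>R b)"
      using B(4) by blast
    \<comment> \<open>For a single point \<open>B\<close> is empty and \<open>u\<close> arbitrary;
      the coefficient 0 keeps the representation valid.\<close>
    define d where "d = (if B = {} then 0 else c u)"
    have d: "\<bar>d\<bar> \<le> R" "z = a + d *\<^sub>R u"
      using c u B(3) by (auto simp: d_def)
    obtain x where x: "0 \<le> x" "x \<le> 1" "d *\<^sub>R u = x *\<^sub>R ((2 * R) *\<^sub>R u) - R *\<^sub>R u"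
      using unit_rescale[OF d(1) B(3)] by blast
    have "z = (a - R *\<^sub>R u) + x *\<^sub>R ((2 * R) *\<^sub>R u)"
      unfolding d(2) x(3) by simp
    then show "z \<in> {(a - R *\<^sub>R u) + x *\<^sub>R ((2 * R) *\<^sub>R u) |x. 0 \<le> x \<and> x \<le> 1}"
      using x by blast
  qed
next
  case True
  then show ?thesis
    using hausdorff2_segment[of "{}" 0 0] by simp
qed

section \<open>The surface measure and faces of polytopes\<close>

lemma space_surface_measure: "space (surface_measure G) = G"
  by (simp add: surface_measure_def space_restrict_space space_measure_of_conv)

lemma sets_measure_of_borel: "sets (measure_of UNIV (sets borel) m) = sets (borel :: R3 measure)"
  using sets.sigma_sets_eq[of "borel :: R3 measure"] by (simp add: sets_measure_of_conv)

lemma sets_surface_measure: "sets (surface_measure G) = sets (restrict_space borel G)"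
  unfolding surface_measure_def by (intro sets_restrict_space_cong sets_measure_of_borel)

text \<open>If \<open>hausdorff2\<close> were not countably additive on Borel sets, \<open>measure_of\<close> would be the null
  measure; so upper bounds hold in any case.\<close>

lemma emeasure_surface_measure_le:
  assumes "G \<in> sets borel" "A \<subseteq> G"
  shows "emeasure (surface_measure G) A \<le> hausdorff2 A"
proof -
  have "emeasure (surface_measure G) A = emeasure (measure_of UNIV (sets borel) hausdorff2) A"
    unfolding surface_measure_def using assms
    by (intro emeasure_restrict_space) (auto simp: sets_measure_of_borel)
  also have "\<dots> \<le> hausdorff2 A"
    by (simp add: emeasure_measure_of_conv)
  finally show ?thesis .
qed

text \<open>Take a face of least dimension containing \<open>x\<close>. If \<open>x\<close> were on
  its relative frontier, a facet of it would be a smaller face containing \<open>x\<close>.\<close>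

lemma polytope_point_face:
  fixes T :: "'a::euclidean_space set"
  assumes T: "polytope T" and x: "x \<in> T"
  obtains g where "g face_of T" "x \<in> rel_interior g"
proof -
  let ?Q = "\<lambda>g. g face_of T \<and> x \<in> g"
  have "?Q T"
    using x T by (simp add: face_of_refl polytope_imp_convex)
  \<comment> \<open>The shift by one keeps the empty face, of dimension \<open>-1\<close>, apart
    from single points under \<open>nat\<close>.\<close>
  define g where "g = arg_min (\<lambda>g. nat (aff_dim g + 1)) ?Q"
  have g: "?Q g" "\<And>h. ?Q h \<Longrightarrow> nat (aff_dim g + 1) \<le> nat (aff_dim h + 1)"
    using arg_min_nat_lemma[of ?Q T "\<lambda>g. nat (aff_dim g + 1)", OF \<open>?Q T\<close>, folded g_def] by blast+
  have pg: "polytope g"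
    using face_of_polytope_polytope[OF T] g(1) by blast
  have "x \<in> rel_interior g"
  proof (rule ccontr)
    assume "x \<notin> rel_interior g"
    then have "x \<in> rel_frontier g"
      using g(1) closure_subset[of g] by (auto simp: rel_frontier_def)
    then obtain F where F: "F facet_of g" "x \<in> F"
      using rel_frontier_of_polyhedron[OF polytope_imp_polyhedron[OF pg]] by blast
    then have "?Q F"
      using facet_of_imp_face_of[OF F(1)] g(1) face_of_trans by blast
    then have "nat (aff_dim g + 1) \<le> nat (aff_dim F + 1)"
      by (rule g(2))
    moreover have "aff_dim F = aff_dim g - 1" "aff_dim F \<noteq> - 1" "- 1 \<le> aff_dim F"
      using F aff_dim_geq[of F] by (auto simp: facet_of_def aff_dim_empty)
    ultimately show False
      by linarith
  qed
  then show thesis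
    using that g(1) by blast
qed

section \<open>Traces on the boundary\<close>

text \<open>The limit exists on the \<open>G\<^sub>\<delta>\<close> set where the oscillation vanishes, is continuous there, and
  \<open>Lim\<close> is a fixed junk value elsewhere.\<close>

lemma borel_measurable_Lim_within:
  fixes f :: "'a::euclidean_space \<Rightarrow> 'b::euclidean_space"
  assumes G: "G \<in> sets borel" and lp: "\<And>x. x \<in> G \<Longrightarrow> at x within D \<noteq> bot"
    and disj: "G \<inter> D = {}"
  shows "(\<lambda>x. Lim (at x within D) f) \<in> borel_measurable (restrict_space borel G)"
proof -
  define osc where "osc e x \<longleftrightarrow> (\<exists>d>0. \<forall>y\<in>D \<inter> ball x d. \<forall>z\<in>D \<inter> ball x d. dist (f y) (f z) < e)" for e x
  have open_osc: "open {x. osc e x}" for e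
    unfolding open_contains_ball
  proof safe
    fix x assume "osc e x"
    then obtain d where d: "d > 0" "\<forall>y\<in>D \<inter> ball x d. \<forall>z\<in>D \<inter> ball x d. dist (f y) (f z) < e"
      by (auto simp: osc_def)
    have "osc e x'" if "x' \<in> ball x (d / 2)" for x'
    proof -
      have "ball x' (d / 2) \<subseteq> ball x d"
      proof
        fix y assume "y \<in> ball x' (d / 2)"
        then show "y \<in> ball x d"
          using that dist_triangle[of x y x'] by simp
      qed
      then show ?thesis
        unfolding osc_def using d by (intro exI[of _ "d / 2"]) auto
    qed
    then show "\<exists>d>0. ball x d \<subseteq> {x. osc e x}"
      using d(1) by (intro exI[of _ "d / 2"]) auto
  qed
  define W where "W = (\<Inter>n. {x. osc (inverse (Suc n)) x})"
  have W: "W \<in> sets borel"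
    unfolding W_def by (intro sets.countable_INT) (auto intro: borel_open open_osc)
  have lim_iff: "x \<in> W \<longleftrightarrow> (\<exists>l. (f \<longlongrightarrow> l) (at x within D))" if x: "x \<in> G" for x
  proof
    assume xW: "x \<in> W"
    have "cauchy_filter (filtermap f (at x within D))"
      unfolding cauchy_filter_metric_filtermap
    proof (intro allI impI)
      fix e :: real assume "e > 0"
      then obtain n where n: "inverse (real (Suc n)) < e"
        using reals_Archimedean by blast
      have "osc (inverse (Suc n)) x"
        using xW by (auto simp: W_def)
      then obtain d where d: "d > 0" "\<forall>y\<in>D \<inter> ball x d. \<forall>z\<in>D \<inter> ball x d. dist (f y) (f z) < inverse (Suc n)"
        by (auto simp: osc_def)
      have "eventually (\<lambda>y. y \<in> D \<inter> ball x d) (at x within D)"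
        unfolding eventually_at by (intro exI[of _ d]) (use d(1) in \<open>auto simp: dist_commute\<close>)
      then show "\<exists>Q. eventually Q (at x within D) \<and> (\<forall>y z. Q y \<and> Q z \<longrightarrow> dist (f y) (f z) < e)"
        using d(2) n by (intro exI[of _ "\<lambda>y. y \<in> D \<inter> ball x d"] conjI) (assumption, meson less_trans)
    qed
    moreover have "filtermap f (at x within D) \<noteq> bot"
      using lp[OF x] by (simp add: filtermap_bot_iff)
    ultimately obtain l where "filtermap f (at x within D) \<le> nhds l"
      using complete_UNIV[where 'a = 'b] unfolding complete_uniform by auto
    then show "\<exists>l. (f \<longlongrightarrow> l) (at x within D)"
      by (auto simp: filterlim_def)
  next
    assume "\<exists>l. (f \<longlongrightarrow> l) (at x within D)"
    then obtain l where l: "(f \<longlongrightarrow> l) (at x within D)"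
      by blast
    have "osc (inverse (Suc n)) x" for n
    proof -
      have "eventually (\<lambda>y. dist (f y) l < inverse (Suc n) / 2) (at x within D)"
        using l by (rule tendstoD) simp
      then obtain d where d: "d > 0" "\<And>y. y \<in> D \<Longrightarrow> y \<noteq> x \<Longrightarrow> dist y x < d \<Longrightarrow> dist (f y) l < inverse (Suc n) / 2"
        unfolding eventually_at by blast
      \<comment> \<open>A limit ignores the value at \<open>x\<close>; disjointness of
        \<open>G\<close> and \<open>D\<close> ensures that \<open>y\<close> differs from
        \<open>x\<close>.\<close>
      have "dist (f y) l < inverse (Suc n) / 2" if "y \<in> D \<inter> ball x d" for y
        using that x disj by (intro d(2)) (auto simp: dist_commute)
      then have "dist (f y) (f z) < inverse (Suc n)" if "y \<in> D \<inter> ball x d" "z \<in> D \<inter> ball x d" for y z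
        using that dist_triangle_half_l[of "f y" l "inverse (Suc n)" "f z"] by (metis dist_commute)
      then show ?thesis
        unfolding osc_def using d(1) by blast
    qed
    then show "x \<in> W"
      by (simp add: W_def)
  qed
  have cont: "continuous_on (G \<inter> W) (\<lambda>x. Lim (at x within D) f)"
    unfolding continuous_on_iff
  proof (intro ballI allI impI)
    have L: "(f \<longlongrightarrow> Lim (at x within D) f) (at x within D)" if "x \<in> G \<inter> W" for x
      using that lim_iff lp tendsto_Lim by fastforce
    fix x and e :: real assume x: "x \<in> G \<inter> W" and "e > 0"
    have "eventually (\<lambda>y. dist (f y) (Lim (at x within D) f) < e / 2) (at x within D)"
      using L[OF x] by (rule tendstoD) (use \<open>e > 0\<close> in simp)
    then obtain d where d: "d > 0" "\<And>y. y \<in> D \<Longrightarrow> y \<noteq> x \<Longrightarrow> dist y x < d \<Longrightarrow> dist (f y) (Lim (at x within D) f) < e / 2"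
      unfolding eventually_at by blast
    have "dist (Lim (at x' within D) f) (Lim (at x within D) f) < e" if x': "x' \<in> G \<inter> W" "dist x' x < d" for x'
    proof -
      have "eventually (\<lambda>y. dist (f y) (Lim (at x within D) f) \<le> e / 2) (at x' within D)"
        unfolding eventually_at
      proof (intro exI[of _ "d - dist x' x"] conjI ballI impI)
        fix y assume y: "y \<in> D" "y \<noteq> x' \<and> dist y x' < d - dist x' x"
        then have "dist y x < d"
          using dist_triangle[of y x x'] by linarith
        then show "dist (f y) (Lim (at x within D) f) \<le> e / 2"
          using d(2)[of y] y x disj by force
      qed (use x' in auto)
      moreover have "((\<lambda>y. dist (f y) (Lim (at x within D) f)) \<longlongrightarrow>
          dist (Lim (at x' within D) f) (Lim (at x within D) f)) (at x' within D)"
        by (intro tendsto_dist L[OF x'(1)] tendsto_const)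
      ultimately have "dist (Lim (at x' within D) f) (Lim (at x within D) f) \<le> e / 2"
        using lp x'(1) by (intro tendsto_upperbound) auto
      then show ?thesis
        using \<open>e > 0\<close> by linarith
    qed
    then show "\<exists>d>0. \<forall>x'\<in>G \<inter> W. dist x' x < d \<longrightarrow> dist (Lim (at x' within D) f) (Lim (at x within D) f) < e"
      using d(1) by blast
  qed
  show ?thesis
  proof (rule measurable_piecewise_restrict)
    show "countable {W, - W}" "space (restrict_space borel G) \<subseteq> \<Union>{W, - W}"
      by auto
    fix X assume X: "X \<in> {W, - W}"
    then have XB: "X \<in> sets borel"
      using W by auto
    then show "X \<inter> space (restrict_space borel G) \<in> sets (restrict_space borel G)"
      using G by (simp add: space_restrict_space sets_restrict_space_iff)
    have sp: "restrict_space (restrict_space borel G) X = restrict_space borel (G \<inter> X)"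
      by (rule restrict_restrict_space) (simp_all add: G XB)
    show "(\<lambda>x. Lim (at x within D) f) \<in> borel_measurable (restrict_space (restrict_space borel G) X)"
    proof (cases "X = W")
      case True
      then show ?thesis
        unfolding sp using cont by (simp add: borel_measurable_continuous_on_restrict)
    next
      case False
      have junk: "Lim (at x within D) f = (THE l. False)" if "x \<in> G \<inter> X" for x
      proof -
        have "(f \<longlongrightarrow> l) (at x within D) \<longleftrightarrow> False" for l
          using lim_iff[of x] that False X by auto
        then show ?thesis
          by (simp add: t2_space_class.Lim_def)
      qed
      have "(\<lambda>x. Lim (at x within D) f) \<in> borel_measurable (restrict_space borel (G \<inter> X)) \<longleftrightarrow>
          (\<lambda>x. THE l :: 'b. False) \<in> borel_measurable (restrict_space borel (G \<inter> X))"
        by (rule measurable_cong) (use junk in \<open>auto simp: space_restrict_space\<close>)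
      then show ?thesis
        unfolding sp by simp
    qed
  qed
qed

text \<open>A short step from \<open>x\<close> towards \<open>p1\<close> stays in \<open>T1\<close>.
  The point reached also lies in \<open>T2\<close>, as a convex combination of \<open>p2\<close> and
  a point \<open>q\<close> of the disc around \<open>x\<close> in the hyperplane, and it is above
  the hyperplane because \<open>p1\<close> is.\<close>

lemma common_halfspace_cells_meet:
  fixes T1 T2 :: "'a::euclidean_space set"
  assumes conv: "convex T1" "convex T2" and x: "x \<in> T1" and e: "e > 0"
    and ball: "ball x e \<inter> {y. a \<bullet> y = a \<bullet> x} \<subseteq> T2"
    and p: "p1 \<in> T1" "a \<bullet> x < a \<bullet> p1" "p2 \<in> T2" "a \<bullet> x < a \<bullet> p2"
  shows "\<exists>z \<in> T1 \<inter> T2. a \<bullet> x < a \<bullet> z"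
proof -
  \<comment> \<open>The ratio of the heights of \<open>p1\<close> and \<open>p2\<close> over the
    hyperplane; it makes \<open>w\<close> parallel to the hyperplane.\<close>
  define \<tau> where "\<tau> = (a \<bullet> p1 - a \<bullet> x) / (a \<bullet> p2 - a \<bullet> x)"
  have \<tau>: "\<tau> > 0" "\<tau> * (a \<bullet> p2 - a \<bullet> x) = a \<bullet> p1 - a \<bullet> x"
    using p by (auto simp: \<tau>_def)
  define w where "w = (p1 - x) - \<tau> *\<^sub>R (p2 - x)"
  have aw: "a \<bullet> w = 0"
    using \<tau>(2) by (simp add: w_def inner_diff_right algebra_simps)
  \<comment> \<open>Small enough that \<open>1 - \<delta> * \<tau> \<ge> 1/2\<close> and that
    \<open>q\<close> stays within distance \<open>e\<close> of \<open>x\<close>.\<close>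
  define \<delta> where "\<delta> = min (min 1 (1 / (2 * \<tau>))) (e / (4 * (norm w + 1)))"
  have \<delta>: "\<delta> > 0" "\<delta> \<le> 1" "\<delta> * \<tau> \<le> 1 / 2" "\<delta> * (norm w + 1) \<le> e / 4"
  proof -
    show "\<delta> > 0" "\<delta> \<le> 1"
      using \<tau>(1) e by (auto simp: \<delta>_def add_nonneg_pos)
    have *: "\<delta> \<le> 1 / (2 * \<tau>)" "\<delta> \<le> e / (4 * (norm w + 1))"
      by (auto simp: \<delta>_def)
    have "0 < 2 * \<tau>" "0 < 4 * (norm w + 1)"
      using \<tau>(1) by (auto intro: add_nonneg_pos)
    then show "\<delta> * \<tau> \<le> 1 / 2" "\<delta> * (norm w + 1) \<le> e / 4"
      using *[unfolded pos_le_divide_eq[OF \<open>0 < 2 * \<tau>\<close>] pos_le_divide_eq[OF \<open>0 < 4 * (norm w + 1)\<close>]]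
      by (simp_all add: algebra_simps)
  qed
  define q where "q = x + (\<delta> / (1 - \<delta> * \<tau>)) *\<^sub>R w"
  have "\<delta> / (1 - \<delta> * \<tau>) \<le> 2 * \<delta>"
    using \<delta> by (simp add: field_simps)
  moreover have nonneg: "0 \<le> \<delta> / (1 - \<delta> * \<tau>)"
    using \<delta> by simp
  ultimately have "norm ((\<delta> / (1 - \<delta> * \<tau>)) *\<^sub>R w) \<le> 2 * \<delta> * norm w"
    unfolding norm_scaleR abs_of_nonneg[OF nonneg] by (intro mult_right_mono) simp_all
  also have "\<dots> < e"
    using \<delta>(1,4) e by (simp add: algebra_simps)
  finally have "q \<in> T2"
    using ball aw by (intro subsetD[OF ball]) (auto simp: q_def dist_norm inner_add_right)
  have z: "x + \<delta> *\<^sub>R (p1 - x) = (1 - \<delta> * \<tau>) *\<^sub>R q + (\<delta> * \<tau>) *\<^sub>R p2"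
  proof -
    have "(1 - \<delta> * \<tau>) *\<^sub>R q = (1 - \<delta> * \<tau>) *\<^sub>R x + \<delta> *\<^sub>R w"
      using \<delta>(3) by (simp add: q_def scaleR_add_right)
    then show ?thesis
      by (simp add: w_def algebra_simps)
  qed
  have "x + \<delta> *\<^sub>R (p1 - x) \<in> T2"
    unfolding z using \<delta> \<tau>(1) by (intro convexD[OF conv(2) \<open>q \<in> T2\<close> p(3)]) auto
  moreover have "x + \<delta> *\<^sub>R (p1 - x) \<in> T1"
    using convexD[OF conv(1) x p(1), of "1 - \<delta>" \<delta>] \<delta> by (simp add: algebra_simps)
  moreover have "a \<bullet> x < a \<bullet> (x + \<delta> *\<^sub>R (p1 - x))"
    using \<delta>(1) p(2) by (simp add: inner_add_right inner_diff_right)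
  ultimately show ?thesis
    by blast
qed

section \<open>Cells and faces of the mesh at the boundary\<close>

context eddy_setting
begin

definition mesh_faces :: "R3 set set" where
  "mesh_faces = {g. \<exists>T\<in>mesh P. g face_of T}"

definition mesh_edges :: "R3 set" where
  "mesh_edges = \<Union>{g \<in> mesh_faces. aff_dim g \<le> 1}"

lemma finite_mesh_faces: "finite mesh_faces"
proof -
  have "mesh_faces = (\<Union>T\<in>mesh P. {g. g face_of T})"
    by (auto simp: mesh_faces_def)
  then show ?thesis
    by (auto intro!: finite_mesh finite_polytope_faces mesh_cell(5))
qed

lemma mesh_face:
  assumes "g \<in> mesh_faces"
  shows "compact g" "convex g" "g \<subseteq> closure (Om P)"
proof -
  obtain T where T: "T \<in> mesh P" "g face_of T"
    using assms by (auto simp: mesh_faces_def)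
  show "compact g" "convex g"
    using face_of_imp_compact[OF mesh_cell(2,1)[OF T(1)] T(2)] face_of_imp_convex[OF T(2)] by auto
  show "g \<subseteq> closure (Om P)"
    using face_of_imp_subset[OF T(2)] T(1) mesh by (auto simp: valid_mesh_def)
qed

lemma Om_facts: "open (Om P)" "convex (Om P)" "bounded (Om P)"
  using domain by (auto simp: valid_domain_def)

lemma Gam_facts: "closed (Gam P)" "Gam P \<subseteq> frontier (Om P)" "Gam P \<inter> Om P = {}" "Gam P \<subseteq> closure (Om P)"
proof -
  obtain F where F: "finite F" "\<forall>f\<in>F. polytope f \<and> aff_dim f = 2" "Gam P = \<Union>F"
    using domain by (auto simp: valid_domain_def)
  show "closed (Gam P)"
    unfolding F(3) using F by (intro closed_Union) (auto intro: polytope_imp_closed)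
  show "Gam P \<subseteq> frontier (Om P)"
    using domain by (auto simp: valid_domain_def)
  then show "Gam P \<inter> Om P = {}" "Gam P \<subseteq> closure (Om P)"
    using Om_facts(1) by (auto simp: frontier_def interior_open)
qed

lemma Gam_limit_point:
  assumes "x \<in> Gam P"
  shows "at x within Om P \<noteq> bot"
proof -
  have "x islimpt Om P"
    using assms Gam_facts by (auto simp: closure_def)
  then show ?thesis
    by (simp add: trivial_limit_within)
qed

lemma finite_muG: "finite_measure (muG P)"
proof
  obtain F where F: "finite F" "\<forall>f\<in>F. polytope f \<and> aff_dim f = 2" "Gam P = \<Union>F"
    using domain by (auto simp: valid_domain_def)
  have G: "Gam P \<in> sets borel"
    using Gam_facts(1) by simp
  have f: "emeasure (muG P) f < \<infinity>" "f \<in> sets (muG P)" if "f \<in> F" for f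
  proof -
    have "emeasure (muG P) f \<le> hausdorff2 f"
      using F(3) that by (intro emeasure_surface_measure_le[OF G]) auto
    also have "\<dots> < \<infinity>"
      using F(2) that by (intro hausdorff2_bounded_finite) (auto intro: polytope_imp_bounded)
    finally show "emeasure (muG P) f < \<infinity>" .
    have "f \<in> sets borel" "f \<subseteq> Gam P"
      using F that by (auto intro: borel_closed polytope_imp_closed)
    then show "f \<in> sets (muG P)"
      unfolding sets_surface_measure using G by (simp add: sets_restrict_space_iff)
  qed
  have "emeasure (muG P) (\<Union>f\<in>F. f) \<le> (\<Sum>f\<in>F. emeasure (muG P) f)"
    using F(1) f by (intro emeasure_subadditive_finite) auto
  also have "\<dots> < \<infinity>"
    using f(1) F(1) by simp
  finally show "emeasure (muG P) (space (muG P)) \<noteq> \<infinity>"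
    by (simp add: space_surface_measure F(3))
qed

lemma AE_not_edge: "AE x in muG P. x \<notin> mesh_edges"
proof -
  have G: "Gam P \<in> sets borel"
    using Gam_facts(1) by simp
  have g: "AE x in muG P. x \<notin> g" if "g \<in> mesh_faces" "aff_dim g \<le> 1" for g
  proof (rule AE_I)
    show "{x \<in> space (muG P). \<not> x \<notin> g} \<subseteq> g \<inter> Gam P"
      by (auto simp: space_surface_measure)
    have "emeasure (muG P) (g \<inter> Gam P) \<le> hausdorff2 (g \<inter> Gam P)"
      by (intro emeasure_surface_measure_le[OF G]) auto
    also have "\<dots> = 0"
    proof (rule hausdorff2_null)
      show "bounded (g \<inter> Gam P)"
        using mesh_face(1)[OF that(1)] compact_imp_bounded by (blast intro: bounded_Int)
      show "aff_dim (g \<inter> Gam P) \<le> 1"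
        using aff_dim_subset[of "g \<inter> Gam P" g] that(2) by simp
    qed
    finally show "emeasure (muG P) (g \<inter> Gam P) = 0"
      by simp
    show "g \<inter> Gam P \<in> sets (muG P)"
      unfolding sets_surface_measure using G mesh_face(1)[OF that(1)]
      by (auto simp: sets_restrict_space_iff intro: borel_closed compact_imp_closed)
  qed
  have "AE x in muG P. \<forall>g\<in>{g \<in> mesh_faces. aff_dim g \<le> 1}. x \<notin> g"
    using g finite_mesh_faces by (subst AE_finite_all) auto
  then show ?thesis
    by eventually_elim (auto simp: mesh_edges_def)
qed

text \<open>Off the edges, two cells could share \<open>x\<close> only in the relative interior of a
  common two-dimensional face. That face lies in a supporting hyperplane of the convex domain at
  \<open>x\<close>, with both cells on the same side; by \<open>common_halfspace_cells_meet\<close>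
  the cells then also meet off the hyperplane, outside their common face.\<close>

lemma boundary_point_in_two_cells:
  assumes x: "x \<in> frontier (Om P)" and T: "T1 \<in> mesh P" "T2 \<in> mesh P" "T1 \<noteq> T2" "x \<in> T1" "x \<in> T2"
  shows "x \<in> mesh_edges"
proof (rule ccontr)
  assume ne: "x \<notin> mesh_edges"
  define f where "f = T1 \<inter> T2"
  have "T1 \<inter> T2 face_of T1" "T2 \<inter> T1 face_of T2"
    using mesh T(1,2) unfolding valid_mesh_def triangulation_def by blast+
  then have f1: "f face_of T1" and f2: "f face_of T2"
    by (simp_all add: f_def Int_commute)
  have pf: "polytope f"
    using face_of_polytope_polytope[OF mesh_cell(5)[OF T(1)] f1] .
  obtain g where g: "g face_of f" "x \<in> rel_interior g"
    using polytope_point_face[OF pf, of x] T by (auto simp: f_def)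
  have gf: "g \<in> mesh_faces"
    using face_of_trans[OF g(1) f1] T(1) by (auto simp: mesh_faces_def)
  have xg: "x \<in> g"
    using g(2) rel_interior_subset by blast
  have dg: "aff_dim g \<ge> 2"
    using ne gf xg by (force simp: mesh_edges_def)
  \<comment> \<open>Otherwise \<open>T1\<close> would be a proper face of \<open>T2\<close> of the
    same dimension.\<close>
  have "f \<noteq> T1"
  proof
    assume eq: "f = T1"
    show False
      using face_of_aff_dim_lt[OF mesh_cell(2)[OF T(2)] f2[unfolded eq] T(3)]
        mesh_cell(4)[OF T(1)] mesh_cell(4)[OF T(2)] by simp
  qed
  then have df: "aff_dim f \<le> 2"
    using face_of_aff_dim_lt[OF mesh_cell(2)[OF T(1)] f1] mesh_cell(4)[OF T(1)] by simp
  then have "g = f"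
    using face_of_aff_dim_lt[OF polytope_imp_convex[OF pf] g(1)] dg by force
  then have xf: "x \<in> rel_interior f" and df2: "aff_dim f = 2"
    using g(2) dg df by auto
  have "x \<in> closure (Om P)" "x \<notin> rel_interior (Om P)"
    using x Om_facts by (auto simp: frontier_def rel_interior_open interior_open)
  then obtain a where a: "a \<noteq> 0" "\<And>y. y \<in> closure (Om P) \<Longrightarrow> a \<bullet> x \<le> a \<bullet> y"
    using supporting_hyperplane_relative_frontier[OF Om_facts(2)] by metis
  let ?H = "{y. a \<bullet> y = a \<bullet> x}"
  have cl: "T \<subseteq> closure (Om P)" if "T \<in> mesh P" for T
    using that mesh by (auto simp: valid_mesh_def)
  obtain e where e: "e > 0" "ball x e \<inter> affine hull f \<subseteq> f"
    using xf by (auto simp: mem_rel_interior_ball)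
  \<comment> \<open>Over the closed domain \<open>a\<close> is minimal at \<open>x\<close>. As
    \<open>f\<close> also contains a point slightly beyond \<open>x\<close> on the line from
    \<open>y\<close>, \<open>a\<close> cannot increase from \<open>x\<close> to
    \<open>y\<close>.\<close>
  have fH: "f \<subseteq> ?H"
  proof
    fix y assume y: "y \<in> f"
    have "\<exists>d>0. x + d *\<^sub>R (x - y) \<in> f"
    proof -
      define d where "d = e / (2 * (norm (x - y) + 1))"
      have "0 < 2 * (norm (x - y) + 1)"
        by (auto intro: add_nonneg_pos)
      then have d: "d > 0" and "d * (2 * (norm (x - y) + 1)) = e"
        using e(1) by (simp_all add: d_def)
      then have "2 * (d * norm (x - y)) + 2 * d = e"
        by (simp add: algebra_simps)
      moreover have "0 \<le> d * norm (x - y)"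
        using d by simp
      ultimately have d: "d > 0" "d * norm (x - y) < e"
        using d by linarith+
      have "x + d *\<^sub>R (x - y) = (1 + d) *\<^sub>R x + (- d) *\<^sub>R y"
        by (simp add: algebra_simps)
      also have "\<dots> \<in> affine hull f"
        using xf y rel_interior_subset by (intro mem_affine[OF affine_affine_hull]) (auto intro: hull_inc)
      finally show ?thesis
        using d e(2) by (intro exI[of _ d]) (auto simp: dist_norm)
    qed
    then obtain d where d: "d > 0" "x + d *\<^sub>R (x - y) \<in> f"
      by blast
    then have "a \<bullet> x \<le> a \<bullet> (x + d *\<^sub>R (x - y))"
      using cl[OF T(1)] by (intro a(2)) (auto simp: f_def)
    then have "d * (a \<bullet> y) \<le> d * (a \<bullet> x)"
      by (simp add: inner_add_right inner_diff_right algebra_simps)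
    then have "a \<bullet> y \<le> a \<bullet> x"
      using d(1) by simp
    moreover have "a \<bullet> x \<le> a \<bullet> y"
      using y cl[OF T(1)] by (intro a(2)) (auto simp: f_def)
    ultimately show "y \<in> ?H"
      by simp
  qed
  \<comment> \<open>Equal dimensions turn the inclusion into equality, so the neighbourhood of
    \<open>x\<close> relative to \<open>f\<close> is a disc in \<open>?H\<close>.\<close>
  have "affine hull f = ?H"
  proof (rule affine_dim_equal)
    show "affine hull f \<subseteq> ?H"
      by (rule hull_minimal) (use fH affine_hyperplane in auto)
    show "affine hull f \<noteq> {}"
      using xg \<open>g = f\<close> by auto
    show "aff_dim (affine hull f) = aff_dim ?H"
      using a(1) df2 by (simp add: aff_dim_hyperplane)
  qed (auto simp: affine_hyperplane)
  then have ball: "ball x e \<inter> ?H \<subseteq> T2"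
    using e(2) by (auto simp: f_def)
  have above: "\<exists>p\<in>T. a \<bullet> x < a \<bullet> p" if "T \<in> mesh P" for T
  proof (rule ccontr)
    assume "\<not> ?thesis"
    then have "T \<subseteq> ?H"
      using a(2) cl[OF that] by (force simp: not_less)
    then have "aff_dim T \<le> aff_dim ?H"
      by (rule aff_dim_subset)
    then show False
      using a(1) mesh_cell(4)[OF that] by (simp add: aff_dim_hyperplane)
  qed
  obtain p1 p2 where "p1 \<in> T1" "a \<bullet> x < a \<bullet> p1" "p2 \<in> T2" "a \<bullet> x < a \<bullet> p2"
    using above[OF T(1)] above[OF T(2)] by blast
  then obtain z where "z \<in> T1 \<inter> T2" "a \<bullet> x < a \<bullet> z"
    using common_halfspace_cells_meet[OF mesh_cell(2)[OF T(1)] mesh_cell(2)[OF T(2)] T(4) e(1) ball] by blast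
  then show False
    using fH by (auto simp: f_def)
qed

text \<open>The other cells form a closed set that misses \<open>x\<close>, so a small ball meets
  the domain in one cell only. Fields in \<open>Rh\<close> are affine there, which makes their
  traces genuine limits.\<close>

lemma boundary_cell:
  assumes x: "x \<in> Gam P" "x \<notin> mesh_edges"
  obtains T d where "T \<in> mesh P" "d > 0" "Om P \<inter> ball x d \<subseteq> interior T"
proof -
  have cover: "closure (Om P) = \<Union>(mesh P)"
    using mesh by (simp add: valid_mesh_def)
  obtain T where T: "T \<in> mesh P" "x \<in> T"
    using x(1) Gam_facts(4) cover by blast
  have "x \<notin> \<Union>(mesh P - {T})"
    using boundary_point_in_two_cells[OF _ T(1) _ _ T(2)] x Gam_facts(2) by blast
  moreover have "closed (\<Union>(mesh P - {T}))"
    using finite_mesh mesh_cell(1) by (intro closed_Union) (auto intro: compact_imp_closed)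
  ultimately obtain d where d: "d > 0" "ball x d \<subseteq> - \<Union>(mesh P - {T})"
    using openE[OF open_Compl] by (metis ComplI)
  have "Om P \<inter> ball x d \<subseteq> T"
    using d(2) cover closure_subset[of "Om P"] by blast
  then have "Om P \<inter> ball x d \<subseteq> interior T"
    using Om_facts(1) by (intro interior_maximal) auto
  then show thesis
    using that T(1) d(1) by blast
qed

lemma bdry_trace_tendsto:
  assumes E: "E \<in> Rh P" and x: "x \<in> Gam P" "x \<notin> mesh_edges"
  shows "(E \<longlongrightarrow> bdry_trace (Om P) E x) (at x within Om P)"
proof -
  obtain T d where T: "T \<in> mesh P" "d > 0" "Om P \<inter> ball x d \<subseteq> interior T"
    using boundary_cell[OF x] by blast
  obtain c L where L: "linear L" "\<forall>y\<in>interior T. E y = c + L y"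
    using Rh_pw_affine[OF E] T(1) unfolding pw_affine_def by blast
  have "((\<lambda>y. c + L y) \<longlongrightarrow> c + L x) (at x within Om P)"
    using L(1) by (intro tendsto_intros bounded_linear.tendsto[of L]) (simp add: linear_conv_bounded_linear)
  moreover have "eventually (\<lambda>y. c + L y = E y) (at x within Om P)"
    unfolding eventually_at using T(2,3) L(2) by (intro exI[of _ d]) (auto simp: dist_commute)
  ultimately have "(E \<longlongrightarrow> c + L x) (at x within Om P)"
    by (rule Lim_transform_eventually)
  from tendsto_Lim[OF Gam_limit_point[OF x(1)] this] this show ?thesis
    by (simp add: bdry_trace_def)
qed

lemma Rh_bounded:
  assumes E: "E \<in> Rh P"
  shows "\<exists>B. \<forall>x. norm (E x) \<le> B"
proof -
  have "\<exists>B. \<forall>x\<in>interior T. norm (E x) \<le> B" if T: "T \<in> mesh P" for T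
  proof -
    obtain c L where L: "linear L" "\<forall>y\<in>interior T. E y = c + L y"
      using Rh_pw_affine[OF E] T unfolding pw_affine_def by blast
    have "continuous_on T (\<lambda>y. c + L y)"
      using L(1) by (intro continuous_intros linear_continuous_on) (simp add: linear_conv_bounded_linear)
    then have "bounded ((\<lambda>y. c + L y) ` T)"
      using mesh_cell(1)[OF T] by (intro compact_imp_bounded compact_continuous_image)
    then obtain B where "\<forall>y\<in>T. norm (c + L y) \<le> B"
      by (auto simp: bounded_iff)
    then show ?thesis
      using L(2) interior_subset[of T] by (intro exI[of _ B]) auto
  qed
  then obtain B where B: "\<And>T x. T \<in> mesh P \<Longrightarrow> x \<in> interior T \<Longrightarrow> norm (E x) \<le> B T"
    by metis
  have "norm (E x) \<le> (\<Sum>T\<in>mesh P. \<bar>B T\<bar>)" for x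
  proof (cases "x \<in> (\<Union>T\<in>mesh P. interior T)")
    case True
    then obtain T where T: "T \<in> mesh P" "x \<in> interior T"
      by blast
    have "\<bar>B T\<bar> \<le> (\<Sum>T\<in>mesh P. \<bar>B T\<bar>)"
      using T(1) finite_mesh by (intro member_le_sum) auto
    then show ?thesis
      using B[OF T] by linarith
  next
    case False
    then have "E x = 0"
      using E by (auto simp: Rh_def)
    then show ?thesis
      by (simp add: sum_nonneg)
  qed
  then show ?thesis
    by blast
qed

section \<open>Traces, outer normal and the adjoint right-hand side\<close>

lemma bdry_trace_Linf:
  assumes E: "E \<in> Rh P"
  shows "Linf (muG P) (bdry_trace (Om P) E)"
proof -
  obtain B where B: "\<forall>x. norm (E x) \<le> B"
    using Rh_bounded[OF E] by blast
  have "(\<lambda>x. Lim (at x within Om P) E) \<in> borel_measurable (restrict_space borel (Gam P))"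
    using Gam_facts by (intro borel_measurable_Lim_within Gam_limit_point) auto
  then have "bdry_trace (Om P) E \<in> borel_measurable (muG P)"
    unfolding bdry_trace_def[abs_def] measurable_cong_sets[OF sets_surface_measure refl] .
  moreover have "AE x in muG P. norm (bdry_trace (Om P) E x) \<le> B"
    using AE_not_edge AE_space
  proof eventually_elim
    case (elim x)
    then have x: "x \<in> Gam P"
      by (simp add: space_surface_measure)
    show ?case
      using tendsto_norm[OF bdry_trace_tendsto[OF E x elim(1)]] B Gam_limit_point[OF x]
      by (intro tendsto_upperbound) auto
  qed
  ultimately show ?thesis
    by (auto simp: Linf_def)
qed

text \<open>All relatively interior points of a mesh face have the same supporting functionals. The
  definite description therefore sees the same predicate and is constant there, even where the
  normal is not unique. Finitely many relative interiors cover \<open>Gam P\<close>, which gives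
  measurability and a bound.\<close>

lemma outer_normal_Linf: "Linf (muG P) (nrm P)"
proof (rule Linf_bounded_linear[OF bounded_linear_cvec])
  let ?n = "outer_normal (Om P)"
  have const: "?n x = ?n y" if g: "g \<in> mesh_faces" and xy: "x \<in> rel_interior g" "y \<in> rel_interior g" for g x y
  proof -
    have le: "v \<bullet> y \<le> v \<bullet> x" "v \<bullet> x \<le> v \<bullet> y"
      if v: "\<forall>z\<in>Om P. v \<bullet> (z - x) \<le> 0" and xy: "x \<in> rel_interior g" "y \<in> rel_interior g" for v x y
    proof -
      have cl: "v \<bullet> (z - x) \<le> 0" if "z \<in> closure (Om P)" for z
      proof -
        have "closure (Om P) \<subseteq> {z. v \<bullet> z \<le> v \<bullet> x}"
          using v by (intro closure_minimal) (auto simp: inner_diff_right closed_halfspace_le)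
        then show ?thesis
          using that by (auto simp: inner_diff_right)
      qed
      have xyg: "x \<in> g" "y \<in> g"
        using xy rel_interior_subset by auto
      then show "v \<bullet> y \<le> v \<bullet> x"
        using cl[of y] mesh_face(3)[OF g] by (auto simp: inner_diff_right)
      \<comment> \<open>A point of \<open>g\<close> beyond \<open>x\<close>, seen from
        \<open>y\<close>, gives the reverse inequality.\<close>
      obtain e where e: "e > 1" "\<forall>d. d > 1 \<and> d \<le> e \<longrightarrow> (1 - d) *\<^sub>R y + d *\<^sub>R x \<in> g"
        using convex_rel_interior_if[OF mesh_face(2)[OF g] xy(1)] hull_inc[OF xyg(2)] by blast
      then have "(1 - e) *\<^sub>R y + e *\<^sub>R x \<in> g"
        by simp
      then have "v \<bullet> ((1 - e) *\<^sub>R y + e *\<^sub>R x - x) \<le> 0"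
        using cl mesh_face(3)[OF g] by blast
      then have "(e - 1) * (v \<bullet> x) \<le> (e - 1) * (v \<bullet> y)"
        by (simp add: inner_diff_right inner_add_right algebra_simps)
      then show "v \<bullet> x \<le> v \<bullet> y"
        using e(1) by simp
    qed
    have "(\<forall>z\<in>Om P. v \<bullet> (z - x) \<le> 0) \<longleftrightarrow> (\<forall>z\<in>Om P. v \<bullet> (z - y) \<le> 0)" for v
      using le[of v x y] le[of v y x] xy by (auto simp: inner_diff_right)
    then show ?thesis
      by (simp add: outer_normal_def)
  qed
  have cover: "\<exists>g\<in>mesh_faces. x \<in> rel_interior g" if x: "x \<in> Gam P" for x
  proof -
    have "closure (Om P) = \<Union>(mesh P)"
      using mesh by (simp add: valid_mesh_def)
    then obtain T where T: "T \<in> mesh P" "x \<in> T"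
      using x Gam_facts(4) by blast
    obtain g where "g face_of T" "x \<in> rel_interior g"
      by (rule polytope_point_face[OF mesh_cell(5)[OF T(1)] T(2)])
    then show ?thesis
      using T(1) by (auto simp: mesh_faces_def)
  qed
  have rel_borel: "rel_interior g \<in> sets borel" if "g \<in> mesh_faces" for g
  proof -
    have "openin (top_of_set (affine hull g)) (rel_interior g)"
      by (rule openin_rel_interior)
    then obtain U where "open U" "rel_interior g = affine hull g \<inter> U"
      by (auto simp: openin_open)
    then show ?thesis
      by (simp add: borel_closed closed_affine_hull)
  qed
  have "?n \<in> borel_measurable (muG P)"
  proof (rule measurable_piecewise_restrict)
    show "countable (rel_interior ` mesh_faces)"
      using finite_mesh_faces by (intro countable_finite) simp
    show "space (muG P) \<subseteq> \<Union>(rel_interior ` mesh_faces)"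
      using cover by (auto simp: space_surface_measure)
    fix X assume "X \<in> rel_interior ` mesh_faces"
    then obtain g where g: "g \<in> mesh_faces" "X = rel_interior g"
      by blast
    show "X \<inter> space (muG P) \<in> sets (muG P)"
      using rel_borel[OF g(1)] Gam_facts(1)
      by (auto simp: g(2) space_surface_measure sets_surface_measure sets_restrict_space_iff borel_closed)
    have "?n \<in> borel_measurable (restrict_space (muG P) X) \<longleftrightarrow>
        (\<lambda>y. ?n (SOME x. x \<in> rel_interior g)) \<in> borel_measurable (restrict_space (muG P) X)"
    proof (rule measurable_cong)
      fix y assume "y \<in> space (restrict_space (muG P) X)"
      then have y: "y \<in> rel_interior g"
        by (simp add: space_restrict_space g(2))
      then show "?n y = ?n (SOME x. x \<in> rel_interior g)"
        by (intro const[OF g(1) y] someI[where P = "\<lambda>x. x \<in> rel_interior g", OF y])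
    qed
    then show "?n \<in> borel_measurable (restrict_space (muG P) X)"
      by simp
  qed
  \<comment> \<open>Where the normal is not unique the description is unspecified, so the bound is a
    sum over the faces rather than 1.\<close>
  moreover have "AE x in muG P. norm (?n x) \<le> (\<Sum>g\<in>mesh_faces. norm (?n (SOME x. x \<in> rel_interior g)))"
  proof (rule AE_I2, unfold space_surface_measure)
    fix x assume "x \<in> Gam P"
    then obtain g where g: "g \<in> mesh_faces" "x \<in> rel_interior g"
      using cover by blast
    have "?n x = ?n (SOME x. x \<in> rel_interior g)"
      by (rule const[OF g(1) g(2) someI[where P = "\<lambda>x. x \<in> rel_interior g", OF g(2)]])
    also have "norm \<dots> \<le> (\<Sum>g\<in>mesh_faces. norm (?n (SOME x. x \<in> rel_interior g)))"
      by (rule member_le_sum[where f = "\<lambda>g. norm (?n (SOME x. x \<in> rel_interior g))",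
            OF g(1) _ finite_mesh_faces]) simp
    finally show "norm (?n x) \<le> (\<Sum>g\<in>mesh_faces. norm (?n (SOME x. x \<in> rel_interior g)))" .
  qed
  ultimately show "Linf (muG P) ?n"
    unfolding Linf_def by blast
qed

lemma cdot_ccross_ccross: "cdot (ccross u v) w = cdot u (ccross v w)"
  by (simp add: cdot_def ccross_def sum_3 algebra_simps)

text \<open>The normal is real, so conjugation passes through the product. The data then enters only
  through its tangential trace, the part of it assumed to be square integrable.\<close>

lemma ccross_minus_real: "ccross (cvec n) (cconj (u - v)) = cconj (ccross v (cvec n) - ccross u (cvec n))"
  by (simp add: ccross_def cconj_def cvec_def vec_eq_iff forall_3 algebra_simps)

text \<open>The right-hand side depends on the field only through finitely many nodal values, so
  pointwise convergence suffices and traces need not be passed to the limit.\<close>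

lemma adjoint_rhs_limit:
  assumes E: "\<And>j. E j \<in> Rh P" "E' \<in> Rh P" "\<And>x. (\<lambda>j. E j x) \<longlonglongrightarrow> E' x" and F: "F \<in> Rh P"
  shows "(\<lambda>j. adjoint_rhs (E j) F) \<longlonglongrightarrow> adjoint_rhs E' F"
proof -
  obtain Y e where Y: "finite Y" "\<And>y. y \<in> Y \<Longrightarrow> e y \<in> Rh P"
    "\<And>x y. x \<in> Y \<Longrightarrow> y \<in> Y \<Longrightarrow> e y (fst x) $ snd x = (if x = y then 1 else 0)"
    "\<And>E. E \<in> Rh P \<Longrightarrow> E = (\<lambda>x. \<Sum>y\<in>Y. (E (fst y) $ snd y) *s e y x)"
    by (rule Rh_basis) (rule that)
  let ?t = "bdry_trace (Om P)"
  define m where "m x = ccross (nrm P x) (cconj (?t F x))" for x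
  define q where "q u x = cdot (cconj (u x)) (m x)" for u :: "R3 \<Rightarrow> C3" and x
  have m: "Linf (muG P) m"
    unfolding m_def[abs_def]
    by (intro Linf_bilinear[OF bounded_bilinear_ccross] outer_normal_Linf
        Linf_bounded_linear[OF bounded_linear_cconj] bdry_trace_Linf F)
  have h: "bounded_bilinear (\<lambda>u v. cdot (cconj u) v)"
    by (rule bounded_bilinearI_linear; rule linearI)
      (simp_all add: cdot_def cconj_def sum.distrib distrib_left distrib_right scaleR_sum_right)
  have intL2: "integrable (muG P) (q u)" if "u \<in> L2 (muG P)" for u
    unfolding q_def[abs_def] by (rule integrable_L2_Linf[OF finite_muG h that m])
  have obs: "(\<lambda>x. ccross (Eobs P x) (nrm P x)) \<in> L2 (muG P)"
    using data by (simp add: valid_data_def)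
  have tr: "(\<lambda>x. ccross (?t G x) (nrm P x)) \<in> L2 (muG P)" if "G \<in> Rh P" for G
    by (intro Linf_L2[OF finite_muG] Linf_bilinear[OF bounded_bilinear_ccross] outer_normal_Linf bdry_trace_Linf that)
  define g where "g y = (LINT x|muG P. q (\<lambda>x. ccross (?t (e y) x) (nrm P x)) x)" for y
  define g0 where "g0 = (LINT x|muG P. q (\<lambda>x. ccross (Eobs P x) (nrm P x)) x)"
  have repr: "adjoint_rhs G F = (\<Sum>y\<in>Y. cnj (G (fst y) $ snd y) * g y) - g0" if G: "G \<in> Rh P" for G
  proof -
    have q1: "cdot (ccross (ccross (nrm P x) (cconj (Eobs P x - ?t G x))) (nrm P x)) (cconj (?t F x)) =
        q (\<lambda>x. ccross (?t G x) (nrm P x)) x - q (\<lambda>x. ccross (Eobs P x) (nrm P x)) x" for x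
      unfolding ccross_minus_real cdot_ccross_ccross q_def m_def
      by (simp add: cdot_def cconj_def left_diff_distrib sum_subtractf)
    \<comment> \<open>The trace is known to be linear only where the limits exist; off the edges
      they do, and the edges are null.\<close>
    have q2: "AE x in muG P. q (\<lambda>x. ccross (?t G x) (nrm P x)) x =
        (\<Sum>y\<in>Y. cnj (G (fst y) $ snd y) * q (\<lambda>x. ccross (?t (e y) x) (nrm P x)) x)"
      using AE_not_edge AE_space
    proof eventually_elim
      case (elim x)
      then have x: "x \<in> Gam P"
        by (simp add: space_surface_measure)
      have "((\<lambda>z. \<Sum>y\<in>Y. (G (fst y) $ snd y) *s e y z) \<longlongrightarrow> (\<Sum>y\<in>Y. (G (fst y) $ snd y) *s ?t (e y) x)) (at x within Om P)"
        by (intro tendsto_sum bounded_linear.tendsto[OF bounded_linear_scalar_vec] bdry_trace_tendsto Y(2) x elim(1))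
      then have "(G \<longlongrightarrow> (\<Sum>y\<in>Y. (G (fst y) $ snd y) *s ?t (e y) x)) (at x within Om P)"
        by (subst Y(4)[OF G])
      then have "?t G x = (\<Sum>y\<in>Y. (G (fst y) $ snd y) *s ?t (e y) x)"
        using tendsto_Lim[OF Gam_limit_point[OF x]] by (simp add: bdry_trace_def)
      moreover have "cdot (cconj (ccross (\<Sum>y\<in>Y. c y *s v y) n)) k = (\<Sum>y\<in>Y. cnj (c y) * cdot (cconj (ccross (v y) n)) k)"
        for c and v :: "R3 \<times> 3 \<Rightarrow> C3" and n k
        using Y(1)
      proof (induction Y rule: finite_induct)
        case empty
        show ?case
          by (simp add: cdot_def cconj_def ccross_def sum_3)
      next
        case (insert y Y)
        have "cdot (cconj (ccross (c y *s v y + w) n)) k =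
            cnj (c y) * cdot (cconj (ccross (v y) n)) k + cdot (cconj (ccross w n)) k" for w
          by (simp add: cdot_def cconj_def ccross_def sum_3 algebra_simps)
        then show ?case
          using insert by simp
      qed
      ultimately show ?case
        by (simp add: q_def)
    qed
    have "adjoint_rhs G F = (LINT x|muG P. q (\<lambda>x. ccross (?t G x) (nrm P x)) x) - g0"
      unfolding adjoint_rhs_def q1 g0_def using intL2[OF tr[OF G]] intL2[OF obs] by simp
    also have "(LINT x|muG P. q (\<lambda>x. ccross (?t G x) (nrm P x)) x) =
        (LINT x|muG P. (\<Sum>y\<in>Y. cnj (G (fst y) $ snd y) * q (\<lambda>x. ccross (?t (e y) x) (nrm P x)) x))"
      using q2 intL2[OF tr[OF G]] intL2[OF tr[OF Y(2)]]
      by (intro integral_cong_AE borel_measurable_sum borel_measurable_times borel_measurable_const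
          borel_measurable_integrable)
    also have "\<dots> = (\<Sum>y\<in>Y. cnj (G (fst y) $ snd y) * g y)"
      using intL2[OF tr[OF Y(2)]] by (simp add: g_def)
    finally show ?thesis .
  qed
  show ?thesis
    unfolding repr[OF E(1)] repr[OF E(2)]
    by (intro tendsto_intros tendsto_vec_nth E(3))
qed

end

section \<open>Descent of the augmented Lagrangian\<close>

text \<open>Divide by \<open>t\<close> and let it tend to zero. A quadratic remainder is all that is
  asked for, so optimality conditions follow without differentiating \<open>Gh\<close>.\<close>

lemma linear_part_nonneg:
  fixes A B :: real
  assumes "\<And>t. 0 < t \<Longrightarrow> t \<le> 1 \<Longrightarrow> 0 \<le> t * A + t\<^sup>2 * B"
  shows "0 \<le> A"
proof (rule field_le_epsilon)
  fix e :: real assume "e > 0"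
  define t where "t = min 1 (e / (\<bar>B\<bar> + 1))"
  have t: "0 < t" "t \<le> 1" "t \<le> e / (\<bar>B\<bar> + 1)"
    using \<open>e > 0\<close> by (auto simp: t_def)
  have "0 \<le> t * (A + t * B)"
    using assms[OF t(1,2)] by (simp add: power2_eq_square algebra_simps)
  then have "0 \<le> A + t * B"
    using t(1) by (simp add: zero_le_mult_iff)
  also have "t * B \<le> t * (\<bar>B\<bar> + 1)"
    using t(1) by (intro mult_left_mono) auto
  also have "t * (\<bar>B\<bar> + 1) \<le> e"
    using t(3) by (simp add: pos_le_divide_eq)
  finally show "0 \<le> A + e"
    by simp
qed

context eddy_setting
begin

declare Vh_lincomb [simp]

section \<open>Gradient inner product and \<open>L2\<close> pairing\<close>

lemma Vh_diff [simp]: "u \<in> Vh P \<Longrightarrow> v \<in> Vh P \<Longrightarrow> (\<lambda>x. u x - v x) \<in> Vh P"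
  using Vh_lincomb[of u v 1 "-1"] by simp

lemma Vh_Linf: "v \<in> Vh P \<Longrightarrow> Linf (muC P) v"
  by (rule pw_affine_Linf[OF meshed_OmC Vh_pw_affine])

lemma Vh_L2 [simp]: "v \<in> Vh P \<Longrightarrow> v \<in> L2 (muC P)"
  by (rule Linf_L2[OF fin_OmC Vh_Linf])

lemma Vh_grad_Linf: "v \<in> Vh P \<Longrightarrow> Linf (muC P) (grad v)"
  by (rule grad_Linf[OF meshed_OmC Vh_pw_affine])

lemma Vh_grad_L2 [simp]: "v \<in> Vh P \<Longrightarrow> grad v \<in> L2 (muC P)"
  by (rule Linf_L2[OF fin_OmC Vh_grad_Linf])

lemma Gh'_L2 [simp]: "\<sigma> \<in> Kh P \<Longrightarrow> Gh' P \<sigma> \<in> L2 (muC P)"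
  by (rule Linf_L2[OF fin_OmC Gh'_Linf])

lemma grad_lincomb_AE:
  assumes "u \<in> Vh P" "v \<in> Vh P"
  shows "AE x in muC P. grad (\<lambda>x. a * u x + b * v x) x = a *\<^sub>R grad u x + b *\<^sub>R grad v x"
  using pw_affine_differentiable[OF meshed_OmC Vh_pw_affine[OF assms(1)]]
    pw_affine_differentiable[OF meshed_OmC Vh_pw_affine[OF assms(2)]]
  by eventually_elim (rule grad_lincomb_real)

text \<open>Bilinearity is available on \<open>Vh\<close>, where functions are differentiable almost
  everywhere; in general the gradient of a sum need not be the sum of the gradients.\<close>

definition gip :: "(R3 \<Rightarrow> real) \<Rightarrow> (R3 \<Rightarrow> real) \<Rightarrow> real" where
  "gip u v = (LINT x|muC P. grad u x \<bullet> grad v x)"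

definition gnorm :: "(R3 \<Rightarrow> real) \<Rightarrow> real" where
  "gnorm u = L2norm (muC P) (grad u)"

lemma gnorm_nonneg [simp]: "0 \<le> gnorm u"
  by (simp add: gnorm_def)

lemma gnorm_power2: "(gnorm u)\<^sup>2 = gip u u"
  by (simp add: gnorm_def gip_def L2norm_power2)

lemma gip_commute: "gip u v = gip v u"
  by (simp add: gip_def inner_commute)

lemma gip_lincomb_left [simp]:
  assumes "u \<in> Vh P" "v \<in> Vh P" "w \<in> Vh P"
  shows "gip (\<lambda>x. a * u x + b * v x) w = a * gip u w + b * gip v w"
proof -
  have "AE x in muC P. grad (\<lambda>x. a * u x + b * v x) x \<bullet> grad w x =
      a * (grad u x \<bullet> grad w x) + b * (grad v x \<bullet> grad w x)"
    using grad_lincomb_AE[OF assms(1,2), of a b] by eventually_elim (simp add: inner_add_left)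
  then have "gip (\<lambda>x. a * u x + b * v x) w =
      (LINT x|muC P. a * (grad u x \<bullet> grad w x) + b * (grad v x \<bullet> grad w x))"
    unfolding gip_def by (rule integral_lebesgue_on_cong_AE[OF sets_OmC])
  then show ?thesis
    using L2_inner_integrable[OF Vh_grad_L2[OF assms(1)] Vh_grad_L2[OF assms(3)]]
      L2_inner_integrable[OF Vh_grad_L2[OF assms(2)] Vh_grad_L2[OF assms(3)]]
    by (simp add: gip_def)
qed

lemma gip_lincomb_right [simp]:
  assumes "u \<in> Vh P" "v \<in> Vh P" "w \<in> Vh P"
  shows "gip w (\<lambda>x. a * u x + b * v x) = a * gip w u + b * gip w v"
  using gip_lincomb_left[OF assms] by (simp add: gip_commute)

lemma gip_diff_left [simp]:
  assumes "u \<in> Vh P" "v \<in> Vh P" "w \<in> Vh P"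
  shows "gip (\<lambda>x. u x - v x) w = gip u w - gip v w"
  using gip_lincomb_left[OF assms, of 1 "-1"] by simp

lemma gip_diff_right [simp]:
  assumes "u \<in> Vh P" "v \<in> Vh P" "w \<in> Vh P"
  shows "gip w (\<lambda>x. u x - v x) = gip w u - gip w v"
  using gip_diff_left[OF assms] by (simp add: gip_commute)

lemma L2norm_grad_diff:
  assumes "u \<in> Vh P" "v \<in> Vh P"
  shows "L2norm (muC P) (\<lambda>x. grad u x - grad v x) = gnorm (\<lambda>x. u x - v x)"
proof -
  have "AE x in muC P. (norm (grad u x - grad v x))\<^sup>2 = (norm (grad (\<lambda>x. u x - v x) x))\<^sup>2"
    using grad_lincomb_AE[OF assms, of 1 "-1"] by eventually_elim simp
  from integral_lebesgue_on_cong_AE[OF sets_OmC this] show ?thesis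
    by (simp add: gnorm_def L2norm_def)
qed

lemma gnorm_commute:
  assumes "u \<in> Vh P" "v \<in> Vh P"
  shows "gnorm (\<lambda>x. u x - v x) = gnorm (\<lambda>x. v x - u x)"
  unfolding L2norm_grad_diff[OF assms, symmetric] L2norm_grad_diff[OF assms(2,1), symmetric]
  by (rule L2norm_minus_commute)

lemma gnorm_triangle:
  assumes "u \<in> Vh P" "v \<in> Vh P" "w \<in> Vh P"
  shows "gnorm (\<lambda>x. u x - w x) \<le> gnorm (\<lambda>x. u x - v x) + gnorm (\<lambda>x. v x - w x)"
  using L2norm_triangle_diff[of "grad u" "muC P" "grad v" "grad w"] assms
  by (simp add: L2norm_grad_diff)

lemma gip_abs_le:
  assumes "u \<in> Vh P" "v \<in> Vh P"
  shows "\<bar>gip u v\<bar> \<le> gnorm u * gnorm v"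
  unfolding gip_def gnorm_def using assms by (intro L2_Cauchy_Schwarz) simp_all

lemma gip_self_nonneg [simp]: "0 \<le> gip u u"
  by (simp add: gnorm_power2[symmetric])

lemma ipC_inner: "ipC P f g = (LINT x|muC P. f x \<bullet> g x)"
  by (simp add: ipC_def)

lemma ipC_lincomb_right:
  assumes "f \<in> L2 (muC P)" "g \<in> L2 (muC P)" "h \<in> L2 (muC P)"
  shows "ipC P f (\<lambda>x. a * g x + b * h x) = a * ipC P f g + b * ipC P f h"
proof -
  have "ipC P f (\<lambda>x. a * g x + b * h x) = (LINT x|muC P. a * (f x \<bullet> g x) + b * (f x \<bullet> h x))"
    unfolding ipC_def by (simp add: algebra_simps)
  then show ?thesis
    using L2_inner_integrable[OF assms(1,2)] L2_inner_integrable[OF assms(1,3)] by (simp add: ipC_def)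
qed

lemma ipC_commute: "ipC P f g = ipC P g f"
  by (simp add: ipC_def mult.commute)

lemma ipC_diff_right:
  assumes "f \<in> L2 (muC P)" "g \<in> L2 (muC P)" "h \<in> L2 (muC P)"
  shows "ipC P f (\<lambda>x. g x - h x) = ipC P f g - ipC P f h"
  using ipC_lincomb_right[OF assms, of 1 "-1"] by simp

lemma ipC_diff_left:
  assumes "f \<in> L2 (muC P)" "g \<in> L2 (muC P)" "h \<in> L2 (muC P)"
  shows "ipC P (\<lambda>x. g x - h x) f = ipC P g f - ipC P h f"
  using ipC_diff_right[OF assms] by (simp add: ipC_commute)

lemma ipC_abs_le:
  assumes "f \<in> L2 (muC P)" "g \<in> L2 (muC P)"
  shows "\<bar>ipC P f g\<bar> \<le> L2norm (muC P) f * L2norm (muC P) g"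
  unfolding ipC_inner by (rule L2_Cauchy_Schwarz[OF assms])

lemma ipC_cong_AE: "AE x in muC P. f x = g x \<Longrightarrow> ipC P f h = ipC P g h"
  unfolding ipC_def by (rule integral_lebesgue_on_cong_AE[OF sets_OmC]) (auto elim: eventually_mono)

lemma grad_L1_nonneg: "0 \<le> grad_L1 P u"
  by (simp add: grad_L1_def)

lemma grad_L1_convex:
  assumes uv: "u \<in> Vh P" "v \<in> Vh P" and ab: "0 \<le> a" "0 \<le> b"
  shows "grad_L1 P (\<lambda>x. a * u x + b * v x) \<le> a * grad_L1 P u + b * grad_L1 P v"
proof -
  have int: "integrable (muC P) (\<lambda>x. norm (grad w x))" if "w \<in> Vh P" for w
    using that by (intro L2_norm_integrable[OF fin_OmC]) simp
  have "grad_L1 P (\<lambda>x. a * u x + b * v x) \<le> (LINT x|muC P. a * norm (grad u x) + b * norm (grad v x))"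
    unfolding grad_L1_def
  proof (rule integral_mono_AE)
    show "integrable (muC P) (\<lambda>x. norm (grad (\<lambda>x. a * u x + b * v x) x))"
      using uv by (intro int) simp
    show "integrable (muC P) (\<lambda>x. a * norm (grad u x) + b * norm (grad v x))"
      using int[OF uv(1)] int[OF uv(2)] by simp
    show "AE x in muC P. norm (grad (\<lambda>x. a * u x + b * v x) x) \<le> a * norm (grad u x) + b * norm (grad v x)"
      using grad_lincomb_AE[OF uv, of a b]
    proof eventually_elim
      case (elim x)
      show ?case
        unfolding elim using norm_triangle_ineq[of "a *\<^sub>R grad u x" "b *\<^sub>R grad v x"] ab by simp
    qed
  qed
  also have "\<dots> = a * grad_L1 P u + b * grad_L1 P v"
    using int[OF uv(1)] int[OF uv(2)] by (simp add: grad_L1_def)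
  finally show ?thesis .
qed

lemma Lagr_eq:
  assumes "\<sigma> \<in> Vh P" "s \<in> Vh P"
  shows "Lagr P \<alpha> \<beta> \<sigma> s y = Gh P \<sigma> + \<alpha> * grad_L1 P s + ipC P y (\<lambda>x. s x - \<sigma> x)
    + \<beta> / 2 * gip (\<lambda>x. s x - \<sigma> x) (\<lambda>x. s x - \<sigma> x)"
  unfolding Lagr_def L2norm_grad_diff[OF assms(2,1)] gnorm_power2 ..

lemma Gh_nonneg: "0 \<le> Gh P \<sigma>"
  by (simp add: Gh_def)

end

section \<open>Lipschitz bounds, optimality conditions and one step of the iteration\<close>

locale eddy_gradient_bound = eddy_setting +
  fixes Cs C0 :: real
  assumes Poincare: "inverse_Poincare_const P Cs" and Lipschitz: "gradient_Lipschitz_const P C0"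
begin

definition Lip :: real where "Lip = C0 / mesh_size P ^ 3"

definition kap :: real where "kap = C0 * Cs\<^sup>2 / mesh_size P"

lemma Lip_pos: "Lip > 0"
  using Lipschitz mesh_size_pos by (simp add: Lip_def gradient_Lipschitz_const_def)

lemma kap_pos: "kap > 0"
  using Lipschitz Poincare mesh_size_pos
  by (simp add: kap_def gradient_Lipschitz_const_def inverse_Poincare_const_def)

lemma kap_eq: "kap = Lip * (Cs * mesh_size P)\<^sup>2"
  using mesh_size_pos by (simp add: kap_def Lip_def power2_eq_square power3_eq_cube)

abbreviation nC :: "(R3 \<Rightarrow> real) \<Rightarrow> real" where
  "nC \<equiv> L2norm (muC P)"

lemma nC_le_gnorm: "v \<in> Vh P \<Longrightarrow> nC v \<le> Cs * mesh_size P * gnorm v"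
  using Poincare by (simp add: inverse_Poincare_const_def gnorm_def)

lemma Lip_nC_le:
  assumes "u \<in> Vh P" "v \<in> Vh P"
  shows "Lip * nC u * nC v \<le> kap * gnorm u * gnorm v"
proof -
  have "nC u * nC v \<le> (Cs * mesh_size P * gnorm u) * (Cs * mesh_size P * gnorm v)"
    using nC_le_gnorm assms Poincare mesh_size_pos
    by (intro mult_mono) (auto simp: inverse_Poincare_const_def)
  then have "Lip * (nC u * nC v) \<le> Lip * ((Cs * mesh_size P * gnorm u) * (Cs * mesh_size P * gnorm v))"
    using Lip_pos by (intro mult_left_mono) auto
  then show ?thesis
    by (simp add: kap_eq power2_eq_square algebra_simps)
qed

lemma Gh_descent:
  assumes "\<sigma>1 \<in> Kh P" "\<sigma>2 \<in> Kh P"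
  shows "Gh P \<sigma>1 - Gh P \<sigma>2 - ipC P (Gh' P \<sigma>2) (\<lambda>x. \<sigma>1 x - \<sigma>2 x) \<le> Lip * (nC (\<lambda>x. \<sigma>1 x - \<sigma>2 x))\<^sup>2"
  using Lipschitz assms by (simp add: gradient_Lipschitz_const_def Lip_def)

lemma nC_scale: "nC (\<lambda>x. a * f x) = \<bar>a\<bar> * nC f"
proof -
  have "(LINT x|muC P. (a * f x)\<^sup>2) = a\<^sup>2 * (LINT x|muC P. (f x)\<^sup>2)"
    by (simp add: power_mult_distrib)
  then show ?thesis
    by (simp add: L2norm_def real_sqrt_mult)
qed

text \<open>The assumed bound is one-sided; exchanging the two points gives the other sign.\<close>

lemma admissible_Lipschitz:
  assumes "\<sigma>1 \<in> Kh P" "\<sigma>2 \<in> Kh P" "d \<in> Vh P" "t > 0"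
    "(\<lambda>x. \<sigma>1 x + t * d x) \<in> Kh P" "(\<lambda>x. \<sigma>2 x + t * d x) \<in> Kh P"
  shows "\<bar>ipC P (Gh' P \<sigma>1) d - ipC P (Gh' P \<sigma>2) d\<bar> \<le> Lip * nC (\<lambda>x. \<sigma>1 x - \<sigma>2 x) * nC d"
proof -
  have *: "ipC P (\<lambda>x. Gh' P \<tau>1 x - Gh' P \<tau>2 x) d \<le> Lip * nC (\<lambda>x. \<tau>1 x - \<tau>2 x) * nC d"
    if "\<tau>1 \<in> Kh P" "\<tau>2 \<in> Kh P" "(\<lambda>x. \<tau>1 x + t * d x) \<in> Kh P" "(\<lambda>x. \<tau>2 x + t * d x) \<in> Kh P" for \<tau>1 \<tau>2
    using Lipschitz that assms(3,4) unfolding gradient_Lipschitz_const_def Lip_def by blast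
  show ?thesis
    using *[OF assms(1,2,5,6)] *[OF assms(2,1,6,5)] L2norm_minus_commute[of "muC P" \<sigma>1 \<sigma>2] assms
    by (simp add: ipC_diff_left abs_le_iff)
qed

text \<open>The assumed bound only covers directions admissible at both points. Moving both points a
  little towards the midpoint of \<open>s\<close> and \<open>\<tau>\<close> makes \<open>s - \<tau>\<close> admissible; the error is controlled
  since \<open>s - \<sigma>i\<close> and \<open>\<tau> - \<sigma>i\<close> are admissible at \<open>\<sigma>i\<close> and at the moved point.\<close>

lemma Gh'_Lipschitz:
  assumes K: "\<sigma>1 \<in> Kh P" "\<sigma>2 \<in> Kh P" "s \<in> Kh P" "\<tau> \<in> Kh P"
  shows "\<bar>ipC P (Gh' P \<sigma>1) (\<lambda>x. s x - \<tau> x) - ipC P (Gh' P \<sigma>2) (\<lambda>x. s x - \<tau> x)\<bar>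
    \<le> Lip * nC (\<lambda>x. \<sigma>1 x - \<sigma>2 x) * nC (\<lambda>x. s x - \<tau> x)"
proof -
  define c where "c x = 1/2 * s x + 1/2 * \<tau> x" for x
  define d where "d x = s x - \<tau> x" for x
  define mv where "mv t \<sigma> x = (1 - t) * \<sigma> x + t * c x" for t \<sigma> and x :: R3
  have cK: "c \<in> Kh P"
    unfolding c_def[abs_def] by (rule Kh_convex) (use K in auto)
  have mvK: "mv t \<sigma> \<in> Kh P" if "\<sigma> \<in> Kh P" "0 < t" "t < 1" for t \<sigma>
    unfolding mv_def[abs_def] by (rule Kh_convex) (use that cK in auto)
  have dV: "d \<in> Vh P"
    unfolding d_def[abs_def] using K by (simp add: Kh_Vh)
  define M where "M \<sigma> = Lip * nC (\<lambda>x. c x - \<sigma> x) * (nC (\<lambda>x. s x - \<sigma> x) + nC (\<lambda>x. \<tau> x - \<sigma> x))" for \<sigma>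
  have near: "\<bar>ipC P (Gh' P \<sigma>) d - ipC P (Gh' P (mv t \<sigma>)) d\<bar> \<le> t * M \<sigma>"
    if \<sigma>: "\<sigma> \<in> Kh P" and t: "0 < t" "t < 1" for \<sigma> t
  proof -
    have dir: "\<bar>ipC P (Gh' P \<sigma>) (\<lambda>x. u x - \<sigma> x) - ipC P (Gh' P (mv t \<sigma>)) (\<lambda>x. u x - \<sigma> x)\<bar>
        \<le> Lip * (t * nC (\<lambda>x. c x - \<sigma> x)) * nC (\<lambda>x. u x - \<sigma> x)" if u: "u \<in> Kh P" for u
    proof -
      \<comment> \<open>With step length \<open>1 - t\<close> both points land on convex
        combinations with \<open>u\<close>; in the moved point the share of \<open>\<sigma>\<close>
        cancels.\<close>
      have "(\<lambda>x. t * \<sigma> x + (1 - t) * u x) \<in> Kh P" "(\<lambda>x. t * c x + (1 - t) * u x) \<in> Kh P"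
        using \<sigma> u cK t by (auto intro!: Kh_convex)
      moreover have "(\<lambda>x. \<sigma> x + (1 - t) * (u x - \<sigma> x)) = (\<lambda>x. t * \<sigma> x + (1 - t) * u x)"
        "(\<lambda>x. mv t \<sigma> x + (1 - t) * (u x - \<sigma> x)) = (\<lambda>x. t * c x + (1 - t) * u x)"
        by (auto simp: mv_def algebra_simps)
      ultimately have "\<bar>ipC P (Gh' P \<sigma>) (\<lambda>x. u x - \<sigma> x) - ipC P (Gh' P (mv t \<sigma>)) (\<lambda>x. u x - \<sigma> x)\<bar>
          \<le> Lip * nC (\<lambda>x. \<sigma> x - mv t \<sigma> x) * nC (\<lambda>x. u x - \<sigma> x)"
        using \<sigma> u t mvK by (intro admissible_Lipschitz[where t = "1 - t"]) (auto simp: Kh_Vh)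
      also have "nC (\<lambda>x. \<sigma> x - mv t \<sigma> x) = t * nC (\<lambda>x. c x - \<sigma> x)"
      proof -
        have "nC (\<lambda>x. \<sigma> x - mv t \<sigma> x) = nC (\<lambda>x. mv t \<sigma> x - \<sigma> x)"
          by (rule L2norm_minus_commute)
        also have "(\<lambda>x. mv t \<sigma> x - \<sigma> x) = (\<lambda>x. t * (c x - \<sigma> x))"
          by (auto simp: mv_def algebra_simps)
        finally show ?thesis
          using t by (simp add: nC_scale)
      qed
      finally show ?thesis .
    qed
    have split: "ipC P (Gh' P \<rho>) d = ipC P (Gh' P \<rho>) (\<lambda>x. s x - \<sigma> x) - ipC P (Gh' P \<rho>) (\<lambda>x. \<tau> x - \<sigma> x)"
      if "\<rho> \<in> Kh P" for \<rho>
      using that K \<sigma> by (simp add: d_def[abs_def] ipC_diff_right Kh_Vh)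
    have "t * M \<sigma> = Lip * (t * nC (\<lambda>x. c x - \<sigma> x)) * nC (\<lambda>x. s x - \<sigma> x) +
        Lip * (t * nC (\<lambda>x. c x - \<sigma> x)) * nC (\<lambda>x. \<tau> x - \<sigma> x)"
      by (simp add: M_def algebra_simps)
    then show ?thesis
      unfolding split[OF \<sigma>] split[OF mvK[OF \<sigma> t]] using dir[OF K(3)] dir[OF K(4)] by linarith
  qed
  have moved: "\<bar>ipC P (Gh' P (mv t \<sigma>1)) d - ipC P (Gh' P (mv t \<sigma>2)) d\<bar> \<le> Lip * nC (\<lambda>x. \<sigma>1 x - \<sigma>2 x) * nC d"
    if t: "0 < t" "t < 1" for t
  proof -
    \<comment> \<open>The step length \<open>t / 2\<close> fits the midpoint:
      \<open>t * c + t / 2 * d = t * s\<close>.\<close>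
    have adm: "(\<lambda>x. mv t \<sigma> x + t / 2 * d x) \<in> Kh P" if "\<sigma> \<in> Kh P" for \<sigma>
    proof -
      have "(\<lambda>x. mv t \<sigma> x + t / 2 * d x) = (\<lambda>x. (1 - t) * \<sigma> x + t * s x)"
        by (auto simp: mv_def c_def d_def field_simps)
      then show ?thesis
        using that K t by (auto intro!: Kh_convex)
    qed
    have "\<bar>ipC P (Gh' P (mv t \<sigma>1)) d - ipC P (Gh' P (mv t \<sigma>2)) d\<bar> \<le> Lip * nC (\<lambda>x. mv t \<sigma>1 x - mv t \<sigma>2 x) * nC d"
      using t K by (intro admissible_Lipschitz[where t = "t / 2"] mvK adm dV) auto
    also have "(\<lambda>x. mv t \<sigma>1 x - mv t \<sigma>2 x) = (\<lambda>x. (1 - t) * (\<sigma>1 x - \<sigma>2 x))"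
      by (auto simp: mv_def algebra_simps)
    also have "Lip * nC \<dots> * nC d \<le> Lip * nC (\<lambda>x. \<sigma>1 x - \<sigma>2 x) * nC d"
      unfolding nC_scale using t Lip_pos by (intro mult_right_mono mult_left_mono) (auto simp: mult_left_le_one_le)
    finally show ?thesis .
  qed
  have "\<bar>ipC P (Gh' P \<sigma>1) d - ipC P (Gh' P \<sigma>2) d\<bar> \<le> Lip * nC (\<lambda>x. \<sigma>1 x - \<sigma>2 x) * nC d + e" if "e > 0" for e
  proof -
    have M0: "0 \<le> M \<sigma>" for \<sigma>
      using Lip_pos by (simp add: M_def)
    \<comment> \<open>Makes the errors \<open>t * M \<sigma>1\<close> and
      \<open>t * M \<sigma>2\<close> together at most \<open>e\<close>; the value \<open>1/2\<close>
      keeps \<open>t < 1\<close>.\<close>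
    define t where "t = min (1/2) (e / (M \<sigma>1 + M \<sigma>2 + 1))"
    have pos: "0 < M \<sigma>1 + M \<sigma>2 + 1"
      using M0[of \<sigma>1] M0[of \<sigma>2] by linarith
    have t: "0 < t" "t < 1" "t \<le> e / (M \<sigma>1 + M \<sigma>2 + 1)"
      using that pos by (auto simp: t_def)
    have "t * (M \<sigma>1 + M \<sigma>2 + 1) \<le> e"
      using t(3) pos_le_divide_eq[OF pos] by blast
    then have "t * M \<sigma>1 + t * M \<sigma>2 + t \<le> e"
      by (simp add: algebra_simps)
    then show ?thesis
      using near[OF K(1) t(1,2)] near[OF K(2) t(1,2)] moved[OF t(1,2)] t(1) by linarith
  qed
  then show ?thesis
    unfolding d_def[abs_def] by (rule field_le_epsilon)
qed

lemma Gh'_Lipschitz_gnorm: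
  assumes K: "\<sigma>1 \<in> Kh P" "\<sigma>2 \<in> Kh P" "s \<in> Kh P" "\<tau> \<in> Kh P"
  shows "\<bar>ipC P (Gh' P \<sigma>1) (\<lambda>x. s x - \<tau> x) - ipC P (Gh' P \<sigma>2) (\<lambda>x. s x - \<tau> x)\<bar>
    \<le> kap * gnorm (\<lambda>x. \<sigma>1 x - \<sigma>2 x) * gnorm (\<lambda>x. s x - \<tau> x)"
  using Gh'_Lipschitz[OF K] Lip_nC_le[of "\<lambda>x. \<sigma>1 x - \<sigma>2 x" "\<lambda>x. s x - \<tau> x"] K
  by (simp add: Kh_Vh)

text \<open>Using the descent inequality on both halves of the segment instead of on the whole segment
  improves the constant from 2 to 5/4, which is what the threshold for \<open>\<beta>\<close> requires.\<close>

lemma Gh_ascent: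
  assumes K: "\<sigma> \<in> Kh P" "\<sigma>' \<in> Kh P"
  shows "Gh P \<sigma> - Gh P \<sigma>' - ipC P (Gh' P \<sigma>') (\<lambda>x. \<sigma> x - \<sigma>' x) \<ge> - (5/4 * kap * (gnorm (\<lambda>x. \<sigma> x - \<sigma>' x))\<^sup>2)"
proof -
  define m where "m x = 1/2 * \<sigma> x + 1/2 * \<sigma>' x" for x
  define d where "d x = \<sigma> x - \<sigma>' x" for x
  have mK: "m \<in> Kh P"
    unfolding m_def[abs_def] by (rule Kh_convex) (use K in auto)
  have V: "\<sigma> \<in> Vh P" "\<sigma>' \<in> Vh P" "m \<in> Vh P" "d \<in> Vh P"
    using K mK by (auto simp: Kh_Vh d_def[abs_def])
  have half: "(\<lambda>x. \<sigma>' x - m x) = (\<lambda>x. (- (1/2)) * d x)" "(\<lambda>x. m x - \<sigma> x) = (\<lambda>x. (- (1/2)) * d x)"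
    "(\<lambda>x. m x - \<sigma>' x) = (\<lambda>x. (1/2) * d x)"
    by (auto simp: m_def d_def field_simps)
  have ip_half: "ipC P f (\<lambda>x. (- (1/2)) * d x) = - (1/2) * ipC P f d" if "f \<in> L2 (muC P)" for f
    using ipC_lincomb_right[OF that, of d d "- (1/2)" 0] V by simp
  \<comment> \<open>In units of \<open>Lip * (nC d)^2\<close>, the two descents cost
    \<open>1/2\<close>; exchanging the gradients at \<open>m\<close> and at \<open>\<sigma>\<close>
    for the one at \<open>\<sigma>'\<close>, each with weight \<open>1/2\<close>, costs
    \<open>1/4\<close> and \<open>1/2\<close>.\<close>
  have 1: "Gh P \<sigma>' - Gh P m + 1/2 * ipC P (Gh' P m) d \<le> Lip * (nC d)\<^sup>2 / 4"
    using Gh_descent[OF K(2) mK] mK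
    unfolding half nC_scale ip_half[OF Gh'_L2[OF mK]] by (simp add: power2_eq_square)
  have 2: "Gh P m - Gh P \<sigma> + 1/2 * ipC P (Gh' P \<sigma>) d \<le> Lip * (nC d)\<^sup>2 / 4"
    using Gh_descent[OF mK K(1)]
    unfolding half nC_scale ip_half[OF Gh'_L2[OF K(1)]] by (simp add: power2_eq_square)
  have 3: "\<bar>ipC P (Gh' P m) d - ipC P (Gh' P \<sigma>') d\<bar> \<le> Lip * (nC d)\<^sup>2 / 2"
    using Gh'_Lipschitz[OF mK K(2) K] unfolding half nC_scale
    by (simp add: power2_eq_square d_def[symmetric] d_def[abs_def, symmetric])
  have 4: "\<bar>ipC P (Gh' P \<sigma>) d - ipC P (Gh' P \<sigma>') d\<bar> \<le> Lip * (nC d)\<^sup>2"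
    using Gh'_Lipschitz[OF K K] by (simp add: power2_eq_square d_def[abs_def, symmetric] mult.assoc)
  have 5: "Lip * (nC d)\<^sup>2 \<le> kap * (gnorm d)\<^sup>2"
    using Lip_nC_le[OF V(4) V(4)] by (simp add: power2_eq_square mult.assoc)
  show ?thesis
    unfolding d_def[abs_def, symmetric] using 1 2 3 4 5 by linarith
qed

text \<open>Compare \<open>\<sigma>'\<close> with the segment towards \<open>\<tau>\<close>. The
  descent inequality bounds the change of \<open>Gh\<close> by its linear part plus a multiple of
  \<open>t^2\<close>; the other terms of the Lagrangian are polynomials of degree two in
  \<open>t\<close>.\<close>

lemma sigma_optimality:
  assumes opt: "is_arg_min (\<lambda>\<tau>. Lagr P \<alpha> \<beta> \<tau> s y) (\<lambda>\<tau>. \<tau> \<in> Kh P) \<sigma>'"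
    and K: "s \<in> Kh P" "\<tau> \<in> Kh P" and y: "y \<in> L2 (muC P)"
  shows "0 \<le> ipC P (Gh' P \<sigma>') (\<lambda>x. \<tau> x - \<sigma>' x) - ipC P y (\<lambda>x. \<tau> x - \<sigma>' x)
    - \<beta> * gip (\<lambda>x. s x - \<sigma>' x) (\<lambda>x. \<tau> x - \<sigma>' x)"
proof -
  have \<sigma>': "\<sigma>' \<in> Kh P" and le: "\<And>\<rho>. \<rho> \<in> Kh P \<Longrightarrow> Lagr P \<alpha> \<beta> \<sigma>' s y \<le> Lagr P \<alpha> \<beta> \<rho> s y"
    using opt by (auto simp: is_arg_min_def not_less)
  have V: "\<sigma>' \<in> Vh P" "s \<in> Vh P" "\<tau> \<in> Vh P"
    using K \<sigma>' by (auto simp: Kh_Vh)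
  define d where "d x = \<tau> x - \<sigma>' x" for x
  have dV: "d \<in> Vh P"
    using V by (simp add: d_def[abs_def])
  show ?thesis
  proof (rule linear_part_nonneg[where B = "Lip * (nC d)\<^sup>2 + \<beta> / 2 * gip d d"])
    fix t :: real assume t: "0 < t" "t \<le> 1"
    define \<rho> where "\<rho> x = (1 - t) * \<sigma>' x + t * \<tau> x" for x
    have \<rho>K: "\<rho> \<in> Kh P"
      unfolding \<rho>_def[abs_def] by (rule Kh_convex) (use \<sigma>' K t in auto)
    have \<rho>eq: "\<rho> = (\<lambda>x. 1 * \<sigma>' x + t * d x)"
      by (auto simp: \<rho>_def d_def algebra_simps)
    have diff: "(\<lambda>x. \<rho> x - \<sigma>' x) = (\<lambda>x. t * d x)"
      by (auto simp: \<rho>eq)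
    have td: "ipC P f (\<lambda>x. t * d x) = t * ipC P f d" if "f \<in> L2 (muC P)" for f
      using ipC_lincomb_right[OF that, of d d t 0] dV by simp
    have G: "Gh P \<rho> - Gh P \<sigma>' \<le> t * ipC P (Gh' P \<sigma>') d + Lip * t\<^sup>2 * (nC d)\<^sup>2"
      using Gh_descent[OF \<rho>K \<sigma>'] unfolding diff nC_scale td[OF Gh'_L2[OF \<sigma>']]
      by (simp add: power_mult_distrib mult.assoc)
    have \<rho>V: "\<rho> \<in> Vh P"
      using \<rho>K by (rule Kh_Vh)
    have "ipC P y \<rho> = ipC P y \<sigma>' + t * ipC P y d"
      unfolding \<rho>eq using ipC_lincomb_right[OF y Vh_L2[OF V(1)] Vh_L2[OF dV], of 1 t] by (simp only: mult_1)
    then have I: "ipC P y (\<lambda>x. s x - \<rho> x) = ipC P y (\<lambda>x. s x - \<sigma>' x) - t * ipC P y d"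
      using V y \<rho>V by (simp add: ipC_diff_right)
    have R: "gip \<rho> w = gip \<sigma>' w + t * gip d w" "gip w \<rho> = gip w \<sigma>' + t * gip w d" if "w \<in> Vh P" for w
      unfolding \<rho>eq
      using gip_lincomb_left[OF V(1) dV that, of 1 t] gip_lincomb_right[OF V(1) dV that, of 1 t]
      by (simp_all only: mult_1)
    have Q: "gip (\<lambda>x. s x - \<rho> x) (\<lambda>x. s x - \<rho> x) = gip (\<lambda>x. s x - \<sigma>' x) (\<lambda>x. s x - \<sigma>' x)
        - 2 * t * gip (\<lambda>x. s x - \<sigma>' x) d + t\<^sup>2 * gip d d"
      using V dV \<rho>V
      by (simp add: R gip_commute[of s \<sigma>'] gip_commute[of d s] gip_commute[of d \<sigma>'] power2_eq_square algebra_simps)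
    have "0 \<le> Lagr P \<alpha> \<beta> \<rho> s y - Lagr P \<alpha> \<beta> \<sigma>' s y"
      using le[OF \<rho>K] by simp
    also have "\<dots> = Gh P \<rho> - Gh P \<sigma>' - t * ipC P y d - \<beta> * t * gip (\<lambda>x. s x - \<sigma>' x) d + \<beta> / 2 * (t\<^sup>2 * gip d d)"
      unfolding Lagr_eq[OF Kh_Vh[OF \<rho>K] V(2)] Lagr_eq[OF V(1,2)] I Q by (simp add: algebra_simps)
    also have "\<dots> \<le> t * (ipC P (Gh' P \<sigma>') d - ipC P y d - \<beta> * gip (\<lambda>x. s x - \<sigma>' x) d)
        + t\<^sup>2 * (Lip * (nC d)\<^sup>2 + \<beta> / 2 * gip d d)"
      using G by (simp add: algebra_simps)
    finally show "0 \<le> t * (ipC P (Gh' P \<sigma>') (\<lambda>x. \<tau> x - \<sigma>' x) - ipC P y (\<lambda>x. \<tau> x - \<sigma>' x)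
        - \<beta> * gip (\<lambda>x. s x - \<sigma>' x) (\<lambda>x. \<tau> x - \<sigma>' x)) + t\<^sup>2 * (Lip * (nC d)\<^sup>2 + \<beta> / 2 * gip d d)"
      by (simp only: d_def[abs_def])
  qed
qed

text \<open>The total variation term need not be differentiable. Convexity bounds its change along
  the segment linearly, so it survives as a difference of values, while pairing and penalty are
  linearised.\<close>

lemma s_optimality:
  assumes opt: "is_arg_min (\<lambda>u. Lagr P \<alpha> \<beta> \<sigma> u y) (\<lambda>u. u \<in> Kh P) s'"
    and K: "\<sigma> \<in> Kh P" "u \<in> Kh P" and y: "y \<in> L2 (muC P)" and \<alpha>: "\<alpha> \<ge> 0"
  shows "0 \<le> \<alpha> * grad_L1 P u - \<alpha> * grad_L1 P s' + ipC P y (\<lambda>x. u x - s' x)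
    + \<beta> * gip (\<lambda>x. s' x - \<sigma> x) (\<lambda>x. u x - s' x)"
proof -
  have s': "s' \<in> Kh P" and le: "\<And>\<rho>. \<rho> \<in> Kh P \<Longrightarrow> Lagr P \<alpha> \<beta> \<sigma> s' y \<le> Lagr P \<alpha> \<beta> \<sigma> \<rho> y"
    using opt by (auto simp: is_arg_min_def not_less)
  have V: "\<sigma> \<in> Vh P" "s' \<in> Vh P" "u \<in> Vh P"
    using K s' by (auto simp: Kh_Vh)
  define d where "d x = u x - s' x" for x
  have dV: "d \<in> Vh P"
    using V by (simp add: d_def[abs_def])
  show ?thesis
  proof (rule linear_part_nonneg[where B = "\<beta> / 2 * gip d d"])
    fix t :: real assume t: "0 < t" "t \<le> 1"
    define \<rho> where "\<rho> x = (1 - t) * s' x + t * u x" for x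
    have \<rho>K: "\<rho> \<in> Kh P"
      unfolding \<rho>_def[abs_def] by (rule Kh_convex) (use s' K t in auto)
    have \<rho>eq: "\<rho> = (\<lambda>x. 1 * s' x + t * d x)"
      by (auto simp: \<rho>_def d_def algebra_simps)
    have "\<alpha> * grad_L1 P \<rho> \<le> \<alpha> * ((1 - t) * grad_L1 P s' + t * grad_L1 P u)"
      unfolding \<rho>_def[abs_def] using V t \<alpha> by (intro mult_left_mono grad_L1_convex) auto
    then have G: "\<alpha> * grad_L1 P \<rho> - \<alpha> * grad_L1 P s' \<le> t * (\<alpha> * grad_L1 P u - \<alpha> * grad_L1 P s')"
      by (simp add: algebra_simps)
    have \<rho>V: "\<rho> \<in> Vh P"
      using \<rho>K by (rule Kh_Vh)
    have "ipC P y \<rho> = ipC P y s' + t * ipC P y d"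
      unfolding \<rho>eq using ipC_lincomb_right[OF y Vh_L2[OF V(2)] Vh_L2[OF dV], of 1 t] by (simp only: mult_1)
    then have I: "ipC P y (\<lambda>x. \<rho> x - \<sigma> x) = ipC P y (\<lambda>x. s' x - \<sigma> x) + t * ipC P y d"
      using V y \<rho>V by (simp add: ipC_diff_right)
    have R: "gip \<rho> w = gip s' w + t * gip d w" "gip w \<rho> = gip w s' + t * gip w d" if "w \<in> Vh P" for w
      unfolding \<rho>eq
      using gip_lincomb_left[OF V(2) dV that, of 1 t] gip_lincomb_right[OF V(2) dV that, of 1 t]
      by (simp_all only: mult_1)
    have Q: "gip (\<lambda>x. \<rho> x - \<sigma> x) (\<lambda>x. \<rho> x - \<sigma> x) = gip (\<lambda>x. s' x - \<sigma> x) (\<lambda>x. s' x - \<sigma> x)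
        + 2 * t * gip (\<lambda>x. s' x - \<sigma> x) d + t\<^sup>2 * gip d d"
      using V dV \<rho>V
      by (simp add: R gip_commute[of \<sigma> s'] gip_commute[of d s'] gip_commute[of d \<sigma>] power2_eq_square algebra_simps)
    have "0 \<le> Lagr P \<alpha> \<beta> \<sigma> \<rho> y - Lagr P \<alpha> \<beta> \<sigma> s' y"
      using le[OF \<rho>K] by simp
    also have "\<dots> = \<alpha> * grad_L1 P \<rho> - \<alpha> * grad_L1 P s' + t * ipC P y d + \<beta> * t * gip (\<lambda>x. s' x - \<sigma> x) d + \<beta> / 2 * (t\<^sup>2 * gip d d)"
      unfolding Lagr_eq[OF V(1) Kh_Vh[OF \<rho>K]] Lagr_eq[OF V(1,2)] I Q by (simp add: algebra_simps)
    also have "\<dots> \<le> t * (\<alpha> * grad_L1 P u - \<alpha> * grad_L1 P s' + ipC P y d + \<beta> * gip (\<lambda>x. s' x - \<sigma> x) d)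
        + t\<^sup>2 * (\<beta> / 2 * gip d d)"
      using G by (simp add: algebra_simps)
    finally show "0 \<le> t * (\<alpha> * grad_L1 P u - \<alpha> * grad_L1 P s' + ipC P y (\<lambda>x. u x - s' x)
        + \<beta> * gip (\<lambda>x. s' x - \<sigma> x) (\<lambda>x. u x - s' x)) + t\<^sup>2 * (\<beta> / 2 * gip d d)"
      by (simp only: d_def[abs_def])
  qed
qed

text \<open>From \<open>\<beta> > 4 * \<kappa>\<close> comes \<open>Z \<le> D / 4\<close>, and then
  \<open>2 - 5/4 - 1/4 = 1/2\<close> remains as the coefficient of \<open>\<kappa> * D^2\<close>.
  The left side is thus at least \<open>\<kappa> * (D^2 / 2 - D * S + 2 * S^2)\<close>, which is the
  square \<open>\<kappa> * (D / 2 - S)^2\<close> plus the claimed amount.\<close>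

lemma descent_arithmetic:
  fixes \<beta> \<kappa> D S Z :: real
  assumes "\<kappa> > 0" "\<beta> > 4 * \<kappa>" "0 \<le> D" "0 \<le> S" "0 \<le> Z" "\<beta> * Z \<le> \<kappa> * D"
  shows "\<beta> / 2 * D\<^sup>2 - 5/4 * \<kappa> * D\<^sup>2 + \<beta> / 2 * S\<^sup>2 - \<kappa> * D * (S + Z) \<ge> \<kappa> * (D\<^sup>2 / 4 + S\<^sup>2)"
proof -
  have "4 * \<kappa> * Z \<le> \<beta> * Z"
    using assms by (intro mult_right_mono) auto
  then have "\<kappa> * (4 * Z) \<le> \<kappa> * D"
    using assms(6) by (simp only: mult.assoc mult.left_commute[of 4])
  then have "4 * Z \<le> D"
    using assms(1) by (rule mult_left_le_imp_le)
  then have "Z \<le> D / 4"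
    by simp
  then have "\<kappa> * D * Z \<le> \<kappa> * D * (D / 4)"
    using assms by (intro mult_left_mono) auto
  moreover have "2 * \<kappa> * D\<^sup>2 \<le> \<beta> / 2 * D\<^sup>2" "2 * \<kappa> * S\<^sup>2 \<le> \<beta> / 2 * S\<^sup>2"
    using assms(2) mult_right_mono[of "2 * \<kappa>" "\<beta> / 2" "D\<^sup>2"] mult_right_mono[of "2 * \<kappa>" "\<beta> / 2" "S\<^sup>2"]
    by auto
  moreover have "0 \<le> \<kappa> * (D / 2 - S)\<^sup>2"
    using assms by simp
  ultimately show ?thesis
    by (simp add: power2_eq_square algebra_simps)
qed

lemma ADMM_step:
  assumes K: "\<sigma> \<in> Kh P" "s \<in> Kh P" and \<alpha>: "\<alpha> \<ge> 0" and \<beta>: "\<beta> > 4 * kap"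
    and opt\<sigma>: "is_arg_min (\<lambda>\<tau>. Lagr P \<alpha> \<beta> \<tau> s (Gh' P \<sigma>)) (\<lambda>\<tau>. \<tau> \<in> Kh P) \<sigma>'"
    and opts: "is_arg_min (\<lambda>u. Lagr P \<alpha> \<beta> \<sigma>' u (Gh' P \<sigma>)) (\<lambda>u. u \<in> Kh P) s'"
  shows "4 * gnorm (\<lambda>x. s x - \<sigma>' x) \<le> gnorm (\<lambda>x. \<sigma> x - \<sigma>' x)"
    and "Lagr P \<alpha> \<beta> \<sigma> s (Gh' P \<sigma>) - Lagr P \<alpha> \<beta> \<sigma>' s' (Gh' P \<sigma>') \<ge>
      kap * ((gnorm (\<lambda>x. \<sigma> x - \<sigma>' x))\<^sup>2 / 4 + (gnorm (\<lambda>x. s x - s' x))\<^sup>2)"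
proof -
  have K': "\<sigma>' \<in> Kh P" "s' \<in> Kh P"
    using opt\<sigma> opts by (auto simp: is_arg_min_def)
  have V: "\<sigma> \<in> Vh P" "s \<in> Vh P" "\<sigma>' \<in> Vh P" "s' \<in> Vh P"
    using K K' by (auto simp: Kh_Vh)
  note L2 = Gh'_L2[OF K(1)] Gh'_L2[OF K'(1)]
  define D where "D = gnorm (\<lambda>x. \<sigma> x - \<sigma>' x)"
  define S where "S = gnorm (\<lambda>x. s x - s' x)"
  define Z where "Z = gnorm (\<lambda>x. s x - \<sigma>' x)"
  have nonneg: "0 \<le> D" "0 \<le> S" "0 \<le> Z"
    by (simp_all add: D_def S_def Z_def)
  have D': "gnorm (\<lambda>x. \<sigma>' x - \<sigma> x) = D"
    using gnorm_commute V by (simp add: D_def)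
  \<comment> \<open>The test function is \<open>s\<close> itself; since the multiplier is
    \<open>Gh' \<sigma>\<close>, the pairings form a difference of two gradients.\<close>
  have "\<beta> * Z\<^sup>2 \<le> ipC P (Gh' P \<sigma>') (\<lambda>x. s x - \<sigma>' x) - ipC P (Gh' P \<sigma>) (\<lambda>x. s x - \<sigma>' x)"
    using sigma_optimality[OF opt\<sigma> K(2) K(2) L2(1)] unfolding Z_def gnorm_power2 by simp
  also have "\<dots> \<le> kap * D * Z"
    using Gh'_Lipschitz_gnorm[OF K'(1) K(1) K(2) K'(1)] unfolding D' Z_def by linarith
  finally have "\<beta> * Z * Z \<le> kap * D * Z"
    by (simp add: power2_eq_square mult.assoc)
  then have \<beta>Z: "\<beta> * Z \<le> kap * D"
  proof (cases "Z = 0")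
    case True
    then show ?thesis
      using nonneg(1) kap_pos by simp
  next
    case False
    then have "0 < Z"
      using nonneg(3) by simp
    with \<open>\<beta> * Z * Z \<le> kap * D * Z\<close> show ?thesis
      by (rule mult_right_le_imp_le)
  qed
  have "4 * kap * Z \<le> \<beta> * Z"
    using \<beta> nonneg by (intro mult_right_mono) auto
  then have "kap * (4 * Z) \<le> kap * D"
    using \<beta>Z by simp
  then show "4 * gnorm (\<lambda>x. s x - \<sigma>' x) \<le> gnorm (\<lambda>x. \<sigma> x - \<sigma>' x)"
    using kap_pos by (simp add: Z_def D_def)
  \<comment> \<open>Optimality tested with \<open>s\<close> takes care of the linear part around
    \<open>s'\<close>; the quadratic penalty adds exactly \<open>\<beta> / 2 * S^2\<close>.\<close>
  have sstep: "\<beta> / 2 * S\<^sup>2 \<le> Lagr P \<alpha> \<beta> \<sigma>' s (Gh' P \<sigma>) - Lagr P \<alpha> \<beta> \<sigma>' s' (Gh' P \<sigma>)"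
    using s_optimality[OF opts K'(1) K(2) L2(1) \<alpha>] V L2
    unfolding Lagr_eq[OF V(3,2)] Lagr_eq[OF V(3,4)] S_def gnorm_power2
    by (simp add: ipC_diff_right gip_commute[of s \<sigma>'] gip_commute[of s' \<sigma>'] gip_commute[of s' s] algebra_simps)
  \<comment> \<open>Expanding the penalty around \<open>\<sigma>'\<close> yields
    \<open>\<beta> / 2 * D^2\<close>. Optimality tested with \<open>\<sigma>\<close> handles the
    mixed term and the multiplier, \<open>Gh_ascent\<close> the change of \<open>Gh\<close>.\<close>
  have \<sigma>step: "\<beta> / 2 * D\<^sup>2 - 5/4 * kap * D\<^sup>2 \<le> Lagr P \<alpha> \<beta> \<sigma> s (Gh' P \<sigma>) - Lagr P \<alpha> \<beta> \<sigma>' s (Gh' P \<sigma>)"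
    using sigma_optimality[OF opt\<sigma> K(2) K(1) L2(1)] Gh_ascent[OF K(1) K'(1)] V L2
    unfolding Lagr_eq[OF V(1,2)] Lagr_eq[OF V(3,2)] D_def[symmetric]
    unfolding D_def gnorm_power2
    by (simp add: ipC_diff_right gip_commute[of s \<sigma>'] gip_commute[of s \<sigma>] gip_commute[of \<sigma>' \<sigma>] algebra_simps)
  have "gnorm (\<lambda>x. s' x - \<sigma>' x) \<le> S + Z"
    using gnorm_triangle[OF V(4,2,3)] gnorm_commute[OF V(4,2)] by (simp add: S_def Z_def)
  then have "kap * D * gnorm (\<lambda>x. s' x - \<sigma>' x) \<le> kap * D * (S + Z)"
    using kap_pos nonneg by (intro mult_left_mono) auto
  \<comment> \<open>Only the pairing with the multiplier changes, and it acts on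
    \<open>s' - \<sigma>'\<close>, whose gradient norm is at most \<open>S + Z\<close>.\<close>
  then have ystep: "Lagr P \<alpha> \<beta> \<sigma>' s' (Gh' P \<sigma>') - Lagr P \<alpha> \<beta> \<sigma>' s' (Gh' P \<sigma>) \<le> kap * D * (S + Z)"
    using Gh'_Lipschitz_gnorm[OF K'(1) K(1) K'(2) K'(1)] unfolding D' Lagr_def by linarith
  show "Lagr P \<alpha> \<beta> \<sigma> s (Gh' P \<sigma>) - Lagr P \<alpha> \<beta> \<sigma>' s' (Gh' P \<sigma>') \<ge>
      kap * ((gnorm (\<lambda>x. \<sigma> x - \<sigma>' x))\<^sup>2 / 4 + (gnorm (\<lambda>x. s x - s' x))\<^sup>2)"
    using descent_arithmetic[OF kap_pos \<beta> nonneg \<beta>Z] sstep \<sigma>step ystep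
    unfolding D_def[symmetric] S_def[symmetric] by linarith
qed

text \<open>The descent inequality gives
  \<open>Gh s \<le> Gh \<sigma> + (Gh' \<sigma>, s - \<sigma>)\<close> up to a term that the penalty
  absorbs, so the Lagrangian is at least \<open>Gh s\<close> plus the total variation term.\<close>

lemma Lagr_nonneg:
  assumes K: "\<sigma> \<in> Kh P" "s \<in> Kh P" and \<alpha>: "\<alpha> \<ge> 0" and \<beta>: "\<beta> > 4 * kap"
  shows "0 \<le> Lagr P \<alpha> \<beta> \<sigma> s (Gh' P \<sigma>)"
proof -
  let ?d = "\<lambda>x. s x - \<sigma> x"
  have V: "\<sigma> \<in> Vh P" "s \<in> Vh P"
    using K by (auto simp: Kh_Vh)
  have "Lip * (nC ?d)\<^sup>2 \<le> kap * gip ?d ?d"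
    using Lip_nC_le[of ?d ?d] V by (simp add: gnorm_power2[symmetric] power2_eq_square mult.assoc)
  moreover have "kap * gip ?d ?d \<le> \<beta> / 2 * gip ?d ?d"
    using \<beta> kap_pos by (intro mult_right_mono gip_self_nonneg) linarith
  moreover have "0 \<le> \<alpha> * grad_L1 P s"
    using \<alpha> grad_L1_nonneg by simp
  ultimately show ?thesis
    unfolding Lagr_eq[OF V] using Gh_descent[OF K(2,1)] Gh_nonneg[of s] by linarith
qed

end

section \<open>Convergence of the iteration\<close>

context eddy_setting
begin

text \<open>Values at the basis nodes are bounded, so along a subsequence the coefficients converge,
  and with them the functions at every point. The limit is a combination of functions in
  \<open>Wh\<close>, which settles variation and support; the bounds pass to the limit.\<close>

lemma Kh_limit:
  assumes K: "\<And>j. \<sigma> j \<in> Kh P"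
  shows "\<exists>r t. strict_mono (r :: nat \<Rightarrow> nat) \<and> t \<in> Kh P \<and> (\<forall>x. (\<lambda>j. \<sigma> (r j) x) \<longlonglongrightarrow> t x) \<and>
    (\<lambda>j. gnorm (\<lambda>x. \<sigma> (r j) x - t x)) \<longlonglongrightarrow> 0"
proof -
  obtain Y e where Y: "finite Y" "\<And>y. y \<in> Y \<Longrightarrow> e y \<in> Wh"
    "\<And>v. v \<in> Wh \<Longrightarrow> v = (\<lambda>x. \<Sum>y\<in>Y. v y * e y x)"
    by (rule Wh_basis) (rule that)
  have W: "\<sigma> j \<in> Wh" for j
    using K by (simp add: Kh_Wh)
  have "bounded (range (\<lambda>j. \<sigma> j y))" for y
    using Kh_bound[OF K] by (auto simp: bounded_iff)
  then obtain r l where r: "strict_mono (r :: nat \<Rightarrow> nat)" "\<forall>y\<in>Y. (\<lambda>j. \<sigma> (r j) y) \<longlonglongrightarrow> l y"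
    using convergent_coordinates_subseq[OF Y(1), of \<sigma>] by blast
  have comb: "(\<lambda>x. \<Sum>y\<in>Y. c y * e y x) \<in> Wh \<and> (\<forall>\<phi> :: (R3 \<Rightarrow> real) \<Rightarrow> real.
      (\<forall>f\<in>Wh. \<forall>g\<in>Wh. \<forall>a b. \<phi> (\<lambda>x. a * f x + b * g x) = a * \<phi> f + b * \<phi> g) \<longrightarrow>
      \<phi> (\<lambda>x. \<Sum>y\<in>Y. c y * e y x) = (\<Sum>y\<in>Y. c y * \<phi> (e y)))" for c
    by (rule linear_combination_sum[where sm = "(*)" and S = Wh and e = e, OF _ _ Wh_lincomb W[of 0] Y(1,2)])
      simp_all
  define t where "t x = (\<Sum>y\<in>Y. l y * e y x)" for x
  have tW: "t \<in> Wh"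
    unfolding t_def[abs_def] using comb by blast
  have lim: "(\<lambda>j. \<sigma> (r j) x) \<longlonglongrightarrow> t x" for x
  proof -
    have "(\<lambda>j. \<Sum>y\<in>Y. \<sigma> (r j) y * e y x) \<longlonglongrightarrow> t x"
      unfolding t_def using r(2) by (intro tendsto_intros) auto
    moreover have "(\<Sum>y\<in>Y. \<sigma> (r j) y * e y x) = \<sigma> (r j) x" for j
      by (rule fun_cong[OF Y(3)[OF W], symmetric])
    ultimately show ?thesis
      by simp
  qed
  have "AE x in muC P. \<forall>j. m0 P \<le> \<sigma> (r j) x \<and> \<sigma> (r j) x \<le> m1 P"
    using K by (subst AE_all_countable) (simp add: Kh_Wh)
  then have "AE x in muC P. m0 P \<le> t x \<and> t x \<le> m1 P"
  proof eventually_elim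
    case (elim x)
    then show ?case
      using LIMSEQ_le_const[OF lim[of x]] LIMSEQ_le_const2[OF lim[of x]] by blast
  qed
  then have tK: "t \<in> Kh P"
    using tW by (simp add: Kh_Wh)
  have WV: "v \<in> Vh P" if "v \<in> Wh" for v
    using that by (simp add: Wh_def)
  \<comment> \<open>Expansion in the Gram matrix of the basis: a fixed quadratic form in
    coefficients that tend to zero.\<close>
  have "(gnorm (\<lambda>x. \<sigma> (r j) x - t x))\<^sup>2 =
      (\<Sum>y\<in>Y. (\<sigma> (r j) y - l y) * (\<Sum>z\<in>Y. (\<sigma> (r j) z - l z) * gip (e y) (e z)))" for j
  proof -
    define c where "c y = \<sigma> (r j) y - l y" for y
    define v where "v x = (\<Sum>y\<in>Y. c y * e y x)" for x
    have "(\<lambda>x. \<sigma> (r j) x - t x) = v"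
    proof
      fix x
      have "(\<Sum>y\<in>Y. \<sigma> (r j) y * e y x) = \<sigma> (r j) x"
        by (rule fun_cong[OF Y(3)[OF W], symmetric])
      then show "\<sigma> (r j) x - t x = v x"
        by (simp add: v_def c_def t_def left_diff_distrib sum_subtractf)
    qed
    moreover have vW: "v \<in> Wh"
      unfolding v_def[abs_def] using comb by blast
    moreover have left: "gip v w = (\<Sum>y\<in>Y. c y * gip (e y) w)" if "w \<in> Wh" for w
      unfolding v_def[abs_def] using WV that
      by (intro comb[THEN conjunct2, rule_format, where \<phi> = "\<lambda>u. gip u w"]) simp
    ultimately have "(gnorm (\<lambda>x. \<sigma> (r j) x - t x))\<^sup>2 = (\<Sum>y\<in>Y. c y * gip (e y) v)"
      by (simp add: gnorm_power2)
    also have "\<dots> = (\<Sum>y\<in>Y. c y * (\<Sum>z\<in>Y. c z * gip (e y) (e z)))"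
    proof (rule sum.cong[OF refl])
      fix y assume y: "y \<in> Y"
      have "gip (e y) v = (\<Sum>z\<in>Y. c z * gip (e z) (e y))"
        using left[OF Y(2)[OF y]] by (simp add: gip_commute)
      then show "c y * gip (e y) v = c y * (\<Sum>z\<in>Y. c z * gip (e y) (e z))"
        by (simp add: gip_commute[of "e y"])
    qed
    finally show ?thesis
      by (simp add: c_def)
  qed
  moreover have "(\<lambda>j. \<Sum>y\<in>Y. (\<sigma> (r j) y - l y) * (\<Sum>z\<in>Y. (\<sigma> (r j) z - l z) * gip (e y) (e z)))
      \<longlonglongrightarrow> (\<Sum>y\<in>Y. (l y - l y) * (\<Sum>z\<in>Y. (l z - l z) * gip (e y) (e z)))"
    using r(2) by (intro tendsto_intros) auto
  ultimately have "(\<lambda>j. (gnorm (\<lambda>x. \<sigma> (r j) x - t x))\<^sup>2) \<longlonglongrightarrow> 0"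
    by simp
  from tendsto_real_sqrt[OF this] have "(\<lambda>j. gnorm (\<lambda>x. \<sigma> (r j) x - t x)) \<longlonglongrightarrow> 0"
    by simp
  then show ?thesis
    using r(1) tK lim by blast
qed

text \<open>Two extractions are made: the adjoint right-hand side contains the state, so the states
  must converge first. Uniqueness identifies both limits. A subsequence is enough to identify an
  \<open>L2\<close> limit later.\<close>

lemma Gh'_limit:
  assumes \<sigma>: "\<And>j. \<sigma> j \<in> Kh P" and t: "t \<in> Kh P" and lim: "\<And>x. (\<lambda>j. \<sigma> j x) \<longlonglongrightarrow> t x"
  shows "\<exists>r. strict_mono (r :: nat \<Rightarrow> nat) \<and> (\<forall>x. (\<lambda>j. Gh' P (\<sigma> (r j)) x) \<longlonglongrightarrow> Gh' P t x)"
proof -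
  obtain p where p: "\<And>j. solves (\<sigma> j) state_rhs (Eh P (\<sigma> j)) (p j)"
    using Eh_solves[OF \<sigma>] by metis
  obtain r1 E' p' where r1: "strict_mono r1" "solves t state_rhs E' p'"
    "\<And>x. (\<lambda>j. Eh P (\<sigma> (r1 j)) x) \<longlonglongrightarrow> E' x"
    using solves_limit[OF \<sigma> t lim p, of state_rhs] by auto
  have E': "E' = Eh P t"
    using Eh_solves[OF t] solves_unique(1)[OF t r1(2)] by blast
  have \<sigma>1: "\<sigma> (r1 j) \<in> Kh P" and lim1: "(\<lambda>j. \<sigma> (r1 j) x) \<longlonglongrightarrow> t x" for j x
    using \<sigma> LIMSEQ_subseq_LIMSEQ[OF lim r1(1)] by (auto simp: o_def)
  obtain q where q: "\<And>j. solves (\<sigma> (r1 j)) (adjoint_rhs (Eh P (\<sigma> (r1 j)))) (Fh P (\<sigma> (r1 j))) (q j)"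
    using Fh_solves[OF \<sigma>1] by metis
  have R: "(\<lambda>j. adjoint_rhs (Eh P (\<sigma> (r1 j))) F) \<longlonglongrightarrow> adjoint_rhs (Eh P t) F" if "F \<in> Rh P" for F
    using r1(3) that \<sigma>1 t by (intro adjoint_rhs_limit Eh_Rh) (simp_all add: E')
  obtain r2 F' q' where r2: "strict_mono r2" "solves t (adjoint_rhs (Eh P t)) F' q'"
    "\<And>x. (\<lambda>j. Fh P (\<sigma> (r1 (r2 j))) x) \<longlonglongrightarrow> F' x"
    using solves_limit[OF \<sigma>1 t lim1 q R] by auto
  have F': "F' = Fh P t"
    using Fh_solves[OF t] solves_unique(1)[OF t r2(2)] by blast
  have "(\<lambda>j. Gh' P (\<sigma> (r1 (r2 j))) x) \<longlonglongrightarrow> Gh' P t x" for x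
  proof -
    have "(\<lambda>j. Eh P (\<sigma> (r1 (r2 j))) x) \<longlonglongrightarrow> Eh P t x"
      using LIMSEQ_subseq_LIMSEQ[OF r1(3) r2(1)] by (simp add: E' o_def)
    then have "(\<lambda>j. cdot (Eh P (\<sigma> (r1 (r2 j))) x) (Fh P (\<sigma> (r1 (r2 j))) x)) \<longlonglongrightarrow> cdot (Eh P t x) (Fh P t x)"
      using r2(3)[of x] by (intro bounded_bilinear.tendsto[OF bounded_bilinear_cdot]) (simp_all add: F')
    then show ?thesis
      unfolding Gh'_def by (intro tendsto_intros)
  qed
  then show ?thesis
    using strict_mono_o[OF r1(1) r2(1)] by (intro exI[of _ "r1 \<circ> r2"]) (simp add: o_def)
qed

text \<open>The squared differences tend to zero in \<open>L1\<close>, hence almost everywhere along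
  a subsequence.\<close>

lemma L2_limit_pointwise_unique:
  fixes f :: "nat \<Rightarrow> R3 \<Rightarrow> real"
  assumes f: "\<And>j. f j \<in> L2 (muC P)" and h: "h \<in> L2 (muC P)"
    and L2: "(\<lambda>j. L2norm (muC P) (\<lambda>x. f j x - h x)) \<longlonglongrightarrow> 0"
    and pw: "\<And>x. (\<lambda>j. f j x) \<longlonglongrightarrow> g x"
  shows "AE x in muC P. h x = g x"
proof -
  let ?u = "\<lambda>j x. (f j x - h x)\<^sup>2"
  have int: "integrable (muC P) (?u j)" for j
    using L2_diff[OF f h, of j] by (simp add: L2_def)
  have "(\<lambda>j. (L2norm (muC P) (\<lambda>x. f j x - h x))\<^sup>2) \<longlonglongrightarrow> 0\<^sup>2"
    using L2 by (intro tendsto_intros)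
  then have "(\<lambda>j. LINT x|muC P. norm (?u j x)) \<longlonglongrightarrow> 0"
    by (simp add: L2norm_def)
  from tendsto_L1_AE_subseq[OF int this]
  obtain r where r: "strict_mono r" "AE x in muC P. (\<lambda>j. ?u (r j) x) \<longlonglongrightarrow> 0"
    by auto
  show ?thesis
    using r(2)
  proof eventually_elim
    case (elim x)
    have "(\<lambda>j. ?u (r j) x) \<longlonglongrightarrow> (g x - h x)\<^sup>2"
      using LIMSEQ_subseq_LIMSEQ[OF pw r(1)] by (intro tendsto_intros) (simp add: o_def)
    then have "(g x - h x)\<^sup>2 = 0"
      using elim by (rule LIMSEQ_unique)
    then show ?case
      by simp
  qed
qed

text \<open>Cauchy-Schwarz against the constant 1; \<open>C\<close> is the square root of the
  volume. This makes the total variation term continuous in \<open>gnorm\<close>.\<close>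

lemma grad_L1_le_gnorm:
  obtains C where "0 \<le> C" "\<And>v. v \<in> Vh P \<Longrightarrow> grad_L1 P v \<le> C * gnorm v"
proof
  show "0 \<le> L2norm (muC P) (\<lambda>x. 1 :: real)"
    by simp
  fix v assume v: "v \<in> Vh P"
  have 1: "(\<lambda>x. norm (grad v x)) \<in> L2 (muC P)"
    using Vh_grad_L2[OF v] measurable_compose[OF L2_measurable borel_measurable_norm]
    by (auto simp: L2_def)
  have 2: "(\<lambda>x. 1 :: real) \<in> L2 (muC P)"
    by (rule Linf_L2[OF fin_OmC Linf_const])
  show "grad_L1 P v \<le> L2norm (muC P) (\<lambda>x. 1 :: real) * gnorm v"
    using L2_Cauchy_Schwarz[OF 1 2] by (simp add: grad_L1_def gnorm_def L2norm_def mult.commute)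
qed

end

lemma (in eddy_gradient_bound) nC_tendsto_zero:
  assumes "\<And>j. v j \<in> Vh P" "(\<lambda>j. gnorm (v j)) \<longlonglongrightarrow> 0"
  shows "(\<lambda>j. nC (v j)) \<longlonglongrightarrow> 0"
proof (rule tendsto_sandwich)
  show "(\<lambda>j. 0 :: real) \<longlonglongrightarrow> 0" "(\<lambda>j. Cs * mesh_size P * gnorm (v j)) \<longlonglongrightarrow> 0"
    using tendsto_mult_right_zero[OF assms(2)] by auto
qed (use nC_le_gnorm[OF assms(1)] in auto)

section \<open>Convergence along the iterates and at limit points\<close>

locale eddy_ADMM = eddy_gradient_bound +
  fixes \<alpha> \<beta> :: real and \<sigma> s y :: "nat \<Rightarrow> R3 \<Rightarrow> real"
  assumes \<alpha>: "\<alpha> > 0" and \<beta>: "\<beta> > 4 * kap" and ADMM: "modified_ADMM P \<alpha> \<beta> \<sigma> s y"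
begin

lemma opt\<sigma>: "is_arg_min (\<lambda>\<tau>. Lagr P \<alpha> \<beta> \<tau> (s k) (y k)) (\<lambda>\<tau>. \<tau> \<in> Kh P) (\<sigma> (Suc k))"
  and opts: "is_arg_min (\<lambda>u. Lagr P \<alpha> \<beta> (\<sigma> (Suc k)) u (y k)) (\<lambda>u. u \<in> Kh P) (s (Suc k))"
  and y_Suc: "AE x in muC P. y (Suc k) x = Gh' P (\<sigma> (Suc k)) x"
  using ADMM by (auto simp: modified_ADMM_def)

lemma iterates_Kh [simp]: "\<sigma> k \<in> Kh P" "s k \<in> Kh P"
  using ADMM by (cases k; auto simp: modified_ADMM_def is_arg_min_def)+

lemma iterates_Vh [simp]: "\<sigma> k \<in> Vh P" "s k \<in> Vh P"
  by (simp_all add: Kh_Vh)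

definition Lag :: "nat \<Rightarrow> real" where
  "Lag k = Lagr P \<alpha> \<beta> (\<sigma> k) (s k) (y k)"

text \<open>The multiplier is the gradient only modulo null sets, and it enters \<open>Lagr\<close>
  only under an integral.\<close>

lemma Lagr_y: "AE x in muC P. y k x = Gh' P (\<sigma> k) x \<Longrightarrow> Lagr P \<alpha> \<beta> \<tau> u (y k) = Lagr P \<alpha> \<beta> \<tau> u (Gh' P (\<sigma> k))"
  by (simp add: Lagr_def ipC_cong_AE)

lemma step:
  assumes y: "AE x in muC P. y k x = Gh' P (\<sigma> k) x"
  shows "4 * gnorm (\<lambda>x. s k x - \<sigma> (Suc k) x) \<le> gnorm (\<lambda>x. \<sigma> k x - \<sigma> (Suc k) x)"
    and "Lag k - Lag (Suc k) \<ge>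
      kap * ((gnorm (\<lambda>x. \<sigma> k x - \<sigma> (Suc k) x))\<^sup>2 / 4 + (gnorm (\<lambda>x. s k x - s (Suc k) x))\<^sup>2)"
  unfolding Lag_def Lagr_y[OF y] Lagr_y[OF y_Suc]
  using ADMM_step[OF _ _ _ \<beta> opt\<sigma>[of k, unfolded Lagr_y[OF y]] opts[of k, unfolded Lagr_y[OF y]]] \<alpha> by simp_all

lemma Lag_decrease:
  assumes "AE x in muC P. y k x = Gh' P (\<sigma> k) x"
  shows "Lag (Suc k) \<le> Lag k"
proof -
  have "0 \<le> kap * ((gnorm (\<lambda>x. \<sigma> k x - \<sigma> (Suc k) x))\<^sup>2 / 4 + (gnorm (\<lambda>x. s k x - s (Suc k) x))\<^sup>2)"
    using kap_pos by simp
  then show ?thesis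
    using step(2)[OF assms] by linarith
qed

text \<open>The index starts at 1 because \<open>y 0\<close> is arbitrary, while \<open>step\<close>
  needs the multiplier to be the gradient.\<close>

lemma decseq_Lag_Suc: "decseq (\<lambda>k. Lag (Suc k))"
  unfolding decseq_Suc_iff using Lag_decrease[OF y_Suc] by blast

lemma decseq_Lag: "AE x in muC P. y 0 x = Gh' P (\<sigma> 0) x \<Longrightarrow> decseq Lag"
  unfolding decseq_Suc_iff using Lag_decrease y_Suc by (metis not0_implies_Suc)

lemma Lag_Suc_nonneg: "0 \<le> Lag (Suc k)"
  unfolding Lag_def Lagr_y[OF y_Suc] using \<alpha> \<beta> by (intro Lagr_nonneg) simp_all

lemma Lag_Suc_convergent: "convergent (\<lambda>k. Lag (Suc k))"
  using decseq_convergent[OF decseq_Lag_Suc, of 0] Lag_Suc_nonneg by (metis convergentI)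

lemma Lag_convergent: "convergent Lag"
  using Lag_Suc_convergent convergent_Suc_iff by blast

lemma increments_tendsto_zero:
  shows "(\<lambda>k. gnorm (\<lambda>x. \<sigma> (Suc k) x - \<sigma> (Suc (Suc k)) x)) \<longlonglongrightarrow> 0"
    and "(\<lambda>k. gnorm (\<lambda>x. s (Suc k) x - s (Suc (Suc k)) x)) \<longlonglongrightarrow> 0"
proof -
  obtain l where l: "(\<lambda>k. Lag (Suc k)) \<longlonglongrightarrow> l"
    using Lag_Suc_convergent by (auto simp: convergent_def)
  have diff: "(\<lambda>k. Lag (Suc k) - Lag (Suc (Suc k))) \<longlonglongrightarrow> 0"
    using tendsto_diff[OF l LIMSEQ_Suc[OF l]] by simp
  have *: "(\<lambda>k. a k) \<longlonglongrightarrow> 0" if "\<And>k. 0 \<le> a k" "\<And>k. kap * ((a k)\<^sup>2 / 4) \<le> Lag (Suc k) - Lag (Suc (Suc k))"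
    for a :: "nat \<Rightarrow> real"
  proof -
    have "(\<lambda>k. (a k)\<^sup>2) \<longlonglongrightarrow> 0"
    proof (rule tendsto_sandwich)
      show "(\<lambda>k. 0 :: real) \<longlonglongrightarrow> 0"
        by simp
      show "(\<lambda>k. 4 / kap * (Lag (Suc k) - Lag (Suc (Suc k)))) \<longlonglongrightarrow> 0"
        by (rule tendsto_mult_right_zero[OF diff])
      show "eventually (\<lambda>k. (a k)\<^sup>2 \<le> 4 / kap * (Lag (Suc k) - Lag (Suc (Suc k)))) sequentially"
        using that(2) kap_pos by (auto simp: field_simps)
    qed auto
    from tendsto_real_sqrt[OF this] show ?thesis
      using that(1) by simp
  qed
  show "(\<lambda>k. gnorm (\<lambda>x. \<sigma> (Suc k) x - \<sigma> (Suc (Suc k)) x)) \<longlonglongrightarrow> 0"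
    "(\<lambda>k. gnorm (\<lambda>x. s (Suc k) x - s (Suc (Suc k)) x)) \<longlonglongrightarrow> 0"
  proof (rule_tac [!] *)
    fix k
    let ?a = "(gnorm (\<lambda>x. \<sigma> (Suc k) x - \<sigma> (Suc (Suc k)) x))\<^sup>2"
    let ?b = "(gnorm (\<lambda>x. s (Suc k) x - s (Suc (Suc k)) x))\<^sup>2"
    \<comment> \<open>The \<open>\<sigma>\<close>-increment carries the factor \<open>1/4\<close>;
      weakening the \<open>s\<close>-increment to the same factor lets one argument serve
      both.\<close>
    have "kap * (?a / 4) \<le> kap * (?a / 4 + ?b)" "kap * (?b / 4) \<le> kap * (?a / 4 + ?b)"
      using kap_pos by (auto intro!: mult_left_mono)
    then show "kap * (?a / 4) \<le> Lag (Suc k) - Lag (Suc (Suc k))" "kap * (?b / 4) \<le> Lag (Suc k) - Lag (Suc (Suc k))"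
      using step(2)[OF y_Suc, of k] by linarith+
  qed simp_all
qed

text \<open>Insert the previous \<open>s\<close>: it is close to the new \<open>s\<close> since
  increments vanish, and to the new \<open>\<sigma>\<close> by the first part of
  \<open>step\<close>.\<close>

lemma gap_tendsto_zero: "(\<lambda>k. gnorm (\<lambda>x. s k x - \<sigma> k x)) \<longlonglongrightarrow> 0"
proof -
  let ?D = "\<lambda>k. gnorm (\<lambda>x. \<sigma> (Suc k) x - \<sigma> (Suc (Suc k)) x)"
  let ?S = "\<lambda>k. gnorm (\<lambda>x. s (Suc k) x - s (Suc (Suc k)) x)"
  have "(\<lambda>k. gnorm (\<lambda>x. s (Suc (Suc k)) x - \<sigma> (Suc (Suc k)) x)) \<longlonglongrightarrow> 0"
  proof (rule tendsto_sandwich)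
    show "(\<lambda>k. 0 :: real) \<longlonglongrightarrow> 0" "(\<lambda>k. ?S k + ?D k) \<longlonglongrightarrow> 0"
      using tendsto_add[OF increments_tendsto_zero(2,1)] by auto
    have "gnorm (\<lambda>x. s (Suc (Suc k)) x - \<sigma> (Suc (Suc k)) x) \<le> ?S k + ?D k" for k
    proof -
      have "gnorm (\<lambda>x. s (Suc (Suc k)) x - \<sigma> (Suc (Suc k)) x)
          \<le> gnorm (\<lambda>x. s (Suc (Suc k)) x - s (Suc k) x) + gnorm (\<lambda>x. s (Suc k) x - \<sigma> (Suc (Suc k)) x)"
        by (rule gnorm_triangle) simp_all
      moreover have "gnorm (\<lambda>x. s (Suc (Suc k)) x - s (Suc k) x) = ?S k"
        by (rule gnorm_commute) simp_all
      moreover have "gnorm (\<lambda>x. s (Suc k) x - \<sigma> (Suc (Suc k)) x) \<le> ?D k"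
        using step(1)[OF y_Suc, of k] gnorm_nonneg[of "\<lambda>x. s (Suc k) x - \<sigma> (Suc (Suc k)) x"] by linarith
      ultimately show ?thesis
        by linarith
    qed
    then show "eventually (\<lambda>k. gnorm (\<lambda>x. s (Suc (Suc k)) x - \<sigma> (Suc (Suc k)) x) \<le> ?S k + ?D k) sequentially"
      by simp
  qed simp
  then show ?thesis
    by (simp only: filterlim_sequentially_Suc[of "\<lambda>k. gnorm (\<lambda>x. s k x - \<sigma> k x)"]
        filterlim_sequentially_Suc[of "\<lambda>k. gnorm (\<lambda>x. s (Suc k) x - \<sigma> (Suc k) x)"])
qed

lemma constraint_tendsto_zero: "(\<lambda>k. nC (\<lambda>x. s k x - \<sigma> k x)) \<longlonglongrightarrow> 0"
  by (rule nC_tendsto_zero[OF _ gap_tendsto_zero]) simp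

text \<open>Pass to the limit in the optimality condition of the \<open>s\<close>-step. Its
  multiplier is the gradient at the previous \<open>\<sigma>\<close>; exchanging it for the gradient
  at the new \<open>\<sigma>\<close> and then at \<open>t\<close> costs \<open>b\<close> and
  \<open>c\<close>, replacing \<open>s\<close> by \<open>t\<close> costs \<open>a\<close>, the
  penalty costs \<open>e\<close>, and all four vanish.\<close>

lemma limit_minimizes:
  assumes p: "strict_mono p" and t: "t \<in> Kh P"
    and lim: "(\<lambda>j. gnorm (\<lambda>x. \<sigma> (Suc (Suc (p j))) x - t x)) \<longlonglongrightarrow> 0" and u: "u \<in> Kh P"
  shows "\<alpha> * grad_L1 P t + ipC P (Gh' P t) t \<le> \<alpha> * grad_L1 P u + ipC P (Gh' P t) u"
proof -
  obtain C where C: "0 \<le> C" "\<And>v. v \<in> Vh P \<Longrightarrow> grad_L1 P v \<le> C * gnorm v"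
    by (rule grad_L1_le_gnorm) (rule that)
  define C' where "C' = nC (Gh' P t) * (Cs * mesh_size P)"
  define U where "U = gnorm (\<lambda>x. u x - t x)"
  \<comment> \<open>The multiplier at index \<open>?k\<close> is used in the step to
    \<open>?q\<close> and must be a gradient, hence \<open>?k > 0\<close> and the shift by
    two.\<close>
  let ?k = "\<lambda>j. Suc (p j)"
  let ?q = "\<lambda>j. Suc (Suc (p j))"
  define a where "a j = gnorm (\<lambda>x. t x - s (?q j) x)" for j
  define b where "b j = gnorm (\<lambda>x. \<sigma> (?k j) x - \<sigma> (?q j) x)" for j
  define c where "c j = gnorm (\<lambda>x. \<sigma> (?q j) x - t x)" for j
  define e where "e j = gnorm (\<lambda>x. s (?q j) x - \<sigma> (?q j) x)" for j
  have V: "t \<in> Vh P" "u \<in> Vh P"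
    using t u by (auto simp: Kh_Vh)
  have q: "strict_mono ?q"
    using p by (simp add: strict_mono_def)
  have lims: "b \<longlonglongrightarrow> 0" "c \<longlonglongrightarrow> 0" "e \<longlonglongrightarrow> 0"
    using LIMSEQ_subseq_LIMSEQ[OF increments_tendsto_zero(1) p] lim
      LIMSEQ_subseq_LIMSEQ[OF gap_tendsto_zero q]
    by (simp_all add: b_def[abs_def] c_def[abs_def] e_def[abs_def] o_def)
  have "a \<longlonglongrightarrow> 0"
  proof (rule tendsto_sandwich)
    show "(\<lambda>j. 0 :: real) \<longlonglongrightarrow> 0" "(\<lambda>j. c j + e j) \<longlonglongrightarrow> 0"
      using tendsto_add[OF lims(2,3)] by auto
    have "a j \<le> c j + e j" for j
      using gnorm_triangle[of t "\<sigma> (?q j)" "s (?q j)"] gnorm_commute[of t "\<sigma> (?q j)"]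
        gnorm_commute[of "\<sigma> (?q j)" "s (?q j)"] V(1) by (simp add: a_def c_def e_def)
    then show "eventually (\<lambda>j. a j \<le> c j + e j) sequentially"
      by simp
  qed (simp add: a_def)
  let ?A = "\<alpha> * grad_L1 P u + ipC P (Gh' P t) u - (\<alpha> * grad_L1 P t + ipC P (Gh' P t) t)"
  have "0 \<le> ?A + \<alpha> * C * a j + (kap * b j + kap * c j + \<beta> * e j) * (U + a j) + C' * a j" for j
  proof -
    let ?s = "s (?q j)" and ?\<sigma> = "\<sigma> (?q j)" and ?g = "Gh' P (\<sigma> (?k j))"
    let ?d = "\<lambda>x. u x - ?s x"
    have "gnorm ?d \<le> U + a j"
      using gnorm_triangle[of u t ?s] V by (simp add: U_def a_def)
    note d = mult_left_mono[OF this]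
    have "0 \<le> \<alpha> * grad_L1 P u - \<alpha> * grad_L1 P ?s + ipC P ?g ?d + \<beta> * gip (\<lambda>x. ?s x - ?\<sigma> x) ?d"
      using opts[of "?k j", unfolded Lagr_y[OF y_Suc]] u \<alpha> by (intro s_optimality) simp_all
    moreover have "\<alpha> * grad_L1 P t \<le> \<alpha> * (grad_L1 P ?s + C * a j)"
    proof (intro mult_left_mono)
      have "grad_L1 P (\<lambda>x. 1 * ?s x + 1 * (t x - ?s x)) \<le> 1 * grad_L1 P ?s + 1 * grad_L1 P (\<lambda>x. t x - ?s x)"
        by (rule grad_L1_convex) (use V in simp_all)
      then show "grad_L1 P t \<le> grad_L1 P ?s + C * a j"
        using C(2)[of "\<lambda>x. t x - ?s x"] V by (simp add: a_def)
    qed (use \<alpha> in simp)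
    moreover have "ipC P ?g ?d \<le> ipC P (Gh' P ?\<sigma>) ?d + kap * b j * (U + a j)"
    proof -
      have "kap * b j * gnorm ?d \<le> kap * b j * (U + a j)"
        by (rule d) (simp add: b_def kap_pos less_imp_le)
      then show ?thesis
        using Gh'_Lipschitz_gnorm[of "\<sigma> (?k j)" ?\<sigma> u ?s, OF iterates_Kh(1) iterates_Kh(1) u iterates_Kh(2)]
        unfolding b_def by linarith
    qed
    moreover have "ipC P (Gh' P ?\<sigma>) ?d \<le> ipC P (Gh' P t) ?d + kap * c j * (U + a j)"
    proof -
      have "kap * c j * gnorm ?d \<le> kap * c j * (U + a j)"
        by (rule d) (simp add: c_def kap_pos less_imp_le)
      then show ?thesis
        using Gh'_Lipschitz_gnorm[of ?\<sigma> t u ?s, OF iterates_Kh(1) t u iterates_Kh(2)]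
        unfolding c_def by linarith
    qed
    moreover have "ipC P (Gh' P t) ?d \<le> ipC P (Gh' P t) u - ipC P (Gh' P t) t + C' * a j"
    proof -
      have "ipC P (Gh' P t) ?d = ipC P (Gh' P t) u - ipC P (Gh' P t) t + ipC P (Gh' P t) (\<lambda>x. t x - ?s x)"
        using t V by (simp add: ipC_diff_right)
      moreover have "ipC P (Gh' P t) (\<lambda>x. t x - ?s x) \<le> nC (Gh' P t) * nC (\<lambda>x. t x - ?s x)"
        using ipC_abs_le[of "Gh' P t" "\<lambda>x. t x - ?s x"] t V by (simp add: abs_le_iff)
      moreover have "nC (Gh' P t) * nC (\<lambda>x. t x - ?s x) \<le> nC (Gh' P t) * (Cs * mesh_size P * a j)"
        unfolding a_def using V by (intro mult_left_mono nC_le_gnorm) simp_all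
      ultimately show ?thesis
        by (simp add: C'_def mult.assoc)
    qed
    moreover have "\<beta> * gip (\<lambda>x. ?s x - ?\<sigma> x) ?d \<le> \<beta> * e j * (U + a j)"
    proof -
      have "gip (\<lambda>x. ?s x - ?\<sigma> x) ?d \<le> e j * gnorm ?d"
        using gip_abs_le[of "\<lambda>x. ?s x - ?\<sigma> x" ?d] V by (simp only: e_def abs_le_iff Vh_diff iterates_Vh)
      also have "\<dots> \<le> e j * (U + a j)"
        by (rule d) (simp add: e_def)
      finally show ?thesis
        using \<beta> kap_pos by (simp add: mult.assoc)
    qed
    ultimately show ?thesis
      by (simp only: distrib_right distrib_left mult.assoc)
  qed
  moreover have "(\<lambda>j. ?A + \<alpha> * C * a j + (kap * b j + kap * c j + \<beta> * e j) * (U + a j) + C' * a j)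
      \<longlonglongrightarrow> ?A + \<alpha> * C * 0 + (kap * 0 + kap * 0 + \<beta> * 0) * (U + 0) + C' * 0"
    by (intro tendsto_intros lims \<open>a \<longlonglongrightarrow> 0\<close>)
  ultimately have "0 \<le> ?A + \<alpha> * C * 0 + (kap * 0 + kap * 0 + \<beta> * 0) * (U + 0) + C' * 0"
    by (intro LIMSEQ_le_const) auto
  then show ?thesis
    by simp
qed

lemma limit_point:
  assumes lp: "L2_limit_point P \<sigma> s y \<sigma>' s' y'"
  shows "(AE x in muC P. y' x = Gh' P \<sigma>' x) \<and> (AE x in muC P. s' x - \<sigma>' x = 0) \<and>
    (\<exists>t. (AE x in muC P. t x = s' x) \<and>
      is_arg_min (\<lambda>u. \<alpha> * grad_L1 P u + ipC P (Gh' P \<sigma>') u) (\<lambda>u. u \<in> Kh P) t)"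
proof -
  obtain r where L2: "\<sigma>' \<in> L2 (muC P)" "s' \<in> L2 (muC P)" "y' \<in> L2 (muC P)" and r: "strict_mono (r :: nat \<Rightarrow> nat)"
    and lr: "(\<lambda>j. nC (\<lambda>x. \<sigma> (r j) x - \<sigma>' x)) \<longlonglongrightarrow> 0" "(\<lambda>j. nC (\<lambda>x. s (r j) x - s' x)) \<longlonglongrightarrow> 0"
      "(\<lambda>j. nC (\<lambda>x. y (r j) x - y' x)) \<longlonglongrightarrow> 0"
    using lp by (auto simp: L2_limit_point_def)
  \<comment> \<open>Since \<open>r (j + 2) \<ge> j + 2\<close> the subtraction is exact, and the
    indices take the form that \<open>limit_minimizes\<close> expects.\<close>
  define q where "q j = r (j + 2) - 2" for j
  have r2: "r (j + 2) = Suc (Suc (q j))" for j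
    using seq_suble[OF r, of "j + 2"] by (simp add: q_def)
  have q: "strict_mono q"
    unfolding strict_mono_def
  proof (intro allI impI)
    fix i j :: nat assume "i < j"
    then have "r (i + 2) < r (j + 2)"
      using r by (simp add: strict_mono_def)
    then show "q i < q j"
      unfolding r2 by simp
  qed
  have lq: "(\<lambda>j. nC (\<lambda>x. \<sigma> (Suc (Suc (q j))) x - \<sigma>' x)) \<longlonglongrightarrow> 0" "(\<lambda>j. nC (\<lambda>x. s (Suc (Suc (q j))) x - s' x)) \<longlonglongrightarrow> 0"
    "(\<lambda>j. nC (\<lambda>x. y (Suc (Suc (q j))) x - y' x)) \<longlonglongrightarrow> 0"
    using lr[THEN LIMSEQ_ignore_initial_segment[where k = 2]] unfolding r2 .
  \<comment> \<open>\<open>\<sigma>'\<close> is a limit in \<open>L2\<close> only and need not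
    belong to \<open>Kh\<close>. The pointwise limit \<open>t\<close> does, and will agree with it
    almost everywhere.\<close>
  obtain r1 t where r1: "strict_mono r1" and t: "t \<in> Kh P"
    and pw: "\<forall>x. (\<lambda>j. \<sigma> (Suc (Suc (q (r1 j)))) x) \<longlonglongrightarrow> t x"
    and gt: "(\<lambda>j. gnorm (\<lambda>x. \<sigma> (Suc (Suc (q (r1 j)))) x - t x)) \<longlonglongrightarrow> 0"
    using Kh_limit[of "\<lambda>j. \<sigma> (Suc (Suc (q j)))"] by auto
  define p where "p j = q (r1 j)" for j
  let ?p = "\<lambda>j. Suc (Suc (p j))"
  have p: "strict_mono p"
    using strict_mono_o[OF q r1] by (simp add: p_def[abs_def] o_def)
  have lp: "(\<lambda>j. nC (\<lambda>x. \<sigma> (?p j) x - \<sigma>' x)) \<longlonglongrightarrow> 0" "(\<lambda>j. nC (\<lambda>x. s (?p j) x - s' x)) \<longlonglongrightarrow> 0"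
    "(\<lambda>j. nC (\<lambda>x. y (?p j) x - y' x)) \<longlonglongrightarrow> 0"
    using lq[THEN LIMSEQ_subseq_LIMSEQ[OF _ r1]] by (simp_all add: o_def p_def)
  have tL2: "t \<in> L2 (muC P)"
    using t by (simp add: Kh_Vh)
  have limits_agree: "AE x in muC P. f x - g x = 0"
    if f: "f \<in> L2 (muC P)" and g: "g \<in> L2 (muC P)" and v: "\<And>j. v j \<in> L2 (muC P)"
      and lim: "(\<lambda>j. nC (\<lambda>x. v j x - f x)) \<longlonglongrightarrow> 0" "(\<lambda>j. nC (\<lambda>x. v j x - g x)) \<longlonglongrightarrow> 0" for f g v
  proof -
    have "nC (\<lambda>x. f x - g x) \<le> nC (\<lambda>x. v j x - f x) + nC (\<lambda>x. v j x - g x)" for j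
      using L2norm_triangle_diff[OF f v[of j] g] L2norm_minus_commute[of "muC P" f "v j"] by simp
    then have "nC (\<lambda>x. f x - g x) \<le> 0 + 0"
      by (intro LIMSEQ_le_const[OF tendsto_add[OF lim]]) auto
    then have "nC (\<lambda>x. f x - g x) = 0"
      by (simp add: antisym)
    then show ?thesis
      using L2norm_zero_AE[OF L2_diff[OF f g]] by blast
  qed
  have "(\<lambda>j. nC (\<lambda>x. \<sigma> (?p j) x - t x)) \<longlonglongrightarrow> 0"
    using gt t by (intro nC_tendsto_zero) (simp_all add: p_def Kh_Vh)
  from limits_agree[OF tL2 L2(1) _ this lp(1)] have t\<sigma>: "AE x in muC P. t x - \<sigma>' x = 0"
    by simp
  have "(\<lambda>j. nC (\<lambda>x. s (?p j) x - \<sigma>' x)) \<longlonglongrightarrow> 0"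
  proof (rule tendsto_sandwich)
    have pp: "strict_mono ?p"
      using p by (simp add: strict_mono_def)
    show "(\<lambda>j. 0 :: real) \<longlonglongrightarrow> 0" "(\<lambda>j. nC (\<lambda>x. s (?p j) x - \<sigma> (?p j) x) + nC (\<lambda>x. \<sigma> (?p j) x - \<sigma>' x)) \<longlonglongrightarrow> 0"
      using tendsto_add[OF LIMSEQ_subseq_LIMSEQ[OF constraint_tendsto_zero pp] lp(1)] by (auto simp: o_def)
    show "eventually (\<lambda>j. nC (\<lambda>x. s (?p j) x - \<sigma>' x) \<le>
        nC (\<lambda>x. s (?p j) x - \<sigma> (?p j) x) + nC (\<lambda>x. \<sigma> (?p j) x - \<sigma>' x)) sequentially"
      using L2norm_triangle_diff[OF Vh_L2 Vh_L2 L2(1)] by simp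
  qed simp
  from limits_agree[OF L2(2) L2(1) _ lp(2) this] have s\<sigma>: "AE x in muC P. s' x - \<sigma>' x = 0"
    by simp
  \<comment> \<open>\<open>Gh'\<close> sees only the class modulo null sets, so its value at
    \<open>\<sigma>'\<close> is the value at \<open>t\<close>, where well-posedness applies.\<close>
  have G: "Gh' P \<sigma>' = Gh' P t"
    using t\<sigma> by (intro Gh'_cong_AE) (auto elim!: eventually_mono)
  obtain r2 where r2: "strict_mono r2" "\<forall>x. (\<lambda>j. Gh' P (\<sigma> (?p (r2 j))) x) \<longlonglongrightarrow> Gh' P t x"
    using Gh'_limit[of "\<lambda>j. \<sigma> (?p j)" t] t pw unfolding p_def by auto
  have "AE x in muC P. y' x = Gh' P t x"
  proof (rule L2_limit_pointwise_unique[where f = "\<lambda>j. Gh' P (\<sigma> (?p (r2 j)))"])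
    \<comment> \<open>From index 1 on \<open>y\<close> equals the gradient almost everywhere, so
      \<open>y'\<close> is also the \<open>L2\<close> limit of the gradients.\<close>
    have "nC (\<lambda>x. Gh' P (\<sigma> (?p j)) x - y' x) = nC (\<lambda>x. y (?p j) x - y' x)" for j
    proof -
      have "AE x in muC P. (norm (Gh' P (\<sigma> (?p j)) x - y' x))\<^sup>2 = (norm (y (?p j) x - y' x))\<^sup>2"
        using y_Suc[of "Suc (p j)"] by eventually_elim simp
      from integral_lebesgue_on_cong_AE[OF sets_OmC this] show ?thesis
        by (simp add: L2norm_def)
    qed
    then show "(\<lambda>j. nC (\<lambda>x. Gh' P (\<sigma> (?p (r2 j))) x - y' x)) \<longlonglongrightarrow> 0"
      using LIMSEQ_subseq_LIMSEQ[OF lp(3) r2(1)] by (simp add: o_def)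
  qed (use r2(2) L2(3) in simp_all)
  moreover have "AE x in muC P. t x = s' x"
    using t\<sigma> s\<sigma> by eventually_elim simp
  moreover have "is_arg_min (\<lambda>u. \<alpha> * grad_L1 P u + ipC P (Gh' P t) u) (\<lambda>u. u \<in> Kh P) t"
    using limit_minimizes[OF p t gt[folded p_def]] t by (auto simp: is_arg_min_def not_less)
  ultimately show ?thesis
    using s\<sigma> unfolding G by blast
qed

end

text \<open>Since \<open>y 0\<close> is arbitrary, monotonicity is asserted from index 1, and from
  index 0 when \<open>y 0\<close> is the gradient. Limit points are \<open>L2\<close> functions, so
  the equalities hold almost everywhere and the minimizer \<open>t\<close> is a representative of
  \<open>s'\<close> in \<open>Kh\<close>.\<close>

theorem theorem4p1:
  fixes P :: eddy
    and Cs C0 \<alpha> \<beta> \<beta>0 \<beta>1 :: real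
    and \<sigma> s y :: "nat \<Rightarrow> R3 \<Rightarrow> real"
  assumes "setting P"
    and "inverse_Poincare_const P Cs"
    and "gradient_Lipschitz_const P C0"
    and "\<alpha> > 0"
    and "\<beta>0 = max (4 * C0 * Cs\<^sup>2) (2 * sqrt 2 * C0 * Cs\<^sup>2) / mesh_size P"
    and "\<beta>1 = 2 * C0 * Cs\<^sup>2 / mesh_size P"
    and "\<beta> > max \<beta>0 \<beta>1"
    and "modified_ADMM P \<alpha> \<beta> \<sigma> s y"
  shows
    "(decseq (\<lambda>k. Lagr P \<alpha> \<beta> (\<sigma> (Suc k)) (s (Suc k)) (y (Suc k))) \<and>
      ((AE x in muC P. y 0 x = Gh' P (\<sigma> 0) x) \<longrightarrow>
         decseq (\<lambda>k. Lagr P \<alpha> \<beta> (\<sigma> k) (s k) (y k))) \<and>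
      convergent (\<lambda>k. Lagr P \<alpha> \<beta> (\<sigma> k) (s k) (y k))) \<and>
     (\<lambda>k. L2norm (muC P) (\<lambda>x. s k x - \<sigma> k x)) \<longlonglongrightarrow> 0 \<and>
     (\<forall>\<sigma>' s' y'. L2_limit_point P \<sigma> s y \<sigma>' s' y' \<longrightarrow>
        (AE x in muC P. y' x = Gh' P \<sigma>' x) \<and>
        (AE x in muC P. s' x - \<sigma>' x = 0) \<and>
        (\<exists>t. (AE x in muC P. t x = s' x) \<and>
             is_arg_min (\<lambda>u. \<alpha> * grad_L1 P u + ipC P (Gh' P \<sigma>') u) (\<lambda>u. u \<in> Kh P) t))"
proof -
  interpret eddy_gradient_bound P Cs C0
    by unfold_locales (rule assms)+
  \<comment> \<open>This is the first entry of the maximum in \<open>\<beta>0\<close>.\<close>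
  have "4 * kap = 4 * C0 * Cs\<^sup>2 / mesh_size P"
    by (simp add: kap_def)
  also have "\<dots> \<le> \<beta>0"
    unfolding assms(5) using mesh_size_pos by (intro divide_right_mono) auto
  also have "\<dots> < \<beta>"
    using assms(7) by simp
  finally interpret eddy_ADMM P Cs C0 \<alpha> \<beta> \<sigma> s y
    using assms by unfold_locales auto
  show ?thesis
    using decseq_Lag_Suc decseq_Lag Lag_convergent constraint_tendsto_zero limit_point
    unfolding Lag_def[abs_def] by blast
qed

end
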